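(* The diameter measure of an FDFA can be computed in PSPACE: given a saturated FDFA $\mathcal F$ using duo-normalized acceptance, its positive diameter measure $|\mathcal F|_{\leadsto}^{+}$ and its negative diameter measure $|\mathcal F|_{\leadsto}^{-}$ can be computed in space polynomial in the size of $\mathcal F$.
   Context: $\Sigma$ is a finite alphabet. For a (complete deterministic) automaton $\mathcal A$ and $w\in\Sigma^*$, $\mathcal A(w)$ is the state reached from the initial state on reading $w$; $[\![\mathcal D]\!]$ is the language of a DFA $\mathcal D$. An FDFA is a pair $\mathcal F=(\mathcal Q,\{\mathcal P_q\}_{q\in Q})$ of a leading automaton structure $\mathcal Q$ (a complete deterministic automaton without acceptance, with state set $Q$) and a complete progress DFA $\mathcal P_q$ for each $q\in Q$; write $\mathcal P_u=\mathcal P_{\mathcal Q(u)}$ for $u\in\Sigma^*$. For $u\in\Sigma^*,v\in\Sigma^+$: $(u,v)$ is a decomposition of $w$ if $uv^\omega=w$; normalized if $\mathcal Q(uv)=\mathcal Q(u)$; duo-normalized if normalized and $\mathcal P_u(vv)=\mathcal P_u(v)$. With duo-normalized acceptance, $(u,v)\in[\![\mathcal F]\!]$ iff there is a duo-normalized decomposition $(x,y)$ of $uv^\omega$ with $y\in[\![\mathcal P_x]\!]$. $\mathcal F$ is saturated if, for every ultimately periodic word $w$, all duo-normalized decompositions $(x,y)$ of $w$ agree on whether $y\in[\![\mathcal P_x]\!]$. $(u,v)$ is persistent (wrt $\mathcal F$) if it is duo-normalized and for every $z\in\Sigma^*$ there is $i\ge 2$ with $\mathcal P_u(zv)=\mathcal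 P_u(zv^i)$. With $\prec$ the strict prefix relation, $v_1\prec v_2\prec\dots\prec v_k$ is a persistent chain of length $k$ wrt $u$ in $\mathcal F$ if $(u,v_i)$ is persistent for all $1\le i\le k$ and $(u,v_{i+1})\in[\![\mathcal F]\!]$ iff $(u,v_i)\notin[\![\mathcal F]\!]$ for all $1\le i<k$; it is positive if $(u,v_1)\in[\![\mathcal F]\!]$ and negative otherwise. $|\mathcal F|_{\leadsto}^{+}$ (resp. $|\mathcal F|_{\leadsto}^{-}$) is the maximal $k$ such that there are $u\in\Sigma^*$ and a positive (resp. negative) persistent chain of length $k$ wrt $u$ in $\mathcal F$ ($0$ if there is none). *)

theory Defs
  imports
    "HOL-Library.Omega_Words_Fun"
    "HOL-Library.Sublist"
    "HOL-Library.Extended_Nat"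
    "HOL-Computational_Algebra.Polynomial"
begin

text \<open>
  The alphabet is the whole type \<open>'a\<close>.  The states of an automaton are the numbers below
  \<open>num_states\<close>, so that automata can be written on the tape of a machine.
\<close>

record 'a automaton =
  num_states :: nat
  init_state :: nat
  trans :: "nat \<Rightarrow> 'a \<Rightarrow> nat"

record 'a dfa = "'a automaton" +
  final :: "nat \<Rightarrow> bool"

definition complete_automaton :: "('a, 'z) automaton_scheme \<Rightarrow> bool" where
  "complete_automaton A \<longleftrightarrow> init_state A < num_states A \<and>
     (\<forall>q < num_states A. \<forall>a. trans A q a < num_states A)"

definition reach :: "('a, 'z) automaton_scheme \<Rightarrow> 'a list \<Rightarrow> nat" where
  "reach A w = foldl (trans A) (init_state A) w"

definition dfa_language :: "'a dfa \<Rightarrow> 'a list set" where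
  "dfa_language D = {w. final D (reach D w)}"

record 'a fdfa =
  leading :: "'a automaton"
  progress :: "nat \<Rightarrow> 'a dfa"

definition is_fdfa :: "'a fdfa \<Rightarrow> bool" where
  "is_fdfa F \<longleftrightarrow> complete_automaton (leading F) \<and>
     (\<forall>q < num_states (leading F). complete_automaton (progress F q))"

definition progress_of :: "'a fdfa \<Rightarrow> 'a list \<Rightarrow> 'a dfa" where
  "progress_of F u = progress F (reach (leading F) u)"

definition decomposition :: "'a word \<Rightarrow> 'a list \<Rightarrow> 'a list \<Rightarrow> bool" where
  "decomposition w u v \<longleftrightarrow> v \<noteq> [] \<and> u \<frown> v\<^sup>\<omega> = w"

definition normalized :: "'a fdfa \<Rightarrow> 'a list \<Rightarrow> 'a list \<Rightarrow> bool" where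
  "normalized F u v \<longleftrightarrow> v \<noteq> [] \<and> reach (leading F) (u @ v) = reach (leading F) u"

definition duo_normalized :: "'a fdfa \<Rightarrow> 'a list \<Rightarrow> 'a list \<Rightarrow> bool" where
  "duo_normalized F u v \<longleftrightarrow> normalized F u v \<and>
     reach (progress_of F u) (v @ v) = reach (progress_of F u) v"

definition fdfa_language :: "'a fdfa \<Rightarrow> ('a list \<times> 'a list) set" where
  "fdfa_language F = {(u, v). v \<noteq> [] \<and>
     (\<exists>x y. decomposition (u \<frown> v\<^sup>\<omega>) x y \<and> duo_normalized F x y \<and>
            y \<in> dfa_language (progress_of F x))}"

text \<open>Words that are not ultimately periodic have no decomposition, so \<open>w\<close> may range over all
  \<open>\<omega>\<close>-words.\<close>

definition saturated :: "'a fdfa \<Rightarrow> bool" where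
  "saturated F \<longleftrightarrow> (\<forall>w x y x' y'.
     decomposition w x y \<and> duo_normalized F x y \<and>
     decomposition w x' y' \<and> duo_normalized F x' y' \<longrightarrow>
     (y \<in> dfa_language (progress_of F x) \<longleftrightarrow> y' \<in> dfa_language (progress_of F x')))"

definition persistent :: "'a fdfa \<Rightarrow> 'a list \<Rightarrow> 'a list \<Rightarrow> bool" where
  "persistent F u v \<longleftrightarrow> duo_normalized F u v \<and>
     (\<forall>z. \<exists>i\<ge>2. reach (progress_of F u) (z @ v) =
                reach (progress_of F u) (z @ concat (replicate i v)))"

definition persistent_chain :: "'a fdfa \<Rightarrow> 'a list \<Rightarrow> 'a list list \<Rightarrow> bool" where
  "persistent_chain F u vs \<longleftrightarrow> vs \<noteq> [] \<and>
     (\<forall>i < length vs. persistent F u (vs ! i)) \<and>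
     (\<forall>i. Suc i < length vs \<longrightarrow>
        strict_prefix (vs ! i) (vs ! Suc i) \<and>
        ((u, vs ! Suc i) \<in> fdfa_language F \<longleftrightarrow> (u, vs ! i) \<notin> fdfa_language F))"

definition positive_chain :: "'a fdfa \<Rightarrow> 'a list \<Rightarrow> 'a list list \<Rightarrow> bool" where
  "positive_chain F u vs \<longleftrightarrow> persistent_chain F u vs \<and> (u, hd vs) \<in> fdfa_language F"

definition negative_chain :: "'a fdfa \<Rightarrow> 'a list \<Rightarrow> 'a list list \<Rightarrow> bool" where
  "negative_chain F u vs \<longleftrightarrow> persistent_chain F u vs \<and> (u, hd vs) \<notin> fdfa_language F"

text \<open>
  The supremum in \<^typ>\<open>enat\<close> is \<open>0\<close> if there is no chain, the maximal length if chain lengths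
  are bounded, and \<open>\<infinity>\<close> otherwise.
\<close>

definition positive_diameter :: "'a fdfa \<Rightarrow> enat" where
  "positive_diameter F = Sup {enat (length vs) | u vs. positive_chain F u vs}"

definition negative_diameter :: "'a fdfa \<Rightarrow> enat" where
  "negative_diameter F = Sup {enat (length vs) | u vs. negative_chain F u vs}"

text \<open>
  As the alphabet is fixed, the total number of states and the length of the encoding below are
  polynomially related.
\<close>

definition fdfa_size :: "'a fdfa \<Rightarrow> nat" where
  "fdfa_size F = num_states (leading F) +
     (\<Sum>q < num_states (leading F). num_states (progress F q))"

definition encode_nat :: "nat \<Rightarrow> bool list" where
  "encode_nat n = replicate n True @ [False]"

definition encode_automaton :: "('a::enum, 'z) automaton_scheme \<Rightarrow> bool list" where
  "encode_automaton A = encode_nat (num_states A) @ encode_nat (init_state A) @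
     concat [encode_nat (trans A q a). q \<leftarrow> [0..<num_states A], a \<leftarrow> enum_class.enum]"

definition encode_dfa :: "'a::enum dfa \<Rightarrow> bool list" where
  "encode_dfa D = encode_automaton D @ map (final D) [0..<num_states D]"

definition encode_fdfa :: "'a::enum fdfa \<Rightarrow> bool list" where
  "encode_fdfa F = encode_automaton (leading F) @
     concat (map (\<lambda>q. encode_dfa (progress F q)) [0..<num_states (leading F)])"

text \<open>
  Deterministic Turing machines with finitely many two-way infinite read-write tapes.  States and
  tape symbols are initial segments of the natural numbers; the blank is \<open>0\<close> and the bits
  \<open>False\<close>, \<open>True\<close> are \<open>1\<close>, \<open>2\<close>.  The input is on tape \<open>0\<close>, the output on tape \<open>1\<close>.
\<close>

datatype move = Left | Stay | Right

record tm =
  tm_tapes :: nat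
  tm_symbols :: nat
  tm_states :: nat
  tm_start :: nat
  tm_halt :: nat
  tm_delta :: "nat \<Rightarrow> nat list \<Rightarrow> nat \<times> (nat \<times> move) list"

definition turing_machine :: "tm \<Rightarrow> bool" where
  "turing_machine M \<longleftrightarrow> 2 \<le> tm_tapes M \<and> 3 \<le> tm_symbols M \<and>
     tm_start M < tm_states M \<and> tm_halt M < tm_states M \<and>
     (\<forall>q syms. q < tm_states M \<and> q \<noteq> tm_halt M \<and>
        length syms = tm_tapes M \<and> set syms \<subseteq> {..<tm_symbols M} \<longrightarrow>
        (case tm_delta M q syms of (q', acts) \<Rightarrow>
           q' < tm_states M \<and> length acts = tm_tapes M \<and>
           fst ` set acts \<subseteq> {..<tm_symbols M}))"

text \<open>A tape is its content together with the position of its head.\<close>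

type_synonym tape = "(int \<Rightarrow> nat) \<times> int"
type_synonym config = "nat \<times> tape list"

definition read_tape :: "tape \<Rightarrow> nat" where
  "read_tape t = fst t (snd t)"

fun act_on_tape :: "tape \<Rightarrow> nat \<times> move \<Rightarrow> tape" where
  "act_on_tape (f, h) (s, m) =
     (f(h := s), (case m of Left \<Rightarrow> h - 1 | Stay \<Rightarrow> h | Right \<Rightarrow> h + 1))"

definition tm_step :: "tm \<Rightarrow> config \<Rightarrow> config" where
  "tm_step M c = (case c of (q, ts) \<Rightarrow>
     if q = tm_halt M then c
     else (case tm_delta M q (map read_tape ts) of (q', acts) \<Rightarrow>
             (q', map2 act_on_tape ts acts)))"

definition bit_symbol :: "bool \<Rightarrow> nat" where
  "bit_symbol b = (if b then 2 else 1)"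

definition input_tape :: "bool list \<Rightarrow> tape" where
  "input_tape x =
     (\<lambda>p. if 0 \<le> p \<and> p < int (length x) then bit_symbol (x ! nat p) else 0, 0)"

definition initial_config :: "tm \<Rightarrow> bool list \<Rightarrow> config" where
  "initial_config M x = (tm_start M, input_tape x # replicate (tm_tapes M - 1) (\<lambda>_. 0, 0))"

definition config_at :: "tm \<Rightarrow> bool list \<Rightarrow> nat \<Rightarrow> config" where
  "config_at M x t = (tm_step M ^^ t) (initial_config M x)"

text \<open>The output is the word that starts in cell \<open>0\<close> and ends before the first blank.\<close>

definition has_output :: "config \<Rightarrow> bool list \<Rightarrow> bool" where
  "has_output c y \<longleftrightarrow>
     (\<forall>i < length y. fst (snd c ! 1) (int i) = bit_symbol (y ! i)) \<and>
     fst (snd c ! 1) (int (length y)) = 0"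

text \<open>The cells, as pairs of a tape and a position, that are visited in the first \<open>T\<close> steps.\<close>

definition visited_cells :: "tm \<Rightarrow> bool list \<Rightarrow> nat \<Rightarrow> (nat \<times> int) set" where
  "visited_cells M x T =
     {(i, snd (snd (config_at M x t) ! i)) | i t. i < tm_tapes M \<and> t \<le> T}"

definition computes_in_space :: "tm \<Rightarrow> bool list \<Rightarrow> bool list \<Rightarrow> nat \<Rightarrow> bool" where
  "computes_in_space M x y s \<longleftrightarrow> (\<exists>T.
     fst (config_at M x T) = tm_halt M \<and>
     has_output (config_at M x T) y \<and>
     card (visited_cells M x T) \<le> s)"

text \<open>Binary notation with the least significant bit first; zero is the empty word.\<close>

fun binary :: "nat \<Rightarrow> bool list" where
  "binary n = (if n = 0 then [] else odd n # binary (n div 2))"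

declare binary.simps [simp del]

text \<open>
  The values of \<open>f\<close> on \<open>X\<close> are finite and can be computed in space polynomial in
  \<open>sz\<close>, where instances are presented to the machine through \<open>enc\<close>.  Instances outside \<open>X\<close>
  are unconstrained.
\<close>

definition poly_space_computable ::
  "('x \<Rightarrow> bool list) \<Rightarrow> ('x \<Rightarrow> nat) \<Rightarrow> 'x set \<Rightarrow> ('x \<Rightarrow> enat) \<Rightarrow> bool" where
  "poly_space_computable enc sz X f \<longleftrightarrow>
     (\<exists>M (p :: nat poly). turing_machine M \<and>
        (\<forall>x \<in> X. \<exists>k. f x = enat k \<and>
           computes_in_space M (enc x) (binary k) (poly p (sz x))))"

end

theory Submission
  imports Defs
begin

text \<open>
  Let \<open>S\<close> be the set of reachable states of a progress automaton and \<open>T\<^sub>v\<close> the map that \<open>v\<close> induces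
  on \<open>S\<close>.  A duo-normalized \<open>(u, v)\<close> is persistent iff \<open>T\<^sub>v\<close> is injective on its own image, and
  saturation forces the rank of \<open>T\<^sub>v\<close> to drop at every alternation of a persistent chain.  Hence chains
  are no longer than the number of states, and a chain of length \<open>k\<close> exists iff there is a path in
  the graph whose nodes are triples of a leading state, a map \<open>T\<^sub>v\<close> and the length reached so far, and
  whose edges append one letter to \<open>v\<close>.  Nodes have polynomial size, so Savitch's midpoint recursion
  decides the existence of the path in polynomial space.

  The machine is obtained by compilation.  A tape serves as a unary counter (its head position) or as
  an array of symbols, and arithmetic expressions contain a bounded sum, so that bounded quantifiers
  and hence the whole edge relation are single expressions.
\<close>

text \<open>Neither words nor nodes can be handled as numbers here. Counters are unary, so they hold
  only values polynomial in the input length, while there are \<open>2 ^ L\<close> nodes, with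
  \<open>L\<close> the number of bits of a node. Midpoints are therefore rows of bits, incremented
  bit by bit, and the recursion becomes a loop over \<open>2 * L\<close> levels: there are at most
  \<open>2 ^ (2 * L)\<close> edges, which bounds the steps of a path. Words are never stored;
  persistence and sign of a word depend only on its effect on the leading state and on its map. The
  bound on chain lengths serves twice: it limits the lengths to be tried, and it leaves the length
  component of a node polynomially many values. Since the last word of a chain is unknown, an extra
  edge forgets the word, so that the path ends in a single node for each length.

  Saturation is used twice: it reduces membership of \<open>(u, v)\<close> in the language to the
  run of \<open>v\<close> itself, and it forbids equal ranks. Space is accounted for by one
  parameter, a bound on all counters, carried from expressions to programs to head
  positions.\<close>

section \<open>Structured programs on Turing machines\<close>

text \<open>In a store \<open>(\<sigma>, \<alpha>)\<close>, cell \<open>-1\<close> of every tape carries the mark \<open>3\<close>, cell \<open>p \<ge> 0\<close> of tape \<open>i\<close>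
  carries \<open>\<alpha> i p\<close>, and its head is at position \<open>\<sigma> i - 1\<close>.  Thus \<open>\<sigma> i\<close> is a counter that can be
  tested for zero.\<close>

type_synonym store = "(nat \<Rightarrow> nat) \<times> (nat \<Rightarrow> nat \<Rightarrow> nat)"

datatype cmd = Halt | Inc nat | Dec nat | Put nat nat | Seq cmd cmd
  | Branch nat nat cmd cmd | Until nat nat cmd

definition scanned :: "store \<Rightarrow> nat \<Rightarrow> nat" where
  "scanned s x = (if fst s x = 0 then 3 else snd s x (fst s x - 1))"

text \<open>\<open>B\<close> guards only \<open>Inc\<close>, the single command that moves a head to
  the right, so a derivation exists only if no counter is ever raised above \<open>B\<close>: this
  is where space is accounted for. \<open>Put\<close> caps its symbol at 2, which keeps the mark 3
  out of the cells from 0 on.\<close>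

inductive exec :: "nat \<Rightarrow> cmd \<Rightarrow> store \<Rightarrow> store \<Rightarrow> bool" for B where
  exec_Halt: "exec B Halt s s"
| exec_Inc: "\<sigma> x < B \<Longrightarrow> exec B (Inc x) (\<sigma>, \<alpha>) (\<sigma>(x := Suc (\<sigma> x)), \<alpha>)"
| exec_Dec: "0 < \<sigma> x \<Longrightarrow> exec B (Dec x) (\<sigma>, \<alpha>) (\<sigma>(x := \<sigma> x - 1), \<alpha>)"
| exec_Put: "0 < \<sigma> x \<Longrightarrow> exec B (Put x v) (\<sigma>, \<alpha>) (\<sigma>, \<alpha>(x := (\<alpha> x)(\<sigma> x - 1 := min v 2)))"
| exec_Seq: "exec B c1 s s' \<Longrightarrow> exec B c2 s' s'' \<Longrightarrow> exec B (Seq c1 c2) s s''"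
| exec_Branch1: "scanned s x = v \<Longrightarrow> exec B c1 s s' \<Longrightarrow> exec B (Branch x v c1 c2) s s'"
| exec_Branch2: "scanned s x \<noteq> v \<Longrightarrow> exec B c2 s s' \<Longrightarrow> exec B (Branch x v c1 c2) s s'"
| exec_Until1: "scanned s x = v \<Longrightarrow> exec B (Until x v c) s s"
| exec_Until2: "scanned s x \<noteq> v \<Longrightarrow> exec B c s s' \<Longrightarrow> exec B (Until x v c) s' s'' \<Longrightarrow>
    exec B (Until x v c) s s''"

lemma exec_mono: "exec B c s s' \<Longrightarrow> B \<le> B' \<Longrightarrow> exec B' c s s'"
  by (induction rule: exec.induct) (auto intro: exec.intros simp del: One_nat_def)

text \<open>\<open>exec\<close> hides the intermediate stores, but every configuration counts for
  the visited cells. Each small step will be exactly one step of the machine, including the silent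
  ones that only unfold the control.\<close>

inductive small_step :: "nat \<Rightarrow> cmd \<times> store \<Rightarrow> cmd \<times> store \<Rightarrow> bool" for B where
  "\<sigma> x < B \<Longrightarrow> small_step B (Inc x, \<sigma>, \<alpha>) (Halt, \<sigma>(x := Suc (\<sigma> x)), \<alpha>)"
| "0 < \<sigma> x \<Longrightarrow> small_step B (Dec x, \<sigma>, \<alpha>) (Halt, \<sigma>(x := \<sigma> x - 1), \<alpha>)"
| "0 < \<sigma> x \<Longrightarrow> small_step B (Put x v, \<sigma>, \<alpha>)
     (Halt, \<sigma>, \<alpha>(x := (\<alpha> x)(\<sigma> x - 1 := min v 2)))"
| "small_step B (Seq Halt c2, s) (c2, s)"
| "c1 \<noteq> Halt \<Longrightarrow> small_step B (c1, s) (c1', s') \<Longrightarrow> small_step B (Seq c1 c2, s) (Seq c1' c2, s')"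
| "small_step B (Branch x v c1 c2, s) (if scanned s x = v then c1 else c2, s)"
| "small_step B (Until x v c, s)
     (if scanned s x = v then Halt else Seq c (Until x v c), s)"

lemma small_steps_Seq:
  "(small_step B)\<^sup>*\<^sup>* (c1, s) (c1', s') \<Longrightarrow> (small_step B)\<^sup>*\<^sup>* (Seq c1 c2, s) (Seq c1' c2, s')"
proof (induction rule: rtranclp_induct2)
  case (step c s' c' s'')
  have "c \<noteq> Halt" using step.hyps(2) by (auto elim: small_step.cases)
  then have "small_step B (Seq c c2, s') (Seq c' c2, s'')"
    using step.hyps(2) by (intro small_step.intros)
  then show ?case using step.IH by auto
qed auto

lemma exec_small_steps: "exec B c s s' \<Longrightarrow> (small_step B)\<^sup>*\<^sup>* (c, s) (Halt, s')"
proof (induction rule: exec.induct)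
  case (exec_Seq c1 s s' c2 s'')
  have "small_step B (Seq Halt c2, s') (c2, s')" by (intro small_step.intros)
  with exec_Seq.IH small_steps_Seq show ?case
    by (meson rtranclp.rtrancl_into_rtrancl rtranclp_trans)
next
  case (exec_Branch1 s x v c1 s' c2)
  have "small_step B (Branch x v c1 c2, s) (c1, s)"
    using small_step.intros(6)[of B x v c1 c2 s] exec_Branch1 by simp
  with exec_Branch1 show ?case by (meson converse_rtranclp_into_rtranclp)
next
  case (exec_Branch2 s x v c2 s' c1)
  have "small_step B (Branch x v c1 c2, s) (c2, s)"
    using small_step.intros(6)[of B x v c1 c2 s] exec_Branch2 by simp
  with exec_Branch2 show ?case by (meson converse_rtranclp_into_rtranclp)
next
  case (exec_Until1 s x v c)
  then show ?case using small_step.intros(7)[of B x v c s] by auto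
next
  case (exec_Until2 s x v c s' s'')
  have 1: "small_step B (Until x v c, s) (Seq c (Until x v c), s)"
    using small_step.intros(7)[of B x v c s] exec_Until2 by auto
  have 2: "small_step B (Seq Halt (Until x v c), s') (Until x v c, s')" by (intro small_step.intros)
  show ?case
    using 1 2 exec_Until2.IH small_steps_Seq
    by (meson converse_rtranclp_into_rtranclp rtranclp_trans)
qed (auto intro: small_step.intros simp del: One_nat_def)

text \<open>What the machine can see of \<open>small_step\<close>: only the scanned symbols, so the
  guards on the counters disappear. At most one tape is acted on, and a move writes back the symbol
  just read.\<close>

fun next_control :: "cmd \<Rightarrow> nat list \<Rightarrow> cmd \<times> (nat \<times> nat \<times> move) option" where
  "next_control Halt syms = (Halt, None)"
| "next_control (Inc x) syms = (Halt, Some (x, syms ! x, Right))"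
| "next_control (Dec x) syms = (Halt, Some (x, syms ! x, Left))"
| "next_control (Put x v) syms = (Halt, Some (x, min v 2, Stay))"
| "next_control (Seq c1 c2) syms = (if c1 = Halt then (c2, None)
     else (case next_control c1 syms of (c1', a) \<Rightarrow> (Seq c1' c2, a)))"
| "next_control (Branch x v c1 c2) syms = (if syms ! x = v then c1 else c2, None)"
| "next_control (Until x v c) syms = (if syms ! x = v then Halt else Seq c (Until x v c), None)"

text \<open>The finite control of the machine for a command consists of its residual commands.\<close>

fun residuals :: "cmd \<Rightarrow> cmd set" where
  "residuals Halt = {Halt}"
| "residuals (Inc x) = {Inc x, Halt}"
| "residuals (Dec x) = {Dec x, Halt}"
| "residuals (Put x v) = {Put x v, Halt}"
| "residuals (Seq c1 c2) = (\<lambda>r. Seq r c2) ` residuals c1 \<union> residuals c2"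
| "residuals (Branch x v c1 c2) = {Branch x v c1 c2} \<union> residuals c1 \<union> residuals c2"
| "residuals (Until x v c) = {Until x v c, Halt} \<union> (\<lambda>r. Seq r (Until x v c)) ` residuals c"

lemma finite_residuals: "finite (residuals c)"
  by (induction c) auto

lemma self_in_residuals: "c \<in> residuals c"
  by (induction c) auto

lemma Halt_in_residuals: "Halt \<in> residuals c"
  by (induction c) auto

lemma next_control_residual: "r \<in> residuals c \<Longrightarrow> fst (next_control r syms) \<in> residuals c"
proof (induction c arbitrary: r)
  case (Seq c1 c2)
  show ?case
  proof (cases "r \<in> residuals c2")
    case False
    then obtain r' where r': "r = Seq r' c2" "r' \<in> residuals c1" using Seq.prems by auto
    from Seq.IH(1)[OF r'(2)] show ?thesis
      by (cases "next_control r' syms") (auto simp: r' self_in_residuals)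
  qed (use Seq.IH in simp)
next
  case (Branch x v c1 c2)
  then show ?case by (auto simp: self_in_residuals)
next
  case (Until x v c)
  consider "r = Until x v c" | "r = Halt" | r' where "r = Seq r' (Until x v c)" "r' \<in> residuals c"
    using Until.prems by auto
  then show ?case
  proof cases
    case (3 r')
    from Until.IH[OF 3(2)] show ?thesis
      by (cases "next_control r' syms") (auto simp: 3)
  qed (auto simp: self_in_residuals)
qed auto

fun width :: "cmd \<Rightarrow> nat" where
  "width Halt = 0"
| "width (Inc x) = Suc x"
| "width (Dec x) = Suc x"
| "width (Put x v) = Suc x"
| "width (Seq c1 c2) = max (width c1) (width c2)"
| "width (Branch x v c1 c2) = max (Suc x) (max (width c1) (width c2))"
| "width (Until x v c) = max (Suc x) (width c)"

lemma next_control_symbol: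
  "next_control c syms = (c', Some (x, v, m)) \<Longrightarrow> width c \<le> length syms \<Longrightarrow>
   set syms \<subseteq> {..<4} \<Longrightarrow> v < 4"
proof (induction c arbitrary: c')
  case (Inc y)
  then have "v \<in> set syms" by auto
  with Inc show ?case by blast
next
  case (Dec y)
  then have "v \<in> set syms" by auto
  with Dec show ?case by blast
qed (auto split: if_splits prod.splits)

section \<open>Stores as tape contents\<close>

definition tape_actions :: "nat list \<Rightarrow> (nat \<times> nat \<times> move) option \<Rightarrow> (nat \<times> move) list" where
  "tape_actions syms a = map (\<lambda>i. case a of None \<Rightarrow> (syms ! i, Stay)
     | Some (x, v, m) \<Rightarrow> if i = x then (v, m) else (syms ! i, Stay)) [0..<length syms]"

definition represents :: "nat \<Rightarrow> store \<Rightarrow> tape list \<Rightarrow> bool" where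
  "represents K s ts \<longleftrightarrow> length ts = K \<and>
     (\<forall>i<K. snd (ts ! i) = int (fst s i) - 1 \<and> fst (ts ! i) (-1) = 3 \<and>
        (\<forall>p. fst (ts ! i) (int p) = snd s i p))"

lemma represents_read:
  assumes "represents K s ts" "i < K"
  shows "map read_tape ts ! i = scanned s i"
proof (cases "fst s i = 0")
  case True
  then show ?thesis using assms by (simp add: represents_def read_tape_def scanned_def)
next
  case False
  then have "int (fst s i) - 1 = int (fst s i - 1)" by simp
  moreover have "fst (ts ! i) (int (fst s i - 1)) = snd s i (fst s i - 1)"
    using assms by (simp add: represents_def)
  ultimately show ?thesis
    using assms False by (simp add: represents_def read_tape_def scanned_def)
qed

lemma act_Stay: "act_on_tape t (read_tape t, Stay) = t"
  by (cases t) (simp add: read_tape_def)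

lemma nth_tape_actions:
  assumes "i < length ts"
  shows "map2 act_on_tape ts (tape_actions (map read_tape ts) a) ! i =
    (case a of None \<Rightarrow> ts ! i
     | Some (x, v, m) \<Rightarrow> if i = x then act_on_tape (ts ! i) (v, m) else ts ! i)"
  using assms by (auto simp: tape_actions_def act_Stay split: option.splits)

lemma represents_move_Right:
  assumes "represents K (\<sigma>, \<alpha>) ts" "x < K"
  shows "represents K (\<sigma>(x := Suc (\<sigma> x)), \<alpha>)
    (map2 act_on_tape ts (tape_actions (map read_tape ts) (Some (x, map read_tape ts ! x, Right))))"
proof -
  have "act_on_tape (ts ! x) (map read_tape ts ! x, Right) = (fst (ts ! x), snd (ts ! x) + 1)"
    using assms by (cases "ts ! x") (auto simp: represents_def read_tape_def)
  then show ?thesis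
    using assms unfolding represents_def by (auto simp: nth_tape_actions tape_actions_def act_Stay)
qed

lemma represents_move_Left:
  assumes "represents K (\<sigma>, \<alpha>) ts" "x < K" "0 < \<sigma> x"
  shows "represents K (\<sigma>(x := \<sigma> x - 1), \<alpha>)
    (map2 act_on_tape ts (tape_actions (map read_tape ts) (Some (x, map read_tape ts ! x, Left))))"
proof -
  have "act_on_tape (ts ! x) (map read_tape ts ! x, Left) = (fst (ts ! x), snd (ts ! x) - 1)"
    using assms by (cases "ts ! x") (auto simp: represents_def read_tape_def)
  then show ?thesis
    using assms unfolding represents_def by (auto simp: nth_tape_actions tape_actions_def act_Stay)
qed

lemma represents_write:
  assumes "represents K (\<sigma>, \<alpha>) ts" "x < K" "0 < \<sigma> x"
  shows "represents K (\<sigma>, \<alpha>(x := (\<alpha> x)(\<sigma> x - 1 := v)))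
    (map2 act_on_tape ts (tape_actions (map read_tape ts) (Some (x, v, Stay))))"
proof -
  have "int (\<sigma> x) - 1 = int (\<sigma> x - 1)" using assms by simp
  then have "act_on_tape (ts ! x) (v, Stay) = ((fst (ts ! x))(int (\<sigma> x - 1) := v), snd (ts ! x))"
    using assms by (cases "ts ! x") (auto simp: represents_def read_tape_def)
  then show ?thesis
    using assms unfolding represents_def by (auto simp: nth_tape_actions tape_actions_def act_Stay)
qed

lemma represents_Stay:
  "represents K s ts \<Longrightarrow> represents K s (map2 act_on_tape ts (tape_actions (map read_tape ts) None))"
  unfolding represents_def by (auto simp: nth_tape_actions tape_actions_def act_Stay)

lemma small_step_simulation:
  assumes "small_step B (c, s) (c', s')" "represents K s ts" "width c \<le> K"
  shows "\<exists>a. next_control c (map read_tape ts) = (c', a) \<and>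
    represents K s' (map2 act_on_tape ts (tape_actions (map read_tape ts) a))"
  using assms
proof (induction "(c, s)" "(c', s')" arbitrary: c s c' s' rule: small_step.induct)
  case (1 \<sigma> x \<alpha>)
  then show ?case using represents_move_Right[of K \<sigma> \<alpha> ts x] by auto
next
  case (2 \<sigma> x \<alpha>)
  then show ?case using represents_move_Left[of K \<sigma> \<alpha> ts x] by auto
next
  case (3 \<sigma> x v \<alpha>)
  then show ?case using represents_write[of K \<sigma> \<alpha> ts x] by auto
next
  case (5 c1 s c1' s' c2)
  then show ?case by fastforce
next
  case (6 x v c1 c2 s)
  then show ?case using represents_read[of K s ts x] represents_Stay[of K s ts] by auto
next
  case (7 x v c s)
  then show ?case using represents_read[of K s ts x] represents_Stay[of K s ts] by auto
qed (auto simp: represents_Stay)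

lemma small_step_bound:
  "small_step B (c, s) (c', s') \<Longrightarrow> \<forall>i. fst s i \<le> B \<Longrightarrow> fst s' i \<le> B"
proof (induction "(c, s)" "(c', s')" arbitrary: c s c' s' rule: small_step.induct)
  case (2 \<sigma> x \<alpha>)
  then show ?case by (auto intro: order_trans[OF diff_le_self])
qed auto

section \<open>The machine of a command and the space that it uses\<close>

datatype control = Step_Left | Write_Mark | Run cmd

definition controls :: "cmd \<Rightarrow> control set" where
  "controls c = {Step_Left, Write_Mark} \<union> Run ` residuals c"

text \<open>The heads start in cell 0 and no tape carries a mark yet. Two extra control states step
  left on all tapes and write 3 there, which turns the initial tapes into those of
  \<open>input_store\<close>, with all counters 0.\<close>

definition machine_step :: "cmd \<Rightarrow> control \<Rightarrow> nat list \<Rightarrow> control \<times> (nat \<times> move) list" where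
  "machine_step c q syms = (case q of
     Step_Left \<Rightarrow> (Write_Mark, map (\<lambda>v. (v, Left)) syms)
   | Write_Mark \<Rightarrow> (Run c, map (\<lambda>v. (3, Stay)) syms)
   | Run r \<Rightarrow> (case next_control r syms of (r', a) \<Rightarrow> (Run r', tape_actions syms a)))"

text \<open>States of a machine must be numbers. An arbitrary numbering will do, because only the
  existence of a machine is claimed.\<close>

definition control_code :: "cmd \<Rightarrow> control \<Rightarrow> nat" where
  "control_code c = (SOME f. bij_betw f (controls c) {..<card (controls c)})"

definition control_of :: "cmd \<Rightarrow> nat \<Rightarrow> control" where
  "control_of c = the_inv_into (controls c) (control_code c)"

text \<open>At least two tapes, as the output is read from tape 1.\<close>

definition machine_tapes :: "cmd \<Rightarrow> nat" where
  "machine_tapes c = max 2 (width c)"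

definition machine :: "cmd \<Rightarrow> tm" where
  "machine c = \<lparr>tm_tapes = machine_tapes c, tm_symbols = 4, tm_states = card (controls c),
     tm_start = control_code c Step_Left, tm_halt = control_code c (Run Halt),
     tm_delta = (\<lambda>q syms. case machine_step c (control_of c q) syms of
       (q', acts) \<Rightarrow> (control_code c q', acts))\<rparr>"

lemma finite_controls: "finite (controls c)"
  by (simp add: controls_def finite_residuals)

lemma bij_control_code: "bij_betw (control_code c) (controls c) {..<card (controls c)}"
proof -
  have "\<exists>f. bij_betw f (controls c) {..<card (controls c)}"
    by (rule finite_same_card_bij) (simp_all add: finite_controls)
  then show ?thesis unfolding control_code_def by (rule someI_ex)
qed

lemma control_of_code: "q \<in> controls c \<Longrightarrow> control_of c (control_code c q) = q"
  unfolding control_of_def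
  by (rule the_inv_into_f_f[OF bij_betw_imp_inj_on[OF bij_control_code]])

lemma control_code_of:
  assumes "n < card (controls c)"
  shows "control_of c n \<in> controls c" "control_code c (control_of c n) = n"
proof -
  have n: "n \<in> control_code c ` controls c"
    using assms bij_betw_imp_surj_on[OF bij_control_code, of c] by simp
  show "control_of c n \<in> controls c"
    unfolding control_of_def
    by (rule the_inv_into_into[OF bij_betw_imp_inj_on[OF bij_control_code] n order_refl])
  show "control_code c (control_of c n) = n"
    unfolding control_of_def
    by (rule f_the_inv_into_f[OF bij_betw_imp_inj_on[OF bij_control_code] n])
qed

lemma control_code_less: "q \<in> controls c \<Longrightarrow> control_code c q < card (controls c)"
  using bij_betw_apply[OF bij_control_code] by blast

lemma control_code_inject:
  "q \<in> controls c \<Longrightarrow> q' \<in> controls c \<Longrightarrow> control_code c q = control_code c q' \<longleftrightarrow> q = q'"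
  by (metis control_of_code)

lemma Run_in_controls: "Run r \<in> controls c \<longleftrightarrow> r \<in> residuals c"
  by (auto simp: controls_def)

lemma residual_width: "r \<in> residuals c \<Longrightarrow> width r \<le> width c"
proof (induction c arbitrary: r)
  case (Until x v c)
  then consider "r = Until x v c" | "r = Halt" | r' where "r = Seq r' (Until x v c)" "r' \<in> residuals c"
    by auto
  then show ?case
    by cases (use Until.IH in \<open>auto simp: le_max_iff_disj\<close>)
qed (auto simp: le_max_iff_disj)

lemma machine_step_wf:
  assumes q: "q \<in> controls c" and syms: "length syms = machine_tapes c" "set syms \<subseteq> {..<4}"
    and step: "machine_step c q syms = (q', acts)"
  shows "q' \<in> controls c \<and> length acts = machine_tapes c \<and> fst ` set acts \<subseteq> {..<4}"
proof (cases q)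
  case Step_Left
  then show ?thesis using assms by (auto simp: machine_step_def controls_def)
next
  case Write_Mark
  then show ?thesis
    using assms self_in_residuals[of c] by (auto simp: machine_step_def controls_def)
next
  case (Run r)
  obtain r' a where a: "next_control r syms = (r', a)" by fastforce
  have r: "r \<in> residuals c" using q Run by (simp add: Run_in_controls)
  have "r' \<in> residuals c" using next_control_residual[OF r, of syms] a by simp
  moreover have "width r \<le> length syms"
    using residual_width[OF r] syms by (simp add: machine_tapes_def)
  then have "v < 4" if "a = Some (x, v, m)" for x v m
    using next_control_symbol a syms that by blast
  then have "fst ` set (tape_actions syms a) \<subseteq> {..<4}"
    using syms(2) by (cases a) (auto simp: tape_actions_def subset_iff split: if_splits)
  moreover have "q' = Run r'" "acts = tape_actions syms a"
    using step Run a by (auto simp: machine_step_def)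
  ultimately show ?thesis
    using syms(1) by (simp add: tape_actions_def Run_in_controls)
qed

lemma turing_machine_machine: "turing_machine (machine c)"
proof -
  have "case tm_delta (machine c) n syms of (q', acts) \<Rightarrow>
      q' < card (controls c) \<and> length acts = machine_tapes c \<and> fst ` set acts \<subseteq> {..<4}"
    if "n < card (controls c)" "length syms = machine_tapes c" "set syms \<subseteq> {..<4}" for n syms
  proof -
    obtain q' acts where m: "machine_step c (control_of c n) syms = (q', acts)" by fastforce
    then show ?thesis
      using machine_step_wf[OF control_code_of(1)[OF that(1)] that(2,3) m]
      by (simp add: machine_def control_code_less)
  qed
  moreover have "Step_Left \<in> controls c" "Run Halt \<in> controls c"
    by (auto simp: controls_def Halt_in_residuals)
  moreover have "tm_tapes (machine c) = machine_tapes c" "tm_symbols (machine c) = 4"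
    "tm_states (machine c) = card (controls c)" "tm_start (machine c) = control_code c Step_Left"
    "tm_halt (machine c) = control_code c (Run Halt)" "2 \<le> machine_tapes c"
    by (simp_all add: machine_def machine_tapes_def)
  ultimately show ?thesis
    unfolding turing_machine_def by (simp add: control_code_less)
qed

lemma tm_step_machine:
  assumes "q \<in> controls c" "q \<noteq> Run Halt" "machine_step c q (map read_tape ts) = (q', acts)"
  shows "tm_step (machine c) (control_code c q, ts) = (control_code c q', map2 act_on_tape ts acts)"
proof -
  have "Run Halt \<in> controls c" by (simp add: Run_in_controls Halt_in_residuals)
  then show ?thesis
    using assms by (simp add: tm_step_def machine_def control_code_inject control_of_code)
qed

definition input_store :: "bool list \<Rightarrow> store" where
  "input_store x = (\<lambda>_. 0, \<lambda>i p. if i = 0 \<and> p < length x then bit_symbol (x ! p) else 0)"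

lemma initial_represents:
  assumes K: "K = machine_tapes c"
  obtains ts where "config_at (machine c) x 2 = (control_code c (Run c), ts)"
    "represents K (input_store x) ts"
    "\<And>i t. t \<le> 2 \<Longrightarrow> i < K \<Longrightarrow> snd (snd (config_at (machine c) x t) ! i) \<in> {-1..0}"
proof -
  define ts0 where "ts0 = input_tape x # replicate (K - 1) (\<lambda>_. 0 :: nat, 0 :: int)"
  define ts1 where "ts1 = map2 act_on_tape ts0 (map (\<lambda>v. (v, Left)) (map read_tape ts0))"
  define ts2 where "ts2 = map2 act_on_tape ts1 (map (\<lambda>v. (3, Stay)) (map read_tape ts1))"
  have K2: "2 \<le> K" by (simp add: K machine_tapes_def)
  have [simp]: "length ts0 = K" using K2 by (simp add: ts0_def)
  then have [simp]: "length ts1 = K" "length ts2 = K" by (simp_all add: ts1_def ts2_def)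
  have 0: "snd (ts0 ! i) = 0" if "i < K" for i
    using that by (cases i) (auto simp: ts0_def input_tape_def)
  have 1: "ts1 ! i = (fst (ts0 ! i), -1)" if "i < K" for i
    using that 0[OF that] by (cases "ts0 ! i") (auto simp: ts1_def read_tape_def)
  have 2: "ts2 ! i = ((fst (ts0 ! i))(-1 := 3), -1)" if "i < K" for i
    using that 1[OF that] by (auto simp: ts2_def)
  have c0: "config_at (machine c) x 0 = (control_code c Step_Left, ts0)"
    by (simp add: config_at_def initial_config_def machine_def K ts0_def)
  have c1: "config_at (machine c) x (Suc 0) = (control_code c Write_Mark, ts1)"
    using tm_step_machine[of Step_Left c ts0] c0
    by (simp add: config_at_def controls_def machine_step_def ts1_def)
  have c2: "config_at (machine c) x 2 = (control_code c (Run c), ts2)"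
    using tm_step_machine[of Write_Mark c ts1] c1
    by (simp add: config_at_def controls_def machine_step_def ts2_def numeral_2_eq_2)
  have "fst (ts0 ! i) (int p) = snd (input_store x) i p" if "i < K" for i p
    using that by (cases i) (auto simp: ts0_def input_tape_def input_store_def)
  then have "represents K (input_store x) ts2"
    unfolding represents_def using 2 by (simp add: input_store_def)
  moreover have "snd (snd (config_at (machine c) x t) ! i) \<in> {-1..0}" if "t \<le> 2" "i < K" for t i
  proof -
    have "t = 0 \<or> t = Suc 0 \<or> t = 2" using that by arith
    then show ?thesis using 0 1 2 c0 c1 c2 that by auto
  qed
  ultimately show thesis using c2 that by blast
qed

text \<open>Counters up to \<open>B\<close> put the heads in cells -1 to \<open>B - 1\<close>, and
  the initial configuration has them in cell 0. Hence the \<open>B + 2\<close> cells from -1 to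
  \<open>B\<close> on each tape.\<close>

theorem exec_computes_in_space:
  assumes run: "exec B c (input_store x) s'"
    and out: "\<And>i. i < length y \<Longrightarrow> snd s' 1 i = bit_symbol (y ! i)" "snd s' 1 (length y) = 0"
  shows "computes_in_space (machine c) x y (machine_tapes c * (B + 2))"
proof -
  define K where "K = machine_tapes c"
  let ?C = "config_at (machine c) x"
  let ?ok = "\<lambda>t. \<forall>i<K. snd (snd (?C t) ! i) \<in> {-1..int B}"
  have reaches: "\<exists>t ts. ?C t = (control_code c (Run c'), ts) \<and> represents K s ts \<and>
      c' \<in> residuals c \<and> (\<forall>i. fst s i \<le> B) \<and> (\<forall>t'\<le>t. ?ok t')"
    if "(small_step B)\<^sup>*\<^sup>* (c, input_store x) (c', s)" for c' s
    using that
  proof (induction rule: rtranclp_induct2)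
    case refl
    obtain ts where "?C 2 = (control_code c (Run c), ts)" "represents K (input_store x) ts"
      "\<And>i t. t \<le> 2 \<Longrightarrow> i < K \<Longrightarrow> snd (snd (?C t) ! i) \<in> {-1..0}"
      using initial_represents[OF K_def, of x] by metis
    moreover have "\<forall>i. fst (input_store x) i \<le> B" by (simp add: input_store_def)
    ultimately show ?case using self_in_residuals[of c] by fastforce
  next
    case (step c1 s1 c2 s2)
    then obtain t ts where t: "?C t = (control_code c (Run c1), ts)" "represents K s1 ts"
      "c1 \<in> residuals c" "\<forall>i. fst s1 i \<le> B" "\<forall>t'\<le>t. ?ok t'"
      by blast
    have "width c1 \<le> K"
      using residual_width[OF t(3)] by (simp add: K_def machine_tapes_def)
    from small_step_simulation[OF step.hyps(2) t(2) this] obtain a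
      where a: "next_control c1 (map read_tape ts) = (c2, a)"
      and r: "represents K s2 (map2 act_on_tape ts (tape_actions (map read_tape ts) a))"
      by blast
    have "c1 \<noteq> Halt" using step.hyps(2) by (auto elim: small_step.cases)
    then have C: "?C (Suc t) = (control_code c (Run c2),
        map2 act_on_tape ts (tape_actions (map read_tape ts) a))"
      using tm_step_machine[of "Run c1" c ts] t(1,3) a
      by (simp add: config_at_def Run_in_controls machine_step_def)
    have b: "\<forall>i. fst s2 i \<le> B" using small_step_bound[OF step.hyps(2) t(4)] by simp
    have "snd (snd (?C (Suc t)) ! i) \<in> {-1..int B}" if "i < K" for i
    proof -
      have "snd (snd (?C (Suc t)) ! i) = int (fst s2 i) - 1"
        using r that unfolding C represents_def snd_conv by blast
      moreover have "fst s2 i \<le> B" using b by blast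
      ultimately show ?thesis by simp
    qed
    then have "\<forall>t'\<le>Suc t. ?ok t'" using t(5) by (auto simp: le_Suc_eq)
    moreover have "c2 \<in> residuals c" using next_control_residual[OF t(3)] a by (metis fst_conv)
    ultimately show ?case using C r b by blast
  qed
  obtain T ts where T: "?C T = (control_code c (Run Halt), ts)" "represents K s' ts"
    "\<forall>t\<le>T. ?ok t"
    using reaches[OF exec_small_steps[OF run]] by blast
  have "tm_halt (machine c) = control_code c (Run Halt)" by (simp add: machine_def)
  moreover have "2 \<le> K" by (simp add: K_def machine_tapes_def)
  then have "has_output (?C T) y"
    using T(2) out unfolding has_output_def represents_def T(1) by simp
  moreover have "visited_cells (machine c) x T \<subseteq> {..<K} \<times> {-1..int B}"
    using T(3) by (auto simp: visited_cells_def machine_def K_def)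
  then have "card (visited_cells (machine c) x T) \<le> card ({..<K} \<times> {-1..int B})"
    by (intro card_mono) auto
  then have "card (visited_cells (machine c) x T) \<le> K * (B + 2)"
    by (simp add: card_cartesian_product nat_add_distrib)
  ultimately show ?thesis
    unfolding computes_in_space_def K_def by (metis T(1) fst_conv)
qed

section \<open>Arithmetic expressions and while programs\<close>

datatype exp = Const nat | Var nat | Plus exp exp | Minus exp exp | Times exp exp
  | Cell nat exp | Sum nat exp exp

fun val :: "exp \<Rightarrow> (nat \<Rightarrow> nat) \<Rightarrow> (nat \<Rightarrow> nat \<Rightarrow> nat) \<Rightarrow> nat" where
  "val (Const n) \<sigma> \<alpha> = n"
| "val (Var x) \<sigma> \<alpha> = \<sigma> x"
| "val (Plus a b) \<sigma> \<alpha> = val a \<sigma> \<alpha> + val b \<sigma> \<alpha>"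
| "val (Minus a b) \<sigma> \<alpha> = val a \<sigma> \<alpha> - val b \<sigma> \<alpha>"
| "val (Times a b) \<sigma> \<alpha> = val a \<sigma> \<alpha> * val b \<sigma> \<alpha>"
| "val (Cell A e) \<sigma> \<alpha> = \<alpha> A (val e \<sigma> \<alpha>)"
| "val (Sum x a b) \<sigma> \<alpha> = (\<Sum>i<val a \<sigma> \<alpha>. val b (\<sigma>(x := i)) \<alpha>)"

text \<open>The tapes below \<open>na\<close> serve as arrays, those from \<open>na\<close> to \<open>nv\<close> as variables, and the others
  as scratch counters.\<close>

fun wf_exp :: "nat \<Rightarrow> nat \<Rightarrow> exp \<Rightarrow> bool" where
  "wf_exp na nv (Const n) \<longleftrightarrow> True"
| "wf_exp na nv (Var x) \<longleftrightarrow> na \<le> x \<and> x < nv"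
| "wf_exp na nv (Plus a b) \<longleftrightarrow> wf_exp na nv a \<and> wf_exp na nv b"
| "wf_exp na nv (Minus a b) \<longleftrightarrow> wf_exp na nv a \<and> wf_exp na nv b"
| "wf_exp na nv (Times a b) \<longleftrightarrow> wf_exp na nv a \<and> wf_exp na nv b"
| "wf_exp na nv (Cell A e) \<longleftrightarrow> A < na \<and> wf_exp na nv e"
| "wf_exp na nv (Sum x a b) \<longleftrightarrow> na \<le> x \<and> x < nv \<and> wf_exp na nv a \<and> wf_exp na nv b"

definition clear :: "nat \<Rightarrow> cmd" where
  "clear x = Until x 3 (Dec x)"

definition drain :: "nat \<Rightarrow> nat \<Rightarrow> cmd" where
  "drain x y = Until x 3 (Seq (Dec x) (Inc y))"

definition copy :: "nat \<Rightarrow> nat \<Rightarrow> nat \<Rightarrow> cmd" where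
  "copy x y t = Seq (Until x 3 (Seq (Dec x) (Seq (Inc y) (Inc t)))) (drain t x)"

text \<open>The contract is \<open>exec_code\<close>: with the counters from \<open>t\<close> on at
  zero, the value arrives in \<open>t\<close>, and all other counters, including array heads and
  variables, end as they began. \<open>Cell\<close> moves the head of the array itself to the cell
  and back; \<open>Sum\<close> runs its bound variable through the indices and keeps the old value
  in \<open>t + 2\<close>.\<close>

fun code :: "exp \<Rightarrow> nat \<Rightarrow> cmd" where
  "code (Const n) t = ((Seq (Inc t)) ^^ n) Halt"
| "code (Var x) t = copy x t (t + 1)"
| "code (Plus a b) t = Seq (code a t) (Seq (code b (t + 1)) (drain (t + 1) t))"
| "code (Minus a b) t = Seq (code a t) (Seq (code b (t + 1))
     (Until (t + 1) 3 (Seq (Dec (t + 1)) (Branch t 3 Halt (Dec t)))))"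
| "code (Times a b) t = Seq (code a (t + 1)) (Seq (code b (t + 2))
     (Seq (Until (t + 1) 3 (Seq (Dec (t + 1)) (copy (t + 2) t (t + 3)))) (clear (t + 2))))"
| "code (Cell A e) t = Seq (code e t) (Seq (Inc A) (Seq (drain t A)
     (Seq (Branch A 1 (Inc t) (Branch A 2 (Seq (Inc t) (Inc t)) Halt)) (clear A))))"
| "code (Sum x a b) t = Seq (code a (t + 1)) (Seq (drain x (t + 2))
     (Seq (Until (t + 1) 3 (Seq (Dec (t + 1)) (Seq (code b (t + 3)) (Seq (drain (t + 3) t) (Inc x)))))
     (Seq (clear x) (drain (t + 2) x))))"

text \<open>Bounds every intermediate counter and not only the value, in terms of a bound on the
  variables. In \<open>Sum\<close> the index stays below \<open>p\<close>, so the body is evaluated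
  with variables up to \<open>p\<close> plus the old bound; the summand \<open>[:0, 1:]\<close>
  covers the saved value of \<open>x\<close>. The 3 in \<open>Cell\<close> covers the head one step
  past the index and the symbol that is read.\<close>

fun exp_bound :: "exp \<Rightarrow> nat poly" where
  "exp_bound (Const n) = [:n:]"
| "exp_bound (Var x) = [:0, 1:]"
| "exp_bound (Plus a b) = exp_bound a + exp_bound b"
| "exp_bound (Minus a b) = exp_bound a + exp_bound b"
| "exp_bound (Times a b) = exp_bound a + exp_bound b + exp_bound a * exp_bound b"
| "exp_bound (Cell A e) = exp_bound e + [:3:]"
| "exp_bound (Sum x a b) = (let p = exp_bound a; q = pcompose (exp_bound b) (p + [:0, 1:])
     in [:0, 1:] + p + q + p * q)"

lemma poly_nat_mono: "m \<le> n \<Longrightarrow> poly p m \<le> poly p (n :: nat)"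
  by (induction p) (auto intro: add_mono mult_mono)

definition small_cells :: "(nat \<Rightarrow> nat \<Rightarrow> nat) \<Rightarrow> bool" where
  "small_cells \<alpha> \<longleftrightarrow> (\<forall>A p. \<alpha> A p \<le> 2)"

lemma scanned_mark: "small_cells \<alpha> \<Longrightarrow> scanned (\<sigma>, \<alpha>) x = 3 \<longleftrightarrow> \<sigma> x = 0"
proof -
  assume "small_cells \<alpha>"
  then have "\<alpha> x (\<sigma> x - 1) \<le> 2" by (simp add: small_cells_def)
  then show ?thesis by (auto simp: scanned_def)
qed

definition bounded_vars :: "nat \<Rightarrow> nat \<Rightarrow> nat \<Rightarrow> (nat \<Rightarrow> nat) \<Rightarrow> bool" where
  "bounded_vars na nv B \<sigma> \<longleftrightarrow> (\<forall>x. na \<le> x \<and> x < nv \<longrightarrow> \<sigma> x \<le> B)"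

definition scratch_clear :: "nat \<Rightarrow> nat \<Rightarrow> (nat \<Rightarrow> nat) \<Rightarrow> bool" where
  "scratch_clear na t \<sigma> \<longleftrightarrow> (\<forall>x. x < na \<or> t \<le> x \<longrightarrow> \<sigma> x = 0)"

lemma val_bound:
  assumes "small_cells \<alpha>"
  shows "wf_exp na nv e \<Longrightarrow> bounded_vars na nv B \<sigma> \<Longrightarrow> val e \<sigma> \<alpha> \<le> poly (exp_bound e) B"
proof (induction e arbitrary: \<sigma> B)
  case (Minus a b)
  then have "val a \<sigma> \<alpha> \<le> poly (exp_bound a) B" by simp
  then show ?case by simp
next
  case (Times a b)
  then have "val a \<sigma> \<alpha> * val b \<sigma> \<alpha> \<le> poly (exp_bound a) B * poly (exp_bound b) B"
    by (intro mult_mono) auto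
  then show ?case by simp
next
  case (Cell A e)
  have "\<alpha> A (val e \<sigma> \<alpha>) \<le> 2" using assms by (simp add: small_cells_def)
  then show ?case by simp
next
  case (Sum x a b)
  define p where "p = poly (exp_bound a) B"
  have a: "val a \<sigma> \<alpha> \<le> p" using Sum by (simp add: p_def)
  have "val b (\<sigma>(x := i)) \<alpha> \<le> poly (exp_bound b) (p + B)" if "i < val a \<sigma> \<alpha>" for i
  proof (rule Sum.IH(2))
    show "bounded_vars na nv (p + B) (\<sigma>(x := i))"
      using Sum.prems(2) that a unfolding bounded_vars_def by (auto intro: trans_le_add2)
  qed (use Sum.prems in simp)
  then have "(\<Sum>i<val a \<sigma> \<alpha>. val b (\<sigma>(x := i)) \<alpha>) \<le> (\<Sum>i<val a \<sigma> \<alpha>. poly (exp_bound b) (p + B))"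
    by (intro sum_mono) simp
  also have "\<dots> \<le> p * poly (exp_bound b) (p + B)" using a by simp
  finally show ?case by (simp add: Let_def poly_pcompose p_def)
qed (auto simp: bounded_vars_def intro: add_mono)

lemma exec_cong: "exec B c s s' \<Longrightarrow> s' = s'' \<Longrightarrow> exec B c s s''"
  by simp

text \<open>\<open>S i\<close> names the store after \<open>i\<close> rounds, so that a loop needs
  one explicit family of stores instead of an induction over derivations.\<close>

lemma exec_Until_count:
  assumes "\<And>i. i < m \<Longrightarrow> 0 < fst (S i) c" "fst (S m) c = 0"
    and "\<And>i. i \<le> m \<Longrightarrow> small_cells (snd (S i))"
    and "\<And>i. i < m \<Longrightarrow> exec B body (S i) (S (Suc i))"
  shows "exec B (Until c 3 body) (S 0) (S m)"
proof -
  have mark: "scanned (S i) c = 3 \<longleftrightarrow> fst (S i) c = 0" if "i \<le> m" for i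
    using scanned_mark[OF assms(3)[OF that], of "fst (S i)" c] by simp
  have "exec B (Until c 3 body) (S (m - j)) (S m)" if "j \<le> m" for j
    using that
  proof (induction j)
    case 0
    then show ?case using mark[of m] assms(2) by (simp add: exec_Until1)
  next
    case (Suc j)
    then have "scanned (S (m - Suc j)) c \<noteq> 3"
      using mark[of "m - Suc j"] assms(1)[of "m - Suc j"] by simp
    moreover have "exec B body (S (m - Suc j)) (S (m - j))"
      using assms(4)[of "m - Suc j"] Suc.prems by (simp add: Suc_diff_Suc)
    ultimately show ?case using Suc by (auto intro: exec_Until2)
  qed
  from this[of m] show ?thesis by simp
qed

lemma exec_clear:
  assumes "small_cells \<alpha>"
  shows "exec B (clear x) (\<sigma>, \<alpha>) (\<sigma>(x := 0), \<alpha>)"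
proof -
  have "exec B (Until x 3 (Dec x)) ((\<lambda>i. (\<sigma>(x := \<sigma> x - i), \<alpha>)) 0) ((\<lambda>i. (\<sigma>(x := \<sigma> x - i), \<alpha>)) (\<sigma> x))"
    by (rule exec_Until_count[of "\<sigma> x" "\<lambda>i. (\<sigma>(x := \<sigma> x - i), \<alpha>)"]) (use assms in \<open>auto intro!:
        exec_cong[OF exec_Dec]\<close>)
  then show ?thesis by (simp add: clear_def)
qed

lemma exec_drain:
  assumes "small_cells \<alpha>" "x \<noteq> y" "\<sigma> x + \<sigma> y \<le> B"
  shows "exec B (drain x y) (\<sigma>, \<alpha>) (\<sigma>(x := 0, y := \<sigma> x + \<sigma> y), \<alpha>)"
proof -
  let ?S = "\<lambda>i. (\<sigma>(x := \<sigma> x - i, y := i + \<sigma> y), \<alpha>)"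
  have "exec B (Until x 3 (Seq (Dec x) (Inc y))) (?S 0) (?S (\<sigma> x))"
  proof (rule exec_Until_count[of "\<sigma> x" ?S])
    fix i assume i: "i < \<sigma> x"
    show "exec B (Seq (Dec x) (Inc y)) (?S i) (?S (Suc i))"
      by (rule exec_Seq, rule exec_Dec, use i assms in simp, rule exec_cong[OF exec_Inc])
         (use i assms in \<open>auto simp: fun_eq_iff\<close>)
  qed (use assms in auto)
  then show ?thesis by (simp add: drain_def)
qed

lemma exec_copy:
  assumes "small_cells \<alpha>" "distinct [x, y, t]" "\<sigma> t = 0" "\<sigma> x + \<sigma> y \<le> B"
  shows "exec B (copy x y t) (\<sigma>, \<alpha>) (\<sigma>(y := \<sigma> x + \<sigma> y), \<alpha>)"
proof -
  let ?S = "\<lambda>i. (\<sigma>(x := \<sigma> x - i, y := i + \<sigma> y, t := i), \<alpha>)"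
  have 1: "exec B (Until x 3 (Seq (Dec x) (Seq (Inc y) (Inc t)))) (?S 0) (?S (\<sigma> x))"
  proof (rule exec_Until_count[of "\<sigma> x" ?S])
    fix i assume i: "i < \<sigma> x"
    show "exec B (Seq (Dec x) (Seq (Inc y) (Inc t))) (?S i) (?S (Suc i))"
      by (rule exec_Seq, rule exec_Dec, use i assms in simp, rule exec_Seq, rule exec_Inc,
          use i assms in simp, rule exec_cong[OF exec_Inc])
         (use i assms in \<open>auto simp: fun_eq_iff\<close>)
  qed (use assms in auto)
  have "?S 0 = (\<sigma>, \<alpha>)" using assms by (auto simp: fun_eq_iff)
  then have 2: "exec B (Until x 3 (Seq (Dec x) (Seq (Inc y) (Inc t)))) (\<sigma>, \<alpha>) (?S (\<sigma> x))"
    using 1 by simp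
  have 3: "exec B (drain t x) (?S (\<sigma> x)) (\<sigma>(y := \<sigma> x + \<sigma> y), \<alpha>)"
    by (rule exec_cong[OF exec_drain[OF assms(1)]]) (use assms in \<open>auto simp: fun_eq_iff\<close>)
  show ?thesis unfolding copy_def by (rule exec_Seq[OF 2 3])
qed

lemma val_cong:
  "wf_exp na nv e \<Longrightarrow> (\<And>x. na \<le> x \<Longrightarrow> x < nv \<Longrightarrow> \<sigma> x = \<sigma>' x) \<Longrightarrow> val e \<sigma> \<alpha> = val e \<sigma>' \<alpha>"
proof (induction e arbitrary: \<sigma> \<sigma>')
  case (Plus a b)
  show ?case using Plus.IH[of \<sigma> \<sigma>'] Plus.prems by simp
next
  case (Minus a b)
  show ?case using Minus.IH[of \<sigma> \<sigma>'] Minus.prems by simp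
next
  case (Times a b)
  show ?case using Times.IH[of \<sigma> \<sigma>'] Times.prems by simp
next
  case (Cell A e)
  show ?case using Cell.IH[of \<sigma> \<sigma>'] Cell.prems by simp
next
  case (Sum x a b)
  have "val a \<sigma> \<alpha> = val a \<sigma>' \<alpha>" using Sum.IH(1)[of \<sigma> \<sigma>'] Sum.prems by simp
  moreover have "val b (\<sigma>(x := i)) \<alpha> = val b (\<sigma>'(x := i)) \<alpha>" for i
    by (rule Sum.IH(2)) (use Sum.prems in auto)
  ultimately show ?case by simp
qed auto

text \<open>\<open>B\<close> and \<open>t\<close> vary in the induction: the body of a
  \<open>Sum\<close> runs with larger variables, and subexpressions are evaluated into later scratch
  counters.\<close>

lemma exec_code:
  assumes "small_cells \<alpha>"
  shows "wf_exp na nv e \<Longrightarrow> bounded_vars na nv B \<sigma> \<Longrightarrow> scratch_clear na t \<sigma> \<Longrightarrow> na \<le> nv \<Longrightarrow> nv \<le> t \<Longrightarrow>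
    exec (poly (exp_bound e) B) (code e t) (\<sigma>, \<alpha>) (\<sigma>(t := val e \<sigma> \<alpha>), \<alpha>)"
proof (induction e arbitrary: \<sigma> B t)
  case (Const n)
  have "exec n (((Seq (Inc t)) ^^ k) Halt) (\<sigma>(t := n - k), \<alpha>) (\<sigma>(t := n), \<alpha>)" if "k \<le> n" for k
    using that
  proof (induction k)
    case 0
    then show ?case by (auto intro: exec_Halt)
  next
    case (Suc k)
    have "exec n (Inc t) (\<sigma>(t := n - Suc k), \<alpha>) (\<sigma>(t := n - k), \<alpha>)"
      by (rule exec_cong[OF exec_Inc]) (use Suc.prems in \<open>auto simp: Suc_diff_Suc\<close>)
    then show ?case
      unfolding funpow.simps o_apply by (rule exec_Seq[OF _ Suc.IH]) (use Suc.prems in simp)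
  qed
  from this[of n] have "exec n (code (Const n) t) (\<sigma>(t := 0), \<alpha>) (\<sigma>(t := n), \<alpha>)" by simp
  moreover have "\<sigma>(t := 0) = \<sigma>" using Const by (auto simp: scratch_clear_def)
  moreover have "poly (exp_bound (Const n)) B = n" by simp
  ultimately show ?case by (simp only: val.simps)
next
  case (Var x)
  show ?case
    unfolding code.simps
    by (rule exec_cong[OF exec_copy[OF assms]])
       (use Var in \<open>auto simp: scratch_clear_def bounded_vars_def fun_eq_iff\<close>)
next
  case (Plus a b)
  let ?B = "poly (exp_bound (Plus a b)) B"
  have a: "exec ?B (code a t) (\<sigma>, \<alpha>) (\<sigma>(t := val a \<sigma> \<alpha>), \<alpha>)"
    by (rule exec_mono[OF Plus.IH(1)]) (use Plus.prems in auto)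
  \<comment> \<open>Expressions mention only variables below \<open>nv\<close>, and
    \<open>nv \<le> t\<close>: filling scratch counters does not change the value of
    \<open>b\<close>.\<close>
  have eq: "val b (\<sigma>(t := val a \<sigma> \<alpha>)) \<alpha> = val b \<sigma> \<alpha>"
    by (rule val_cong[of na nv]) (use Plus.prems in auto)
  have b: "exec ?B (code b (t + 1)) (\<sigma>(t := val a \<sigma> \<alpha>), \<alpha>)
      (\<sigma>(t := val a \<sigma> \<alpha>, t + 1 := val b \<sigma> \<alpha>), \<alpha>)"
    unfolding eq[symmetric]
    by (rule exec_mono[OF Plus.IH(2)])
       (use Plus.prems in \<open>auto simp: bounded_vars_def scratch_clear_def\<close>)
  have le: "val (Plus a b) \<sigma> \<alpha> \<le> ?B" by (rule val_bound[OF assms Plus.prems(1,2)])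
  show ?case
    unfolding code.simps
    by (rule exec_Seq[OF a], rule exec_Seq[OF b], rule exec_cong[OF exec_drain[OF assms]])
       (use Plus.prems le in \<open>auto simp: scratch_clear_def fun_eq_iff\<close>)
next
  case (Minus a b)
  let ?B = "poly (exp_bound (Minus a b)) B"
  let ?x = "val a \<sigma> \<alpha>" and ?y = "val b \<sigma> \<alpha>"
  let ?S = "\<lambda>i. (\<sigma>(t := ?x - i, t + 1 := ?y - i), \<alpha>)"
  have a: "exec ?B (code a t) (\<sigma>, \<alpha>) (\<sigma>(t := ?x), \<alpha>)"
    by (rule exec_mono[OF Minus.IH(1)]) (use Minus.prems in auto)
  have eq: "val b (\<sigma>(t := ?x)) \<alpha> = ?y"
    by (rule val_cong[of na nv]) (use Minus.prems in auto)
  have b: "exec ?B (code b (t + 1)) (\<sigma>(t := ?x), \<alpha>) (\<sigma>(t := ?x, t + 1 := ?y), \<alpha>)"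
    unfolding eq[symmetric]
    by (rule exec_mono[OF Minus.IH(2)])
       (use Minus.prems in \<open>auto simp: bounded_vars_def scratch_clear_def\<close>)
  have "exec ?B (Until (t + 1) 3 (Seq (Dec (t + 1)) (Branch t 3 Halt (Dec t)))) (?S 0) (?S ?y)"
  proof (rule exec_Until_count[of "?y" ?S])
    fix i assume i: "i < ?y"
    let ?\<sigma> = "\<sigma>(t := ?x - i, t + 1 := ?y - Suc i)"
    have 1: "exec ?B (Dec (t + 1)) (?S i) (?\<sigma>, \<alpha>)"
      by (rule exec_cong[OF exec_Dec]) (use i in auto)
    have 2: "exec ?B (Branch t 3 Halt (Dec t)) (?\<sigma>, \<alpha>) (?S (Suc i))"
    proof (cases "?x - i = 0")
      case True
      then have "scanned (?\<sigma>, \<alpha>) t = 3" by (simp add: scanned_mark[OF assms])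
      then show ?thesis by (rule exec_Branch1) (rule exec_cong[OF exec_Halt], use True in auto)
    next
      case False
      then have "scanned (?\<sigma>, \<alpha>) t \<noteq> 3" by (simp add: scanned_mark[OF assms])
      then show ?thesis
        by (rule exec_Branch2) (rule exec_cong[OF exec_Dec], use False in \<open>auto simp: fun_eq_iff\<close>)
    qed
    show "exec ?B (Seq (Dec (t + 1)) (Branch t 3 Halt (Dec t))) (?S i) (?S (Suc i))"
      by (rule exec_Seq[OF 1 2])
  qed (use assms in auto)
  moreover have "?S 0 = (\<sigma>(t := ?x, t + 1 := ?y), \<alpha>)" by simp
  ultimately have c: "exec ?B (Until (t + 1) 3 (Seq (Dec (t + 1)) (Branch t 3 Halt (Dec t))))
      (\<sigma>(t := ?x, t + 1 := ?y), \<alpha>) (?S ?y)" by simp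
  show ?case
    unfolding code.simps
    by (rule exec_Seq[OF a], rule exec_Seq[OF b], rule exec_cong[OF c])
       (use Minus.prems in \<open>auto simp: scratch_clear_def fun_eq_iff\<close>)
next
  case (Times a b)
  let ?B = "poly (exp_bound (Times a b)) B"
  let ?x = "val a \<sigma> \<alpha>" and ?y = "val b \<sigma> \<alpha>"
  let ?S = "\<lambda>i. (\<sigma>(t := i * ?y, t + 1 := ?x - i, t + 2 := ?y), \<alpha>)"
  have a: "exec ?B (code a (t + 1)) (\<sigma>, \<alpha>) (\<sigma>(t + 1 := ?x), \<alpha>)"
    by (rule exec_mono[OF Times.IH(1)]) (use Times.prems in \<open>auto simp: scratch_clear_def\<close>)
  have eq: "val b (\<sigma>(t + 1 := ?x)) \<alpha> = ?y"
    by (rule val_cong[of na nv]) (use Times.prems in auto)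
  have b: "exec ?B (code b (t + 2)) (\<sigma>(t + 1 := ?x), \<alpha>) (\<sigma>(t + 1 := ?x, t + 2 := ?y), \<alpha>)"
    unfolding eq[symmetric]
    by (rule exec_mono[OF Times.IH(2)])
       (use Times.prems in \<open>auto simp: bounded_vars_def scratch_clear_def\<close>)
  have le: "?x * ?y \<le> ?B" using val_bound[OF assms Times.prems(1,2)] by simp
  have y: "?y \<le> poly (exp_bound b) B" by (rule val_bound[OF assms, of na nv]) (use Times.prems in auto)
  have "exec ?B (Until (t + 1) 3 (Seq (Dec (t + 1)) (copy (t + 2) t (t + 3)))) (?S 0) (?S ?x)"
  proof (rule exec_Until_count[of "?x" ?S])
    fix i assume i: "i < ?x"
    have "Suc i * ?y \<le> ?x * ?y" using i by (intro mult_le_mono1) simp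
    then have le': "Suc i * ?y \<le> ?B" using le by (rule le_trans)
    show "exec ?B (Seq (Dec (t + 1)) (copy (t + 2) t (t + 3))) (?S i) (?S (Suc i))"
      by (rule exec_Seq, rule exec_Dec, use i in simp, rule exec_cong[OF exec_copy[OF assms]])
         (use i le' Times.prems in \<open>auto simp: scratch_clear_def fun_eq_iff\<close>)
  qed (use assms in auto)
  moreover have "?S 0 = (\<sigma>(t + 1 := ?x, t + 2 := ?y), \<alpha>)"
    using Times.prems by (auto simp: scratch_clear_def fun_eq_iff)
  ultimately have c: "exec ?B (Until (t + 1) 3 (Seq (Dec (t + 1)) (copy (t + 2) t (t + 3))))
      (\<sigma>(t + 1 := ?x, t + 2 := ?y), \<alpha>) (?S ?x)" by simp
  show ?case
    unfolding code.simps
    by (rule exec_Seq[OF a], rule exec_Seq[OF b], rule exec_Seq[OF c], rule exec_cong[OF exec_clear[OF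
        assms]])
       (use Times.prems in \<open>auto simp: scratch_clear_def fun_eq_iff\<close>)
next
  case (Cell A e)
  let ?B = "poly (exp_bound (Cell A e)) B"
  let ?i = "val e \<sigma> \<alpha>"
  have wf: "A < na" "wf_exp na nv e" using Cell.prems by auto
  have le: "?i \<le> poly (exp_bound e) B" by (rule val_bound[OF assms wf(2) Cell.prems(2)])
  have A: "\<sigma> A = 0" "A \<noteq> t" "\<sigma> t = 0" using Cell.prems by (auto simp: scratch_clear_def)
  have 1: "exec ?B (code e t) (\<sigma>, \<alpha>) (\<sigma>(t := ?i), \<alpha>)"
    by (rule exec_mono[OF Cell.IH]) (use Cell.prems in auto)
  \<comment> \<open>A counter at 0 stands on the mark, so cell \<open>i\<close> is reached with the
    counter at \<open>i + 1\<close>.\<close>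
  have 2: "exec ?B (Inc A) (\<sigma>(t := ?i), \<alpha>) (\<sigma>(t := ?i, A := 1), \<alpha>)"
    by (rule exec_cong[OF exec_Inc]) (use A in auto)
  have 3: "exec ?B (drain t A) (\<sigma>(t := ?i, A := 1), \<alpha>) (\<sigma>(A := Suc ?i), \<alpha>)"
    by (rule exec_cong[OF exec_drain[OF assms]]) (use A le in \<open>auto simp: fun_eq_iff\<close>)
  have sc: "scanned (\<sigma>(A := Suc ?i), \<alpha>) A = \<alpha> A ?i" by (simp add: scanned_def)
  have cell: "\<alpha> A ?i \<in> {0, 1, 2}"
  proof -
    have "\<alpha> A ?i \<le> 2" using assms by (simp add: small_cells_def)
    then show ?thesis by auto
  qed
  have 4: "exec ?B (Branch A 1 (Inc t) (Branch A 2 (Seq (Inc t) (Inc t)) Halt))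
      (\<sigma>(A := Suc ?i), \<alpha>) (\<sigma>(A := Suc ?i, t := \<alpha> A ?i), \<alpha>)"
  proof -
    consider "\<alpha> A ?i = 0" | "\<alpha> A ?i = 1" | "\<alpha> A ?i = 2" using cell by auto
    then show ?thesis
    proof cases
      case 1
      then show ?thesis
        using A by (intro exec_Branch2) (auto simp: sc fun_eq_iff intro!: exec_cong[OF exec_Halt])
    next
      case 2
      then show ?thesis
        using A by (intro exec_Branch1) (auto simp: sc fun_eq_iff intro!: exec_cong[OF exec_Inc])
    next
      case 3
      have "exec ?B (Seq (Inc t) (Inc t)) (\<sigma>(A := Suc ?i), \<alpha>) (\<sigma>(A := Suc ?i, t := \<alpha> A ?i), \<alpha>)"
        by (rule exec_Seq, rule exec_Inc, use A in simp, rule exec_cong[OF exec_Inc])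
           (use A 3 in auto)
      with 3 show ?thesis by (intro exec_Branch2 exec_Branch1) (auto simp: sc)
    qed
  qed
  show ?case
    unfolding code.simps
    by (rule exec_Seq[OF 1], rule exec_Seq[OF 2], rule exec_Seq[OF 3], rule exec_Seq[OF 4], rule
        exec_cong[OF exec_clear[OF assms]]) (use A in \<open>auto simp: fun_eq_iff\<close>)
next
  case (Sum x a b)
  let ?p = "poly (exp_bound a) B"
  let ?B = "poly (exp_bound (Sum x a b)) B"
  let ?m = "val a \<sigma> \<alpha>" and ?v = "\<lambda>i. val b (\<sigma>(x := i)) \<alpha>"
  have wf: "na \<le> x" "x < nv" "wf_exp na nv a" "wf_exp na nv b" using Sum.prems by auto
  have ne: "x \<noteq> t" "x < t" "\<sigma> t = 0" "\<sigma> (t + 1) = 0" "\<sigma> (t + 2) = 0" "\<sigma> (t + 3) = 0"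
    using Sum.prems by (auto simp: scratch_clear_def)
  have B: "?B = B + ?p + poly (exp_bound b) (?p + B) + ?p * poly (exp_bound b) (?p + B)"
    by (simp add: Let_def poly_pcompose)
  have m: "?m \<le> ?p" by (rule val_bound[OF assms wf(3) Sum.prems(2)])
  have x: "\<sigma> x \<le> B" using Sum.prems by (simp add: bounded_vars_def)
  have total: "(\<Sum>i<?m. ?v i) \<le> ?B" using val_bound[OF assms Sum.prems(1,2)] by simp
  have 1: "exec ?B (code a (t + 1)) (\<sigma>, \<alpha>) (\<sigma>(t + 1 := ?m), \<alpha>)"
    by (rule exec_mono[OF Sum.IH(1)]) (use Sum.prems B in \<open>auto simp: scratch_clear_def\<close>)
  let ?S = "\<lambda>i. (\<sigma>(t := (\<Sum>j<i. ?v j), t + 1 := ?m - i, t + 2 := \<sigma> x, x := i), \<alpha>)"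
  have 2: "exec ?B (drain x (t + 2)) (\<sigma>(t + 1 := ?m), \<alpha>) (?S 0)"
    by (rule exec_cong[OF exec_drain[OF assms]]) (use ne x B in \<open>auto simp: fun_eq_iff\<close>)
  have 3: "exec ?B (Until (t + 1) 3
      (Seq (Dec (t + 1)) (Seq (code b (t + 3)) (Seq (drain (t + 3) t) (Inc x))))) (?S 0) (?S ?m)"
  proof (rule exec_Until_count[of "?m" ?S])
    fix i assume i: "i < ?m"
    let ?\<sigma> = "\<sigma>(t := (\<Sum>j<i. ?v j), t + 1 := ?m - Suc i, t + 2 := \<sigma> x, x := i)"
    have 1: "exec ?B (Dec (t + 1)) (?S i) (?\<sigma>, \<alpha>)"
      by (rule exec_cong[OF exec_Dec]) (use i ne in auto)
    have eq: "val b ?\<sigma> \<alpha> = ?v i"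
      by (rule val_cong[OF wf(4)]) (use Sum.prems(5) in auto)
    have 2: "exec ?B (code b (t + 3)) (?\<sigma>, \<alpha>) (?\<sigma>(t + 3 := ?v i), \<alpha>)"
      unfolding eq[symmetric]
    proof (rule exec_mono[OF Sum.IH(2)])
      show "bounded_vars na nv (?p + B) ?\<sigma>"
        using Sum.prems i m by (auto simp: bounded_vars_def intro: trans_le_add2)
      show "scratch_clear na (t + 3) ?\<sigma>"
        using Sum.prems wf by (auto simp: scratch_clear_def)
    qed (use wf Sum.prems B in auto)
    \<comment> \<open>Partial sums stay below the total, which \<open>val_bound\<close>
      bounds.\<close>
    have "(\<Sum>j<Suc i. ?v j) \<le> (\<Sum>j<?m. ?v j)" using i by (intro sum_mono2) auto
    then have 3: "exec ?B (drain (t + 3) t) (?\<sigma>(t + 3 := ?v i), \<alpha>) (?\<sigma>(t := \<Sum>j<Suc i. ?v j), \<alpha>)"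
      using total by (intro exec_cong[OF exec_drain[OF assms]]) (use ne in \<open>auto simp: fun_eq_iff\<close>)
    have 4: "exec ?B (Inc x) (?\<sigma>(t := \<Sum>j<Suc i. ?v j), \<alpha>) (?S (Suc i))"
      by (rule exec_cong[OF exec_Inc]) (use ne i m B in \<open>auto simp: fun_eq_iff\<close>)
    show "exec ?B (Seq (Dec (t + 1)) (Seq (code b (t + 3)) (Seq (drain (t + 3) t) (Inc x))))
        (?S i) (?S (Suc i))"
      by (intro exec_Seq[OF 1] exec_Seq[OF 2] exec_Seq[OF 3] 4)
  qed (use assms ne in auto)
  let ?\<sigma> = "\<sigma>(t := (\<Sum>j<?m. ?v j), t + 2 := \<sigma> x, x := 0)"
  have 4: "exec ?B (clear x) (?S ?m) (?\<sigma>, \<alpha>)"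
    by (rule exec_cong[OF exec_clear[OF assms]]) (use ne in \<open>auto simp: fun_eq_iff\<close>)
  show ?case
    unfolding code.simps
    by (rule exec_Seq[OF 1], rule exec_Seq[OF 2], rule exec_Seq[OF 3], rule exec_Seq[OF 4], rule
        exec_cong[OF exec_drain[OF assms]]) (use ne x B in \<open>auto simp: fun_eq_iff\<close>)
qed

section \<open>While programs and their compilation\<close>

datatype com = Nop | Assign nat exp | Write nat exp exp | Then com com | Cond exp com com
  | Loop exp com

text \<open>\<open>B\<close> bounds only what is assigned to variables. The scratch counters that an
  evaluation needs on top are covered by \<open>com_bound\<close> at compilation.\<close>

inductive big_step :: "nat \<Rightarrow> com \<Rightarrow> store \<Rightarrow> store \<Rightarrow> bool" for B where
  big_Nop: "big_step B Nop s s"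
| big_Assign: "val e \<sigma> \<alpha> \<le> B \<Longrightarrow> big_step B (Assign x e) (\<sigma>, \<alpha>) (\<sigma>(x := val e \<sigma> \<alpha>), \<alpha>)"
| big_Write: "big_step B (Write A i e) (\<sigma>, \<alpha>)
    (\<sigma>, \<alpha>(A := (\<alpha> A)(val i \<sigma> \<alpha> := min (val e \<sigma> \<alpha>) 2)))"
| big_Then: "big_step B c1 s s' \<Longrightarrow> big_step B c2 s' s'' \<Longrightarrow> big_step B (Then c1 c2) s s''"
| big_Cond1: "val e \<sigma> \<alpha> \<noteq> 0 \<Longrightarrow> big_step B c1 (\<sigma>, \<alpha>) s' \<Longrightarrow> big_step B (Cond e c1 c2) (\<sigma>, \<alpha>) s'"
| big_Cond2: "val e \<sigma> \<alpha> = 0 \<Longrightarrow> big_step B c2 (\<sigma>, \<alpha>) s' \<Longrightarrow> big_step B (Cond e c1 c2) (\<sigma>, \<alpha>) s'"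
| big_Loop1: "val e \<sigma> \<alpha> = 0 \<Longrightarrow> big_step B (Loop e c) (\<sigma>, \<alpha>) (\<sigma>, \<alpha>)"
| big_Loop2: "val e \<sigma> \<alpha> \<noteq> 0 \<Longrightarrow> big_step B c (\<sigma>, \<alpha>) s' \<Longrightarrow> big_step B (Loop e c) s' s'' \<Longrightarrow>
    big_step B (Loop e c) (\<sigma>, \<alpha>) s''"

fun wf_com :: "nat \<Rightarrow> nat \<Rightarrow> com \<Rightarrow> bool" where
  "wf_com na nv Nop \<longleftrightarrow> True"
| "wf_com na nv (Assign x e) \<longleftrightarrow> na \<le> x \<and> x < nv \<and> wf_exp na nv e"
| "wf_com na nv (Write A i e) \<longleftrightarrow> A < na \<and> wf_exp na nv i \<and> wf_exp na nv e"
| "wf_com na nv (Then c1 c2) \<longleftrightarrow> wf_com na nv c1 \<and> wf_com na nv c2"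
| "wf_com na nv (Cond e c1 c2) \<longleftrightarrow> wf_exp na nv e \<and> wf_com na nv c1 \<and> wf_com na nv c2"
| "wf_com na nv (Loop e c) \<longleftrightarrow> wf_exp na nv e \<and> wf_com na nv c"

text \<open>\<open>Loop\<close> evaluates its test once before the \<open>Until\<close> and again at
  the end of each round, and every branch starts with the scratch counter at 0. \<open>Write\<close>
  tells the values 0, 1 and larger apart by decrementing, as cells hold at most 2.\<close>

fun compile :: "nat \<Rightarrow> com \<Rightarrow> cmd" where
  "compile t Nop = Halt"
| "compile t (Assign x e) = Seq (code e t) (Seq (clear x) (drain t x))"
| "compile t (Write A i e) = Seq (code i t) (Seq (code e (t + 1)) (Seq (Inc A) (Seq (drain t A)
     (Seq (Branch (t + 1) 3 (Put A 0) (Seq (Dec (t + 1)) (Branch (t + 1) 3 (Put A 1) (Put A 2))))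
     (Seq (clear (t + 1)) (clear A))))))"
| "compile t (Then c1 c2) = Seq (compile t c1) (compile t c2)"
| "compile t (Cond e c1 c2) = Seq (code e t)
     (Branch t 3 (compile t c2) (Seq (clear t) (compile t c1)))"
| "compile t (Loop e c) = Seq (code e t)
     (Until t 3 (Seq (clear t) (Seq (compile t c) (code e t))))"

fun com_bound :: "com \<Rightarrow> nat poly" where
  "com_bound Nop = 0"
| "com_bound (Assign x e) = exp_bound e + [:0, 1:]"
| "com_bound (Write A i e) = exp_bound i + exp_bound e + [:1:]"
| "com_bound (Then c1 c2) = com_bound c1 + com_bound c2"
| "com_bound (Cond e c1 c2) = exp_bound e + com_bound c1 + com_bound c2"
| "com_bound (Loop e c) = exp_bound e + com_bound c"

definition clean_store :: "nat \<Rightarrow> nat \<Rightarrow> nat \<Rightarrow> store \<Rightarrow> bool" where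
  "clean_store na nv B s \<longleftrightarrow>
     small_cells (snd s) \<and> bounded_vars na nv B (fst s) \<and> scratch_clear na nv (fst s)"

lemma clean_store_Assign:
  "clean_store na nv B (\<sigma>, \<alpha>) \<Longrightarrow> na \<le> x \<Longrightarrow> x < nv \<Longrightarrow> v \<le> B \<Longrightarrow> clean_store na nv B (\<sigma>(x := v), \<alpha>)"
  by (auto simp: clean_store_def bounded_vars_def scratch_clear_def)

lemma clean_store_Write:
  "clean_store na nv B (\<sigma>, \<alpha>) \<Longrightarrow> clean_store na nv B (\<sigma>, \<alpha>(A := (\<alpha> A)(i := min v 2)))"
  by (auto simp: clean_store_def small_cells_def)

lemma big_step_clean:
  "big_step B c s s' \<Longrightarrow> wf_com na nv c \<Longrightarrow> clean_store na nv B s \<Longrightarrow> clean_store na nv B s'"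
  by (induction rule: big_step.induct) (auto simp: clean_store_Assign clean_store_Write)

lemma exec_test:
  assumes "wf_exp na nv e" "clean_store na nv B (\<sigma>, \<alpha>)" "na \<le> nv"
  shows "exec (poly (exp_bound e) B) (code e nv) (\<sigma>, \<alpha>) (\<sigma>(nv := val e \<sigma> \<alpha>), \<alpha>)"
    "scanned (\<sigma>(nv := val e \<sigma> \<alpha>), \<alpha>) nv = 3 \<longleftrightarrow> val e \<sigma> \<alpha> = 0"
    "val e \<sigma> \<alpha> = 0 \<Longrightarrow> \<sigma>(nv := val e \<sigma> \<alpha>) = \<sigma>"
    "exec B' (clear nv) (\<sigma>(nv := val e \<sigma> \<alpha>), \<alpha>) (\<sigma>, \<alpha>)"
proof -
  have s: "small_cells \<alpha>" "bounded_vars na nv B \<sigma>" "scratch_clear na nv \<sigma>"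
    using assms(2) by (auto simp: clean_store_def)
  show "exec (poly (exp_bound e) B) (code e nv) (\<sigma>, \<alpha>) (\<sigma>(nv := val e \<sigma> \<alpha>), \<alpha>)"
    by (rule exec_code[OF s(1) assms(1) s(2,3) assms(3) order_refl])
  show "scanned (\<sigma>(nv := val e \<sigma> \<alpha>), \<alpha>) nv = 3 \<longleftrightarrow> val e \<sigma> \<alpha> = 0"
    by (simp add: scanned_mark[OF s(1)])
  show "val e \<sigma> \<alpha> = 0 \<Longrightarrow> \<sigma>(nv := val e \<sigma> \<alpha>) = \<sigma>" using s(3) by (auto simp: scratch_clear_def)
  show "exec B' (clear nv) (\<sigma>(nv := val e \<sigma> \<alpha>), \<alpha>) (\<sigma>, \<alpha>)"
    using s(3) by (intro exec_cong[OF exec_clear[OF s(1)]]) (auto simp: scratch_clear_def)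
qed

theorem exec_compile:
  "big_step B c s s' \<Longrightarrow> wf_com na nv c \<Longrightarrow> clean_store na nv B s \<Longrightarrow> na \<le> nv \<Longrightarrow>
   exec (poly (com_bound c) B) (compile nv c) s s'"
proof (induction rule: big_step.induct)
  case (big_Nop s)
  then show ?case by (auto intro: exec_Halt)
next
  case (big_Assign e \<sigma> \<alpha> x)
  have wf: "na \<le> x" "x < nv" "wf_exp na nv e" using big_Assign.prems by auto
  have s: "small_cells \<alpha>" "scratch_clear na nv \<sigma>" using big_Assign.prems by (auto simp: clean_store_def)
  let ?B = "poly (com_bound (Assign x e)) B"
  have 1: "exec ?B (code e nv) (\<sigma>, \<alpha>) (\<sigma>(nv := val e \<sigma> \<alpha>), \<alpha>)"
    by (rule exec_mono[OF exec_test(1)[OF wf(3) big_Assign.prems(2,3)]]) simp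
  show ?case
    unfolding compile.simps
    by (rule exec_Seq[OF 1], rule exec_Seq[OF exec_clear[OF s(1)]], rule exec_cong[OF exec_drain[OF s(1)]])
       (use wf s(2) big_Assign.hyps in \<open>auto simp: scratch_clear_def fun_eq_iff\<close>)
next
  case (big_Write A i e \<sigma> \<alpha>)
  have wf: "A < na" "wf_exp na nv i" "wf_exp na nv e" using big_Write.prems by auto
  have s: "small_cells \<alpha>" "bounded_vars na nv B \<sigma>" "scratch_clear na nv \<sigma>"
    using big_Write.prems by (auto simp: clean_store_def)
  let ?B = "poly (com_bound (Write A i e)) B" and ?i = "val i \<sigma> \<alpha>" and ?v = "val e \<sigma> \<alpha>"
  have ne: "A \<noteq> nv" "A < nv" "\<sigma> A = 0" "\<sigma> nv = 0" "\<sigma> (nv + 1) = 0"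
    using wf s(3) big_Write.prems by (auto simp: scratch_clear_def)
  have i: "?i \<le> poly (exp_bound i) B" by (rule val_bound[OF s(1) wf(2) s(2)])
  have 1: "exec ?B (code i nv) (\<sigma>, \<alpha>) (\<sigma>(nv := ?i), \<alpha>)"
    by (rule exec_mono[OF exec_test(1)[OF wf(2) big_Write.prems(2,3)]]) simp
  have eq: "val e (\<sigma>(nv := ?i)) \<alpha> = ?v"
    by (rule val_cong[OF wf(3)]) auto
  have 2: "exec ?B (code e (nv + 1)) (\<sigma>(nv := ?i), \<alpha>) (\<sigma>(nv := ?i, nv + 1 := ?v), \<alpha>)"
    unfolding eq[symmetric]
    by (rule exec_mono[OF exec_code[OF s(1) wf(3)]])
       (use s big_Write.prems in \<open>auto simp: bounded_vars_def scratch_clear_def\<close>)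
  have 3: "exec ?B (Inc A) (\<sigma>(nv := ?i, nv + 1 := ?v), \<alpha>) (\<sigma>(nv := ?i, nv + 1 := ?v, A := 1), \<alpha>)"
    by (rule exec_cong[OF exec_Inc]) (use ne in auto)
  have 4: "exec ?B (drain nv A) (\<sigma>(nv := ?i, nv + 1 := ?v, A := 1), \<alpha>)
      (\<sigma>(nv + 1 := ?v, A := Suc ?i), \<alpha>)"
    by (rule exec_cong[OF exec_drain[OF s(1)]]) (use ne i in \<open>auto simp: fun_eq_iff\<close>)
  let ?\<alpha> = "\<alpha>(A := (\<alpha> A)(?i := min ?v 2))"
  have "\<exists>w. exec ?B
      (Branch (nv + 1) 3 (Put A 0) (Seq (Dec (nv + 1)) (Branch (nv + 1) 3 (Put A 1) (Put A 2))))
      (\<sigma>(nv + 1 := ?v, A := Suc ?i), \<alpha>) (\<sigma>(nv + 1 := w, A := Suc ?i), ?\<alpha>)"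
  proof (cases "?v = 0")
    case True
    then have "scanned (\<sigma>(nv + 1 := ?v, A := Suc ?i), \<alpha>) (nv + 1) = 3"
      using ne by (simp add: scanned_mark[OF s(1)])
    moreover have "exec ?B (Put A 0) (\<sigma>(nv + 1 := ?v, A := Suc ?i), \<alpha>)
        (\<sigma>(nv + 1 := ?v, A := Suc ?i), ?\<alpha>)"
      by (rule exec_cong[OF exec_Put]) (use True in auto)
    ultimately show ?thesis by (blast intro: exec_Branch1)
  next
    case False
    then have sc: "scanned (\<sigma>(nv + 1 := ?v, A := Suc ?i), \<alpha>) (nv + 1) \<noteq> 3"
      using ne by (simp add: scanned_mark[OF s(1)])
    let ?s = "(\<sigma>(nv + 1 := ?v - 1, A := Suc ?i), \<alpha>)"
    have d: "exec ?B (Dec (nv + 1)) (\<sigma>(nv + 1 := ?v, A := Suc ?i), \<alpha>) ?s"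
      by (rule exec_cong[OF exec_Dec]) (use ne False in \<open>auto simp: fun_eq_iff\<close>)
    have "exec ?B (Branch (nv + 1) 3 (Put A 1) (Put A 2)) ?s (\<sigma>(nv + 1 := ?v - 1, A := Suc ?i), ?\<alpha>)"
    proof (cases "?v = 1")
      case True
      then have "scanned ?s (nv + 1) = 3" using ne by (simp add: scanned_mark[OF s(1)])
      then show ?thesis
        by (rule exec_Branch1) (rule exec_cong[OF exec_Put], use True in auto)
    next
      case v: False
      then have "scanned ?s (nv + 1) \<noteq> 3" using ne False by (simp add: scanned_mark[OF s(1)])
      moreover have "min ?v 2 = 2" using v False by auto
      ultimately show ?thesis
        by (intro exec_Branch2) (auto intro!: exec_cong[OF exec_Put])
    qed
    with d sc show ?thesis by (blast intro: exec_Branch2 exec_Seq)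
  qed
  then obtain w where 5: "exec ?B
      (Branch (nv + 1) 3 (Put A 0) (Seq (Dec (nv + 1)) (Branch (nv + 1) 3 (Put A 1) (Put A 2))))
      (\<sigma>(nv + 1 := ?v, A := Suc ?i), \<alpha>) (\<sigma>(nv + 1 := w, A := Suc ?i), ?\<alpha>)" by blast
  have \<alpha>': "small_cells ?\<alpha>" using s(1) by (auto simp: small_cells_def)
  show ?case
    unfolding compile.simps
    by (rule exec_Seq[OF 1], rule exec_Seq[OF 2], rule exec_Seq[OF 3], rule exec_Seq[OF 4], rule
        exec_Seq[OF 5], rule exec_Seq[OF exec_clear[OF \<alpha>']], rule exec_cong[OF exec_clear[OF \<alpha>']])
       (use ne in \<open>auto simp: fun_eq_iff\<close>)
next
  case (big_Then c1 s s' c2 s'')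
  have "clean_store na nv B s'" using big_step_clean[OF big_Then.hyps(1)] big_Then.prems by auto
  then show ?case
    using big_Then by (auto intro!: exec_Seq elim: exec_mono)
next
  case (big_Cond1 e \<sigma> \<alpha> c1 s' c2)
  have wf: "wf_exp na nv e" using big_Cond1.prems by simp
  note t = exec_test[OF wf big_Cond1.prems(2,3)]
  have "exec (poly (com_bound (Cond e c1 c2)) B) (compile nv c1) (\<sigma>, \<alpha>) s'"
    by (rule exec_mono[OF big_Cond1.IH]) (use big_Cond1.prems in auto)
  then show ?case
    using t(2) big_Cond1.hyps unfolding compile.simps
    by (intro exec_Seq[OF exec_mono[OF t(1)]] exec_Branch2 exec_Seq[OF t(4)]) auto
next
  case (big_Cond2 e \<sigma> \<alpha> c2 s' c1)
  have wf: "wf_exp na nv e" using big_Cond2.prems by simp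
  note t = exec_test[OF wf big_Cond2.prems(2,3)]
  have "exec (poly (com_bound (Cond e c1 c2)) B) (compile nv c2) (\<sigma>, \<alpha>) s'"
    by (rule exec_mono[OF big_Cond2.IH]) (use big_Cond2.prems in auto)
  then show ?case
    using t(2,3) big_Cond2.hyps unfolding compile.simps
    by (intro exec_Seq[OF exec_mono[OF t(1)]] exec_Branch1) auto
next
  case (big_Loop1 e \<sigma> \<alpha> c)
  have wf: "wf_exp na nv e" using big_Loop1.prems by simp
  note t = exec_test[OF wf big_Loop1.prems(2,3)]
  show ?case
    unfolding compile.simps
    by (rule exec_Seq[OF exec_mono[OF t(1)]], simp, rule exec_cong[OF exec_Until1])
       (use t(2,3) big_Loop1.hyps in auto)
next
  case (big_Loop2 e \<sigma> \<alpha> c s' s'')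
  have wf: "wf_exp na nv e" using big_Loop2.prems by simp
  note t = exec_test[OF wf big_Loop2.prems(2,3)]
  let ?B = "poly (com_bound (Loop e c)) B"
  have body: "exec ?B (compile nv c) (\<sigma>, \<alpha>) s'"
    by (rule exec_mono[OF big_Loop2.IH(1)]) (use big_Loop2.prems in auto)
  have "clean_store na nv B s'" using big_step_clean[OF big_Loop2.hyps(2)] big_Loop2.prems by auto
  then have "exec ?B (compile nv (Loop e c)) s' s''"
    using big_Loop2.IH(2) big_Loop2.prems by simp
  then have "exec ?B (Seq (code e nv) (Until nv 3 (Seq (clear nv) (Seq (compile nv c) (code e nv))))) s'
      s''"
    by (simp only: compile.simps)
  \<comment> \<open>The induction hypothesis is a run of the whole compiled loop. Its initial test
    is split off, because in the unrolled loop this test ends the first round.\<close>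
  then obtain s1 where s1: "exec ?B (code e nv) s' s1"
    "exec ?B (Until nv 3 (Seq (clear nv) (Seq (compile nv c) (code e nv)))) s1 s''"
    by (cases rule: exec.cases) blast
  have 1: "exec ?B (code e nv) (\<sigma>, \<alpha>) (\<sigma>(nv := val e \<sigma> \<alpha>), \<alpha>)"
    by (rule exec_mono[OF t(1)]) simp
  have "scanned (\<sigma>(nv := val e \<sigma> \<alpha>), \<alpha>) nv \<noteq> 3" using t(2) big_Loop2.hyps(1) by blast
  then show ?case
    unfolding compile.simps
    by (rule exec_Seq[OF 1 exec_Until2[OF _ exec_Seq[OF t(4) exec_Seq[OF body s1(1)]] s1(2)]])
qed

section \<open>Total correctness\<close>

fun exp_vars :: "exp \<Rightarrow> nat set" where
  "exp_vars (Const n) = {}"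
| "exp_vars (Var x) = {x}"
| "exp_vars (Plus a b) = exp_vars a \<union> exp_vars b"
| "exp_vars (Minus a b) = exp_vars a \<union> exp_vars b"
| "exp_vars (Times a b) = exp_vars a \<union> exp_vars b"
| "exp_vars (Cell A e) = exp_vars e"
| "exp_vars (Sum x a b) = exp_vars a \<union> (exp_vars b - {x})"

fun exp_arrays :: "exp \<Rightarrow> nat set" where
  "exp_arrays (Const n) = {}"
| "exp_arrays (Var x) = {}"
| "exp_arrays (Plus a b) = exp_arrays a \<union> exp_arrays b"
| "exp_arrays (Minus a b) = exp_arrays a \<union> exp_arrays b"
| "exp_arrays (Times a b) = exp_arrays a \<union> exp_arrays b"
| "exp_arrays (Cell A e) = insert A (exp_arrays e)"
| "exp_arrays (Sum x a b) = exp_arrays a \<union> exp_arrays b"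

lemma val_agree:
  "(\<And>x. x \<in> exp_vars e \<Longrightarrow> \<sigma> x = \<sigma>' x) \<Longrightarrow> (\<And>A. A \<in> exp_arrays e \<Longrightarrow> \<alpha> A = \<alpha>' A) \<Longrightarrow>
   val e \<sigma> \<alpha> = val e \<sigma>' \<alpha>'"
proof (induction e arbitrary: \<sigma> \<sigma>')
  case (Plus a b)
  show ?case using Plus.IH[of \<sigma> \<sigma>'] Plus.prems by simp
next
  case (Minus a b)
  show ?case using Minus.IH[of \<sigma> \<sigma>'] Minus.prems by simp
next
  case (Times a b)
  show ?case using Times.IH[of \<sigma> \<sigma>'] Times.prems by simp
next
  case (Cell A e)
  show ?case using Cell.IH[of \<sigma> \<sigma>'] Cell.prems by simp
next
  case (Sum x a b)
  have "val a \<sigma> \<alpha> = val a \<sigma>' \<alpha>'" using Sum.IH(1)[of \<sigma> \<sigma>'] Sum.prems by simp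
  moreover have "val b (\<sigma>(x := i)) \<alpha> = val b (\<sigma>'(x := i)) \<alpha>'" for i
    by (rule Sum.IH(2)) (use Sum.prems in auto)
  ultimately show ?case by simp
qed auto

lemma val_upd_var [simp]: "x \<notin> exp_vars e \<Longrightarrow> val e (\<sigma>(x := v)) \<alpha> = val e \<sigma> \<alpha>"
  by (rule val_agree) auto

lemma val_upd_array [simp]: "A \<notin> exp_arrays e \<Longrightarrow> val e \<sigma> (\<alpha>(A := f)) = val e \<sigma> \<alpha>"
  by (rule val_agree) auto

section \<open>Truth values, bounded quantifiers and minimisation as expressions\<close>

definition eNot :: "exp \<Rightarrow> exp" where "eNot a = Minus (Const 1) a"
definition eAnd :: "exp \<Rightarrow> exp \<Rightarrow> exp" where "eAnd a b = Times a b"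
definition eOr :: "exp \<Rightarrow> exp \<Rightarrow> exp" where "eOr a b = Plus a b"
definition eLess :: "exp \<Rightarrow> exp \<Rightarrow> exp" where "eLess a b = Minus b a"
definition eEq :: "exp \<Rightarrow> exp \<Rightarrow> exp" where "eEq a b = eNot (Plus (Minus a b) (Minus b a))"
definition eIff :: "exp \<Rightarrow> exp \<Rightarrow> exp" where "eIff a b = eOr (eAnd a b) (eAnd (eNot a) (eNot b))"
definition eImp :: "exp \<Rightarrow> exp \<Rightarrow> exp" where "eImp a b = eOr (eNot a) b"
definition eFlag :: "exp \<Rightarrow> exp" where "eFlag a = eNot (eNot a)"
definition eEx :: "nat \<Rightarrow> exp \<Rightarrow> exp \<Rightarrow> exp" where "eEx x a b = Sum x a b"
definition eAll :: "nat \<Rightarrow> exp \<Rightarrow> exp \<Rightarrow> exp" where "eAll x a b = eNot (Sum x a (eNot b))"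
text \<open>Minimisation by counting: the summand at \<open>x\<close> is 1 iff no
  \<open>y \<le> x\<close> satisfies \<open>b\<close>, so the sum is the least witness below
  \<open>a\<close>, or the value of \<open>a\<close> if there is none.\<close>

definition eMu :: "nat \<Rightarrow> nat \<Rightarrow> exp \<Rightarrow> (exp \<Rightarrow> exp) \<Rightarrow> exp" where
  "eMu x y a b = Sum x a (eAll y (Plus (Var x) (Const 1)) (eNot (b (Var y))))"

lemmas e_defs = eNot_def eAnd_def eOr_def eLess_def eEq_def eIff_def eImp_def eFlag_def eEx_def eAll_def
    eMu_def

definition holds :: "exp \<Rightarrow> (nat \<Rightarrow> nat) \<Rightarrow> (nat \<Rightarrow> nat \<Rightarrow> nat) \<Rightarrow> bool" where
  "holds e \<sigma> \<alpha> \<longleftrightarrow> val e \<sigma> \<alpha> \<noteq> 0"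

lemma holds_Sum [simp]: "holds (Sum x a b) \<sigma> \<alpha> \<longleftrightarrow> (\<exists>i<val a \<sigma> \<alpha>. holds b (\<sigma>(x := i)) \<alpha>)"
  by (auto simp: holds_def)

lemma holds_eNot [simp]: "holds (eNot a) \<sigma> \<alpha> \<longleftrightarrow> \<not> holds a \<sigma> \<alpha>"
  by (auto simp: holds_def eNot_def)

lemma holds_simps [simp]:
  "holds (eAnd a b) \<sigma> \<alpha> \<longleftrightarrow> holds a \<sigma> \<alpha> \<and> holds b \<sigma> \<alpha>"
  "holds (eOr a b) \<sigma> \<alpha> \<longleftrightarrow> holds a \<sigma> \<alpha> \<or> holds b \<sigma> \<alpha>"
  "holds (eLess a b) \<sigma> \<alpha> \<longleftrightarrow> val a \<sigma> \<alpha> < val b \<sigma> \<alpha>"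
  by (auto simp: holds_def eAnd_def eOr_def eLess_def)

lemma holds_derived [simp]:
  "holds (eEq a b) \<sigma> \<alpha> \<longleftrightarrow> val a \<sigma> \<alpha> = val b \<sigma> \<alpha>"
  "holds (eIff a b) \<sigma> \<alpha> \<longleftrightarrow> (holds a \<sigma> \<alpha> \<longleftrightarrow> holds b \<sigma> \<alpha>)"
  "holds (eImp a b) \<sigma> \<alpha> \<longleftrightarrow> (holds a \<sigma> \<alpha> \<longrightarrow> holds b \<sigma> \<alpha>)"
  "holds (eEx x a b) \<sigma> \<alpha> \<longleftrightarrow> (\<exists>i<val a \<sigma> \<alpha>. holds b (\<sigma>(x := i)) \<alpha>)"
  "holds (eAll x a b) \<sigma> \<alpha> \<longleftrightarrow> (\<forall>i<val a \<sigma> \<alpha>. holds b (\<sigma>(x := i)) \<alpha>)"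
  by (auto simp: eEq_def eIff_def eImp_def eEx_def eAll_def) (auto simp: holds_def)

lemma holds_Var [simp]: "holds (Var x) \<sigma> \<alpha> \<longleftrightarrow> \<sigma> x \<noteq> 0"
  by (simp add: holds_def)

lemma holds_Const [simp]: "holds (Const n) \<sigma> \<alpha> \<longleftrightarrow> n \<noteq> 0"
  by (simp add: holds_def)

lemma holds_Cell [simp]: "holds (Cell A e) \<sigma> \<alpha> \<longleftrightarrow> \<alpha> A (val e \<sigma> \<alpha>) \<noteq> 0"
  by (simp add: holds_def)

lemma val_eNot [simp]: "val (eNot a) \<sigma> \<alpha> = of_bool (\<not> holds a \<sigma> \<alpha>)"
  by (auto simp: holds_def eNot_def)

lemma val_flags [simp]:
  "val (eFlag a) \<sigma> \<alpha> = of_bool (holds a \<sigma> \<alpha>)"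
  "val (eAll x a b) \<sigma> \<alpha> = of_bool (\<forall>i<val a \<sigma> \<alpha>. holds b (\<sigma>(x := i)) \<alpha>)"
  "val (eEq a b) \<sigma> \<alpha> = of_bool (val a \<sigma> \<alpha> = val b \<sigma> \<alpha>)"
  using holds_derived(1)[of a b \<sigma> \<alpha>] by (auto simp: eFlag_def eAll_def eEq_def)

lemma exp_vars_e [simp]:
  "exp_vars (eNot a) = exp_vars a"
  "exp_vars (eAnd a b) = exp_vars a \<union> exp_vars b"
  "exp_vars (eOr a b) = exp_vars a \<union> exp_vars b"
  "exp_vars (eLess a b) = exp_vars a \<union> exp_vars b"
  "exp_vars (eEq a b) = exp_vars a \<union> exp_vars b"
  "exp_vars (eIff a b) = exp_vars a \<union> exp_vars b"
  "exp_vars (eImp a b) = exp_vars a \<union> exp_vars b"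
  "exp_vars (eFlag a) = exp_vars a"
  "exp_vars (eEx x a b) = exp_vars a \<union> (exp_vars b - {x})"
  "exp_vars (eAll x a b) = exp_vars a \<union> (exp_vars b - {x})"
  by (auto simp: e_defs)

lemma exp_arrays_e [simp]:
  "exp_arrays (eNot a) = exp_arrays a"
  "exp_arrays (eAnd a b) = exp_arrays a \<union> exp_arrays b"
  "exp_arrays (eOr a b) = exp_arrays a \<union> exp_arrays b"
  "exp_arrays (eLess a b) = exp_arrays a \<union> exp_arrays b"
  "exp_arrays (eEq a b) = exp_arrays a \<union> exp_arrays b"
  "exp_arrays (eIff a b) = exp_arrays a \<union> exp_arrays b"
  "exp_arrays (eImp a b) = exp_arrays a \<union> exp_arrays b"
  "exp_arrays (eFlag a) = exp_arrays a"
  "exp_arrays (eEx x a b) = exp_arrays a \<union> exp_arrays b"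
  "exp_arrays (eAll x a b) = exp_arrays a \<union> exp_arrays b"
  by (auto simp: e_defs)

lemma wf_exp_e [simp]:
  "wf_exp na nv (eNot a) \<longleftrightarrow> wf_exp na nv a"
  "wf_exp na nv (eAnd a b) \<longleftrightarrow> wf_exp na nv a \<and> wf_exp na nv b"
  "wf_exp na nv (eOr a b) \<longleftrightarrow> wf_exp na nv a \<and> wf_exp na nv b"
  "wf_exp na nv (eLess a b) \<longleftrightarrow> wf_exp na nv a \<and> wf_exp na nv b"
  "wf_exp na nv (eEq a b) \<longleftrightarrow> wf_exp na nv a \<and> wf_exp na nv b"
  "wf_exp na nv (eIff a b) \<longleftrightarrow> wf_exp na nv a \<and> wf_exp na nv b"
  "wf_exp na nv (eImp a b) \<longleftrightarrow> wf_exp na nv a \<and> wf_exp na nv b"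
  "wf_exp na nv (eFlag a) \<longleftrightarrow> wf_exp na nv a"
  "wf_exp na nv (eEx x a b) \<longleftrightarrow> na \<le> x \<and> x < nv \<and> wf_exp na nv a \<and> wf_exp na nv b"
  "wf_exp na nv (eAll x a b) \<longleftrightarrow> na \<le> x \<and> x < nv \<and> wf_exp na nv a \<and> wf_exp na nv b"
  "wf_exp na nv (eMu x y a f) \<longleftrightarrow> na \<le> x \<and> x < nv \<and> na \<le> y \<and> y < nv \<and> wf_exp na nv a \<and>
      wf_exp na nv (f (Var y))"
  by (auto simp: e_defs)

definition bounded_least :: "nat \<Rightarrow> (nat \<Rightarrow> bool) \<Rightarrow> nat" where
  "bounded_least n P = (LEAST i. i = n \<or> P i)"

lemma bounded_least:
  "bounded_least n P \<le> n"
  "bounded_least n P < n \<Longrightarrow> P (bounded_least n P)"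
  "i < bounded_least n P \<Longrightarrow> \<not> P i"
  unfolding bounded_least_def
  using LeastI[of "\<lambda>i. i = n \<or> P i" n] not_less_Least[of i "\<lambda>i. i = n \<or> P i"]
  by (auto intro: Least_le)

lemma bounded_least_eqI:
  assumes "k \<le> n" "k < n \<Longrightarrow> P k" "\<And>i. i < k \<Longrightarrow> \<not> P i"
  shows "bounded_least n P = k"
  using assms bounded_least[where n = n and P = P] by (metis le_neq_implies_less linorder_neqE_nat not_less)

lemma val_eMu:
  assumes "\<And>i j. i < val a \<sigma> \<alpha> \<Longrightarrow> j \<le> i \<Longrightarrow> holds (b (Var y)) (\<sigma>(x := i, y := j)) \<alpha> \<longleftrightarrow> P j"
    and "x \<noteq> y"
  shows "val (eMu x y a b) \<sigma> \<alpha> = bounded_least (val a \<sigma> \<alpha>) P"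
proof -
  let ?n = "val a \<sigma> \<alpha>"
  have "val (eMu x y a b) \<sigma> \<alpha> = (\<Sum>i<?n. of_bool (\<forall>j\<le>i. \<not> P j))"
    unfolding eMu_def using assms by (auto intro!: sum.cong simp: less_Suc_eq_le)
  also have "\<dots> = card {i. i < ?n \<and> (\<forall>j\<le>i. \<not> P j)}"
    by (simp add: Int_def lessThan_def sum_of_bool_eq)
  also have "{i. i < ?n \<and> (\<forall>j\<le>i. \<not> P j)} = {..<bounded_least ?n P}"
    using bounded_least[where n = ?n and P = P] by (auto simp: not_le) (meson le_less_trans not_le
        le_neq_implies_less)+
  finally show ?thesis by simp
qed

text \<open>Asks for a run that ends in \<open>Q\<close>, so termination and the bound
  \<open>B\<close> on the variables are part of the claim.\<close>

definition wp :: "nat \<Rightarrow> com \<Rightarrow> (store \<Rightarrow> bool) \<Rightarrow> store \<Rightarrow> bool" where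
  "wp B c Q s \<longleftrightarrow> (\<exists>s'. big_step B c s s' \<and> Q s')"

lemma wp_Nop: "Q s \<Longrightarrow> wp B Nop Q s"
  using big_Nop unfolding wp_def by blast

lemma wp_Assign:
  "val e \<sigma> \<alpha> \<le> B \<Longrightarrow> Q (\<sigma>(x := val e \<sigma> \<alpha>), \<alpha>) \<Longrightarrow> wp B (Assign x e) Q (\<sigma>, \<alpha>)"
  by (auto simp: wp_def intro: big_Assign)

lemma wp_Write:
  "Q (\<sigma>, \<alpha>(A := (\<alpha> A)(val i \<sigma> \<alpha> := min (val e \<sigma> \<alpha>) 2))) \<Longrightarrow> wp B (Write A i e) Q (\<sigma>, \<alpha>)"
  by (auto simp: wp_def intro: big_Write)

lemma wp_Then: "wp B c1 (wp B c2 Q) s \<Longrightarrow> wp B (Then c1 c2) Q s"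
  by (auto simp: wp_def intro: big_Then)

lemma wp_Cond:
  "(holds e \<sigma> \<alpha> \<Longrightarrow> wp B c1 Q (\<sigma>, \<alpha>)) \<Longrightarrow> (\<not> holds e \<sigma> \<alpha> \<Longrightarrow> wp B c2 Q (\<sigma>, \<alpha>)) \<Longrightarrow>
   wp B (Cond e c1 c2) Q (\<sigma>, \<alpha>)"
  by (cases "holds e \<sigma> \<alpha>") (auto simp: wp_def holds_def intro: big_Cond1 big_Cond2)

lemma wp_mono: "wp B c Q s \<Longrightarrow> (\<And>s'. Q s' \<Longrightarrow> Q' s') \<Longrightarrow> wp B c Q' s"
  by (auto simp: wp_def)

lemma wp_Loop_stop: "\<not> holds e \<sigma> \<alpha> \<Longrightarrow> Q (\<sigma>, \<alpha>) \<Longrightarrow> wp B (Loop e c) Q (\<sigma>, \<alpha>)"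
  by (auto simp: wp_def holds_def intro: big_Loop1)

lemma wp_Loop_step:
  "holds e \<sigma> \<alpha> \<Longrightarrow> wp B c (wp B (Loop e c) Q) (\<sigma>, \<alpha>) \<Longrightarrow> wp B (Loop e c) Q (\<sigma>, \<alpha>)"
  by (auto simp: wp_def holds_def intro: big_Loop2)

text \<open>For a loop whose rounds mirror the steps of an abstract transition system. Termination
  comes from the given finite path \<open>R\<^sup>*\<^sup>* t t'\<close> instead of a
  variant.\<close>

lemma wp_Loop_simulation:
  assumes "R\<^sup>*\<^sup>* t t'" "I t s"
    and "\<And>t t' \<sigma> \<alpha>. R t t' \<Longrightarrow> I t (\<sigma>, \<alpha>) \<Longrightarrow> holds e \<sigma> \<alpha> \<and> wp B c (I t') (\<sigma>, \<alpha>)"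
    and "\<And>\<sigma> \<alpha>. I t' (\<sigma>, \<alpha>) \<Longrightarrow> \<not> holds e \<sigma> \<alpha> \<and> Q (\<sigma>, \<alpha>)"
  shows "wp B (Loop e c) Q s"
  using assms(1,2)
proof (induction arbitrary: s rule: converse_rtranclp_induct)
  case base
  then show ?case using assms(4) by (cases s) (auto intro: wp_Loop_stop)
next
  case (step t u)
  obtain \<sigma> \<alpha> where s: "s = (\<sigma>, \<alpha>)" by (cases s)
  have h: "holds e \<sigma> \<alpha>" "wp B c (I u) (\<sigma>, \<alpha>)"
    using assms(3)[OF step.hyps(1)] step.prems s by auto
  show ?case unfolding s by (rule wp_Loop_step[OF h(1) wp_mono[OF h(2) step.IH]])
qed

lemma wp_Loop:
  assumes "I s" and "\<And>\<sigma> \<alpha>. I (\<sigma>, \<alpha>) \<Longrightarrow> holds e \<sigma> \<alpha> \<Longrightarrow>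
      wp B c (\<lambda>s'. I s' \<and> f s' < (f (\<sigma>, \<alpha>) :: nat)) (\<sigma>, \<alpha>)"
    and "\<And>\<sigma> \<alpha>. I (\<sigma>, \<alpha>) \<Longrightarrow> \<not> holds e \<sigma> \<alpha> \<Longrightarrow> Q (\<sigma>, \<alpha>)"
  shows "wp B (Loop e c) Q s"
  using assms(1)
proof (induction "f s" arbitrary: s rule: less_induct)
  case less
  obtain \<sigma> \<alpha> where s: "s = (\<sigma>, \<alpha>)" by (cases s)
  show ?case
  proof (cases "holds e \<sigma> \<alpha>")
    case True
    have "wp B c (wp B (Loop e c) Q) (\<sigma>, \<alpha>)"
      using assms(2)[of \<sigma> \<alpha>] less.prems True s less.hyps by (auto elim!: wp_mono)
    then show ?thesis unfolding s by (rule wp_Loop_step[OF True])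
  next
    case False
    then show ?thesis unfolding s using assms(3) less.prems s by (auto intro: wp_Loop_stop)
  qed
qed

definition Fill :: "nat \<Rightarrow> nat \<Rightarrow> exp \<Rightarrow> exp \<Rightarrow> exp \<Rightarrow> com" where
  "Fill i A b n e = Then (Assign i (Const 0)) (Loop (eLess (Var i) n)
     (Then (Write A (Plus b (Var i)) e) (Assign i (Plus (Var i) (Const 1)))))"

text \<open>As \<open>e\<close> does not read \<open>A\<close>, each new cell can be described by a
  value in the store before the loop.\<close>

lemma wp_Fill:
  assumes stable: "i \<notin> exp_vars b" "i \<notin> exp_vars n" "A \<notin> exp_arrays b" "A \<notin> exp_arrays n" "A \<notin> exp_arrays e"
    and B: "val n \<sigma> \<alpha> \<le> B"
    and Q: "Q (\<sigma>(i := val n \<sigma> \<alpha>), \<alpha>(A := (\<lambda>p. if val b \<sigma> \<alpha> \<le> p \<and> p < val b \<sigma> \<alpha> + val n \<sigma> \<alpha>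
        then min (val e (\<sigma>(i := p - val b \<sigma> \<alpha>)) \<alpha>) 2 else \<alpha> A p)))"
  shows "wp B (Fill i A b n e) Q (\<sigma>, \<alpha>)"
proof -
  let ?b = "val b \<sigma> \<alpha>" and ?n = "val n \<sigma> \<alpha>"
  let ?\<alpha> = "\<lambda>k. \<alpha>(A := (\<lambda>p. if ?b \<le> p \<and> p < ?b + k then min (val e (\<sigma>(i := p - ?b)) \<alpha>) 2 else \<alpha> A p))"
  let ?I = "\<lambda>s. \<exists>k\<le>?n. s = (\<sigma>(i := k), ?\<alpha> k)"
  have loop: "wp B (Loop (eLess (Var i) n) (Then (Write A (Plus b (Var i)) e)
      (Assign i (Plus (Var i) (Const 1))))) Q (\<sigma>(i := 0), \<alpha>)"
  proof (rule wp_Loop[where I = ?I and f = "\<lambda>s. ?n - fst s i"])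
    show "?I (\<sigma>(i := 0), \<alpha>)" by (auto intro!: exI[of _ 0] simp: fun_eq_iff)
  next
    fix \<sigma>' \<alpha>' assume "?I (\<sigma>', \<alpha>')" "holds (eLess (Var i) n) \<sigma>' \<alpha>'"
    then obtain k where k: "k < ?n" "\<sigma>' = \<sigma>(i := k)" "\<alpha>' = ?\<alpha> k" using stable by auto
    have "?\<alpha> (Suc k) = (?\<alpha> k)(A := (?\<alpha> k A)(?b + k := min (val e (\<sigma>(i := k)) \<alpha>) 2))"
      by (auto simp: fun_eq_iff)
    then show "wp B (Then (Write A (Plus b (Var i)) e) (Assign i (Plus (Var i) (Const 1))))
        (\<lambda>s'. ?I s' \<and> ?n - fst s' i < ?n - fst (\<sigma>', \<alpha>') i) (\<sigma>', \<alpha>')"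
      using k B stable by (intro wp_Then wp_Write wp_Assign) (auto intro!: exI[of _ "Suc k"])
  next
    fix \<sigma>' \<alpha>' assume "?I (\<sigma>', \<alpha>')" "\<not> holds (eLess (Var i) n) \<sigma>' \<alpha>'"
    then obtain k where "k = ?n" "\<sigma>' = \<sigma>(i := k)" "\<alpha>' = ?\<alpha> k" using stable by auto
    then show "Q (\<sigma>', \<alpha>')" using Q by simp
  qed
  show ?thesis unfolding Fill_def by (intro wp_Then wp_Assign) (use loop in auto)
qed

text \<open>Variable \<open>6\<close> holds the length of the input, and the variables \<open>30\<close> to \<open>33\<close> are bound here, so the
  arguments must not contain the latter.  The \<open>j\<close>-th unary number after position \<open>p\<close> starts after as
  many cells as have fewer than \<open>j\<close> separators between them and \<open>p\<close>.\<close>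

definition startE :: "exp \<Rightarrow> exp \<Rightarrow> exp" where
  "startE p j = Plus p (Sum 30 (Var 6) (eFlag (eLess
     (Sum 31 (Var 30) (eEq (Cell 0 (Plus p (Var 31))) (Const 1))) j)))"

definition tokenE :: "exp \<Rightarrow> exp \<Rightarrow> exp" where
  "tokenE p j = Sum 32 (Var 6) (eAll 33 (Plus (Var 32) (Const 1))
     (eEq (Cell 0 (Plus (startE p j) (Var 33))) (Const 2)))"

text \<open>What \<open>startE\<close> computes, as a function of the tape content \<open>f\<close>,
  and below it the same for \<open>tokenE\<close>. The symbol 1 is the bit \<open>False\<close>,
  which ends a unary number, and 2 is \<open>True\<close>.\<close>

definition token_start :: "(nat \<Rightarrow> nat) \<Rightarrow> nat \<Rightarrow> nat \<Rightarrow> nat \<Rightarrow> nat" where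
  "token_start f w p j = p + (\<Sum>i<w. of_bool ((\<Sum>l<i. of_bool (f (p + l) = 1)) < j))"

definition token :: "(nat \<Rightarrow> nat) \<Rightarrow> nat \<Rightarrow> nat \<Rightarrow> nat \<Rightarrow> nat" where
  "token f w p j = (\<Sum>i<w. of_bool (\<forall>l\<le>i. f (token_start f w p j + l) = 2))"

lemma val_startE [simp]:
  assumes "30 \<notin> exp_vars p" "31 \<notin> exp_vars p" "30 \<notin> exp_vars j"
  shows "val (startE p j) \<sigma> \<alpha> = token_start (\<alpha> 0) (\<sigma> 6) (val p \<sigma> \<alpha>) (val j \<sigma> \<alpha>)"
  using assms by (simp add: startE_def token_start_def)

lemma val_tokenE [simp]:
  assumes "exp_vars p \<inter> {30,31,32,33} = {}" "exp_vars j \<inter> {30,31,32,33} = {}"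
  shows "val (tokenE p j) \<sigma> \<alpha> = token (\<alpha> 0) (\<sigma> 6) (val p \<sigma> \<alpha>) (val j \<sigma> \<alpha>)"
  using assms by (simp add: tokenE_def token_def less_Suc_eq_le)

lemma exp_vars_token [simp]:
  "exp_vars (startE p j) = exp_vars p - {30, 31} \<union> exp_vars p \<union> (exp_vars j - {30}) \<union> {6}"
  "exp_arrays (startE p j) = insert 0 (exp_arrays p \<union> exp_arrays j)"
  "exp_arrays (tokenE p j) = insert 0 (exp_arrays p \<union> exp_arrays j)"
  by (auto simp: startE_def tokenE_def)

lemma exp_vars_tokenE [simp]:
  "x \<noteq> 6 \<Longrightarrow> x \<notin> exp_vars p \<Longrightarrow> x \<notin> exp_vars j \<Longrightarrow> x \<notin> exp_vars (tokenE p j)"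
  by (auto simp: tokenE_def)

lemma wf_exp_token [simp]:
  assumes "na \<le> 6" "0 < na" "33 < nv"
  shows "wf_exp na nv (startE p j) \<longleftrightarrow> wf_exp na nv p \<and> wf_exp na nv j"
    "wf_exp na nv (tokenE p j) \<longleftrightarrow> wf_exp na nv p \<and> wf_exp na nv j"
  using assms by (auto simp: startE_def tokenE_def)

section \<open>Savitch's recursion\<close>

primrec bridge :: "nat \<Rightarrow> (nat \<Rightarrow> nat \<Rightarrow> bool) \<Rightarrow> nat \<Rightarrow> nat \<Rightarrow> nat \<Rightarrow> bool" where
  "bridge M P 0 c d \<longleftrightarrow> P c d"
| "bridge M P (Suc l) c d \<longleftrightarrow> (\<exists>e<M. bridge M P l c e \<and> bridge M P l e d)"

lemma bridge_reach:
  assumes "\<And>c d. P c d \<longleftrightarrow> c = d \<or> E c d"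
  shows "bridge M P l c d \<Longrightarrow> E\<^sup>*\<^sup>* c d"
proof (induction l arbitrary: c d)
  case (Suc l)
  then show ?case by (auto intro: rtranclp_trans)
qed (use assms in auto)

lemma reach_bridge:
  assumes P: "\<And>c d. P c d \<longleftrightarrow> c = d \<or> E c d" and M: "\<And>c d. E c d \<Longrightarrow> d < M"
  shows "(E ^^ k) c d \<Longrightarrow> k \<le> 2 ^ l \<Longrightarrow> c < M \<Longrightarrow> bridge M P l c d"
proof (induction l arbitrary: c d k)
  case 0
  then have "k = 0 \<or> k = 1" by auto
  then show ?case using 0 P by auto
next
  case (Suc l)
  \<comment> \<open>The first half takes \<open>2 ^ l\<close> steps, or all of them if there are
    fewer; the second half may then be empty, which the reflexive \<open>P\<close> allows.\<close>
  define i where "i = min k (2 ^ l)"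
  have k: "k = i + (k - i)" by (simp add: i_def)
  have "(E ^^ (i + (k - i))) c d" using Suc.prems(1) k by simp
  then obtain e where e: "(E ^^ i) c e" "(E ^^ (k - i)) e d"
    by (auto simp: relpowp_add)
  have "e < M"
  proof (cases i)
    case (Suc j)
    then show ?thesis using e(1) M by auto
  qed (use e(1) Suc.prems(3) in simp)
  moreover have "i \<le> 2 ^ l" "k - i \<le> 2 ^ l" using Suc.prems(2) by (auto simp: i_def)
  ultimately show ?case using Suc.IH[OF e(1)] Suc.IH[OF e(2)] Suc.prems(3) by auto
qed

text \<open>A reachable node is reached in at most as many steps as there are edges, and these are
  at most \<open>M * M\<close>. With \<open>M = 2 ^ L\<close> this makes \<open>2 * L\<close> levels
  enough.\<close>

lemma bridge_iff_reach:
  assumes P: "\<And>c d. P c d \<longleftrightarrow> c = d \<or> E c d" and E: "\<And>c d. E c d \<Longrightarrow> c < M \<and> d < M"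
    and "M * M \<le> 2 ^ l" "c < M"
  shows "bridge M P l c d \<longleftrightarrow> E\<^sup>*\<^sup>* c d"
proof
  show "bridge M P l c d \<Longrightarrow> E\<^sup>*\<^sup>* c d" by (rule bridge_reach[OF P])
  assume "E\<^sup>*\<^sup>* c d"
  let ?R = "{(x, y). E x y}"
  have sub: "?R \<subseteq> {..<M} \<times> {..<M}" using E by auto
  then have fin: "finite ?R" by (rule finite_subset) simp
  have "card ?R \<le> M * M" using card_mono[OF _ sub] by simp
  have "(c, d) \<in> ?R\<^sup>*" using \<open>E\<^sup>*\<^sup>* c d\<close> by (simp add: rtranclp_rtrancl_eq)
  then obtain k where k: "k \<le> card ?R" "(c, d) \<in> ?R ^^ k"
    unfolding rtrancl_finite_eq_relpow[OF fin] by blast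
  have "(E ^^ k) c d" using k(2) relpowp_relpow_eq[of k ?R] by simp
  then show "bridge M P l c d"
    using reach_bridge[OF P] E k(1) \<open>card ?R \<le> M * M\<close> assms(3,4) by (meson le_trans)
qed

text \<open>Endpoints are not copied down the levels: the midpoint in row \<open>i\<close> is the
  left end of its second half and the right end of its first half, and the nearest suitable row from
  \<open>l\<close> upwards counts. With \<open>ph K\<close> true, row \<open>K\<close> is the
  outermost left end and row \<open>K + 1\<close> the outermost right end.\<close>

definition left_row :: "nat \<Rightarrow> (nat \<Rightarrow> bool) \<Rightarrow> nat \<Rightarrow> nat" where
  "left_row K ph l = (LEAST i. l \<le> i \<and> (i = K + 1 \<or> ph i))"

definition right_row :: "nat \<Rightarrow> (nat \<Rightarrow> bool) \<Rightarrow> nat \<Rightarrow> nat" where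
  "right_row K ph l = left_row K (\<lambda>i. \<not> ph i) l"

lemma left_row_here: "ph l \<Longrightarrow> left_row K ph l = l"
  unfolding left_row_def by (intro Least_equality) auto

lemma left_row_skip: "\<not> ph l \<Longrightarrow> l \<le> K \<Longrightarrow> left_row K ph l = left_row K ph (Suc l)"
proof -
  assume "\<not> ph l" "l \<le> K"
  then have "l \<le> i \<and> (i = K + 1 \<or> ph i) \<longleftrightarrow> Suc l \<le> i \<and> (i = K + 1 \<or> ph i)" for i
    by (cases "i = l") auto
  then show ?thesis unfolding left_row_def by simp
qed

lemma left_row_upd [simp]: "left_row K (ph(l := b)) (Suc l) = left_row K ph (Suc l)"
  unfolding left_row_def by (intro arg_cong[of _ _ Least]) (auto simp: fun_eq_iff)

lemma right_row_here: "\<not> ph l \<Longrightarrow> right_row K ph l = l"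
  unfolding right_row_def by (rule left_row_here)

lemma right_row_skip: "ph l \<Longrightarrow> l \<le> K \<Longrightarrow> right_row K ph l = right_row K ph (Suc l)"
  unfolding right_row_def by (rule left_row_skip) simp

lemma right_row_upd [simp]: "right_row K (ph(l := b)) (Suc l) = right_row K ph (Suc l)"
proof -
  have "(\<lambda>i. \<not> (ph(l := b)) i) = (\<lambda>i. \<not> ph i)(l := \<not> b)" by auto
  then show ?thesis unfolding right_row_def by simp
qed

lemma left_row_ge: "l \<le> K + 1 \<Longrightarrow> l \<le> left_row K ph l"
  unfolding left_row_def by (rule conjunct1, rule LeastI[of _ "K + 1"]) simp

lemma left_row_bounded_least: "left_row K ph 0 = bounded_least (K + 1) ph"
  by (simp add: left_row_def bounded_least_def)

lemma left_row_le: "l \<le> K \<Longrightarrow> ph K \<Longrightarrow> left_row K ph l \<le> K"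
  unfolding left_row_def by (rule Least_le) simp

lemma right_row_le: "l \<le> K + 1 \<Longrightarrow> right_row K ph l \<le> K + 1"
  unfolding right_row_def left_row_def by (rule Least_le) simp

lemma left_row_top: "ph K \<Longrightarrow> left_row K ph K = K"
  by (rule left_row_here)

lemma right_row_top: "ph K \<Longrightarrow> right_row K ph K = K + 1"
  unfolding right_row_def left_row_def by (rule Least_equality) (auto, metis Suc_leI le_neq_implies_less)

type_synonym search = "(nat \<Rightarrow> nat) \<times> (nat \<Rightarrow> bool) \<times> nat \<times> bool"

definition leaf :: "nat \<Rightarrow> (nat \<Rightarrow> nat \<Rightarrow> bool) \<Rightarrow> (nat \<Rightarrow> nat) \<Rightarrow> (nat \<Rightarrow> bool) \<Rightarrow> bool" where
  "leaf K P rows ph = P (rows (left_row K ph 0)) (rows (right_row K ph 0))"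

text \<open>Row \<open>l < K\<close> holds the current midpoint of level \<open>l\<close> of Savitch's recursion, and \<open>ph l\<close> tells
  which half of the path is being examined; rows \<open>K\<close> and \<open>K + 1\<close> hold the endpoints.  The flag
  \<open>b\<close> is the result of the call that has just been completed below level \<open>l\<close>.\<close>

inductive search_step :: "nat \<Rightarrow> nat \<Rightarrow> (nat \<Rightarrow> nat \<Rightarrow> bool) \<Rightarrow> search \<Rightarrow> search \<Rightarrow> bool" for K M P where
  second_half: "l < K \<Longrightarrow> \<not> ph l \<Longrightarrow> search_step K M P (rows, ph, l, True)
     (rows, ph(l := True), 0, leaf K P rows (ph(l := True)))"
| succeed: "l < K \<Longrightarrow> ph l \<Longrightarrow> search_step K M P (rows, ph, l, True)
     (rows(l := 0), ph(l := False), Suc l, True)"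
| next_midpoint: "l < K \<Longrightarrow> Suc (rows l) < M \<Longrightarrow> search_step K M P (rows, ph, l, False)
     (rows(l := Suc (rows l)), ph(l := False), 0,
      leaf K P (rows(l := Suc (rows l))) (ph(l := False)))"
| fail: "l < K \<Longrightarrow> \<not> Suc (rows l) < M \<Longrightarrow> search_step K M P (rows, ph, l, False)
     (rows(l := 0), ph(l := False), Suc l, False)"

text \<open>The iteration simulates the recursion: started with the rows below \<open>l\<close> at
  zero and in their first half, it arrives at level \<open>l\<close> with the value of
  \<open>bridge\<close> and with all rows as before, ready for the next call.\<close>

lemma search_computes_bridge:
  assumes "0 < M"
  shows "l \<le> K \<Longrightarrow> (\<And>i. i < l \<Longrightarrow> rows i = 0 \<and> \<not> ph i) \<Longrightarrow>
    (search_step K M P)\<^sup>*\<^sup>* (rows, ph, 0, leaf K P rows ph)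
      (rows, ph, l, bridge M P l (rows (left_row K ph l)) (rows (right_row K ph l)))"
proof (induction l arbitrary: rows ph)
  case 0
  then show ?case by (simp add: leaf_def)
next
  case (Suc l)
  let ?S = "(search_step K M P)\<^sup>*\<^sup>*"
  have l: "l < K" "rows l = 0" "\<not> ph l" using Suc.prems by auto
  have trans: "?S x y \<Longrightarrow> ?S y z \<Longrightarrow> ?S x z" for x y z by (rule rtranclp_trans)
  have extend: "?S x y \<Longrightarrow> search_step K M P y z \<Longrightarrow> ?S x z" for x y z
    by (rule rtranclp.rtrancl_into_rtrancl)
  have single: "search_step K M P x y \<Longrightarrow> ?S x y" for x y by (rule r_into_rtranclp)
  define c where "c = rows (left_row K ph (Suc l))"
  define d where "d = rows (right_row K ph (Suc l))"
  have ge: "Suc l \<le> left_row K ph (Suc l)" "Suc l \<le> right_row K ph (Suc l)"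
    using left_row_ge[of "Suc l" K] l by (auto simp: right_row_def)
  \<comment> \<open>With midpoint \<open>m\<close> in row \<open>l\<close>, the outcome is whether
    some midpoint from \<open>m\<close> on works. The induction is on the number of midpoints
    left.\<close>
  have "?S (rows(l := m), ph, 0, leaf K P (rows(l := m)) ph)
      (rows, ph, Suc l, \<exists>e\<ge>m. e < M \<and> bridge M P l c e \<and> bridge M P l e d)" if "m < M" for m
    using that
  proof (induction "M - m" arbitrary: m rule: less_induct)
    case less
    let ?r = "rows(l := m)" and ?ph = "ph(l := True)"
    let ?goal = "\<exists>e\<ge>m. e < M \<and> bridge M P l c e \<and> bridge M P l e d"
    \<comment> \<open>Either half may fail, hence the two phases. In both cases the search goes on
      with \<open>Suc m\<close>, or gives up after the last midpoint.\<close>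
    have retry: "?S (?r, ph', l, False) (rows, ph, Suc l, ?goal)"
      if "ph' = ph \<or> ph' = ?ph" "\<not> (bridge M P l c m \<and> bridge M P l m d)" for ph'
    proof (cases "Suc m < M")
      case True
      have ph': "ph'(l := False) = ph" using that(1) l by (elim disjE) (simp_all add: fun_upd_idem)
      have s: "search_step K M P (?r, ph', l, False) (rows(l := Suc m), ph, 0, leaf K P (rows(l := Suc
          m)) ph)"
        using next_midpoint[of l K ?r M P ph'] l True ph' by simp
      have eq: "(\<exists>e\<ge>Suc m. e < M \<and> bridge M P l c e \<and> bridge M P l e d) \<longleftrightarrow> ?goal"
        using that(2) by (metis Suc_le_eq le_neq_implies_less less_imp_le)
      have "?S (rows(l := Suc m), ph, 0, leaf K P (rows(l := Suc m)) ph) (rows, ph, Suc l, ?goal)"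
        using less.hyps[of "Suc m"] True unfolding eq by simp
      from trans[OF single[OF s] this] show ?thesis .
    next
      case False
      have "ph'(l := False) = ph" using that(1) l by (elim disjE) (simp_all add: fun_upd_idem)
      then have s: "search_step K M P (?r, ph', l, False) (rows, ph, Suc l, False)"
        using fail[of l K ?r M P ph'] l False by (simp add: fun_upd_idem)
      have "e = m" if "m \<le> e" "e < M" for e using that False by linarith
      then have g: "?goal = False" using that(2) by blast
      show ?thesis unfolding g by (rule single[OF s])
    qed
    have IH: "?S (r', p, 0, leaf K P r' p) (r', p, l, bridge M P l x y)"
      if "\<And>i. i < l \<Longrightarrow> r' i = 0 \<and> \<not> p i" "x = r' (left_row K p l)" "y = r' (right_row K p l)" for r' p x y
      unfolding that(2,3) by (rule Suc.IH) (use l that in auto)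
    have 1: "?S (?r, ph, 0, leaf K P ?r ph) (?r, ph, l, bridge M P l c m)"
      by (rule IH) (use Suc.prems l left_row_skip[of ph l K] right_row_here[of ph l K] ge
        in \<open>simp_all add: c_def\<close>)
    have 2: "?S (?r, ?ph, 0, leaf K P ?r ?ph) (?r, ?ph, l, bridge M P l m d)"
      by (rule IH) (use Suc.prems l left_row_here[of ?ph l K] right_row_skip[of ?ph l K] ge
        in \<open>simp_all add: d_def\<close>)
    have 3: "search_step K M P (?r, ph, l, True) (?r, ?ph, 0, leaf K P ?r ?ph)"
      using second_half l by simp
    show ?case
    proof (cases "bridge M P l c m")
      case c: True
      have "?S (?r, ph, 0, leaf K P ?r ph) (?r, ph, l, True)" using 1 c by simp
      from trans[OF extend[OF this 3] 2]
      have to2: "?S (?r, ph, 0, leaf K P ?r ph) (?r, ?ph, l, bridge M P l m d)" .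
      show ?thesis
      proof (cases "bridge M P l m d")
        case d: True
        have s: "search_step K M P (?r, ?ph, l, True) (rows, ph, Suc l, True)"
          using succeed[of l K ?ph M P ?r] l by (simp add: fun_upd_idem)
        have g: "?goal = True" using c d less.prems by blast
        have "?S (?r, ph, 0, leaf K P ?r ph) (?r, ?ph, l, True)" using to2 d by simp
        from extend[OF this s] show ?thesis unfolding g .
      next
        case d: False
        then have "?S (?r, ph, 0, leaf K P ?r ph) (?r, ?ph, l, False)" using to2 by simp
        from trans[OF this retry] d show ?thesis by simp
      qed
    next
      case c: False
      then have "?S (?r, ph, 0, leaf K P ?r ph) (?r, ph, l, False)" using 1 by simp
      from trans[OF this retry] c show ?thesis by simp
    qed
  qed
  from this[OF assms] show ?case using l by (simp add: c_def d_def fun_upd_idem)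
qed

section \<open>The search program\<close>

abbreviation (input) "len \<equiv> 6 :: nat"
abbreviation (input) "num_lead \<equiv> 7 :: nat"
abbreviation (input) "qvar \<equiv> 8 :: nat"
abbreviation (input) "pos \<equiv> 9 :: nat"
abbreviation (input) "num_prog \<equiv> 10 :: nat"
abbreviation (input) "row_len \<equiv> 11 :: nat"
abbreviation (input) "level \<equiv> 12 :: nat"
abbreviation (input) "flag \<equiv> 13 :: nat"
abbreviation (input) "carry \<equiv> 14 :: nat"
abbreviation (input) "ivar \<equiv> 15 :: nat"
abbreviation (input) "kvar \<equiv> 16 :: nat"
abbreviation (input) "result \<equiv> 17 :: nat"
abbreviation (input) "lrow \<equiv> 18 :: nat"
abbreviation (input) "rrow \<equiv> 19 :: nat"
abbreviation (input) "yvar \<equiv> 20 :: nat"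

abbreviation (input) "rows_arr \<equiv> 2 :: nat"
abbreviation (input) "phase_arr \<equiv> 3 :: nat"
abbreviation (input) "lead_arr \<equiv> 4 :: nat"
abbreviation (input) "prog_arr \<equiv> 5 :: nat"

text \<open>A configuration of the search is a bit vector: a one-hot leading state (\<open>N\<close> bits), a one-hot
  chain length (\<open>n + 1\<close> bits), and the \<open>n \<times> n\<close> matrix of the map that the word read so far
  induces on the states of the progress automaton.  The letter index \<open>m\<close> clears the state and the
  matrix.\<close>

locale search_graph =
  fixes N n m :: nat and dQ dP :: "nat \<Rightarrow> nat \<Rightarrow> nat" and fin S :: "nat \<Rightarrow> bool" and ini q :: nat
    and positive :: bool
begin

definition mat :: "nat \<Rightarrow> nat \<Rightarrow> nat" where
  "mat j y = N + (n + 1) + j * n + y"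

text \<open>To close is to add the word just read to the chain: \<open>X'\<close> supplies the word,
  \<open>X\<close> the old length \<open>i\<close>. The conjuncts demand that the word loops on
  \<open>q\<close>, that the state \<open>y\<close> to which its map takes \<open>ini\<close> is
  fixed and has the sign required by the parity of \<open>i\<close>, and that the map is injective
  on the image of \<open>S\<close>.\<close>

definition closes :: "(nat \<Rightarrow> bool) \<Rightarrow> (nat \<Rightarrow> bool) \<Rightarrow> bool" where
  "closes X X' \<longleftrightarrow> X' q \<and>
     (\<exists>y<n. X' (mat ini y) \<and> X' (mat y y) \<and> (\<exists>i<n. X (N + i) \<and> (fin y \<longleftrightarrow> even i = positive))) \<and>
     (\<forall>y<n. \<forall>z<n. \<forall>r<n. (\<exists>j<n. S j \<and> X' (mat j y)) \<and> (\<exists>j<n. S j \<and> X' (mat j z)) \<and>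
        X' (mat y r) \<and> X' (mat z r) \<longrightarrow> y = z)"

text \<open>\<open>g\<close> chooses whether the extended word joins the chain. The clearing index
  \<open>a = m\<close> exists so that the path for a given length can end in one fixed node; for
  \<open>q < N\<close> it cannot be combined with closing, which needs \<open>X' q\<close>.\<close>

definition edge :: "(nat \<Rightarrow> bool) \<Rightarrow> (nat \<Rightarrow> bool) \<Rightarrow> bool" where
  "edge X X' \<longleftrightarrow> (\<exists>a<m + 1. \<exists>g<(2::nat).
     (\<forall>y'<N. X' y' \<longleftrightarrow> (\<exists>y<N. a < m \<and> X y \<and> dQ y a = y')) \<and>
     (\<forall>j<n. \<forall>y'<n. X' (mat j y') \<longleftrightarrow> (\<exists>y<n. a < m \<and> X (mat j y) \<and> dP y a = y')) \<and>
     (\<forall>i<n + 1. X' (N + i) \<longleftrightarrow> (g \<noteq> 0 \<and> (\<exists>h<i. h + 1 = i \<and> X (N + h)) \<or> g = 0 \<and> X (N + i))) \<and>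
     (g \<noteq> 0 \<longrightarrow> closes X X'))"

end

section \<open>The edge relation as an expression\<close>

definition rowE :: "exp \<Rightarrow> exp \<Rightarrow> exp" where
  "rowE r i = Cell rows_arr (Plus (Times r (Var row_len)) i)"

definition matE :: "exp \<Rightarrow> exp \<Rightarrow> exp \<Rightarrow> exp" where
  "matE r j y = rowE r (Plus (Plus (Plus (Var num_lead) (Plus (Var num_prog) (Const 1)))
     (Times j (Var num_prog))) y)"

definition leadE :: "nat \<Rightarrow> exp \<Rightarrow> exp \<Rightarrow> exp" where
  "leadE m y a = tokenE (Const 0) (Plus (Plus (Const 2) (Times y (Const m))) a)"

definition progE :: "nat \<Rightarrow> exp \<Rightarrow> exp \<Rightarrow> exp" where
  "progE m y a = tokenE (Var pos) (Plus (Plus (Const 2) (Times y (Const m))) a)"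

definition table_endE :: "nat \<Rightarrow> exp" where
  "table_endE m = startE (Var pos) (Plus (Const 2) (Times (Var num_prog) (Const m)))"

definition finalE :: "nat \<Rightarrow> exp \<Rightarrow> exp" where
  "finalE m y = eEq (Cell 0 (Plus (table_endE m) y)) (Const 2)"

definition closesE :: "nat \<Rightarrow> bool \<Rightarrow> exp" where
  "closesE m positive = eAnd (rowE (Var rrow) (Var qvar)) (eAnd
     (eEx 23 (Var num_prog) (eAnd (matE (Var rrow) (tokenE (Var pos) (Const 1)) (Var 23))
        (eAnd (matE (Var rrow) (Var 23) (Var 23))
          (eEx 24 (Var num_prog) (eAnd (rowE (Var lrow) (Plus (Var num_lead) (Var 24)))
            (eIff (finalE m (Var 23))
              (eIff (eEx 25 (Plus (Var 24) (Const 1)) (eEq (Times (Const 2) (Var 25)) (Var 24)))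
                (Const (of_bool positive)))))))))
     (eAll 23 (Var num_prog) (eAll 24 (Var num_prog) (eAll 25 (Var num_prog)
        (eImp (eAnd (eEx 26 (Var num_prog) (eAnd (Cell prog_arr (Var 26)) (matE (Var rrow) (Var 26) (Var
            23))))
          (eAnd (eEx 26 (Var num_prog) (eAnd (Cell prog_arr (Var 26)) (matE (Var rrow) (Var 26) (Var 24))))
          (eAnd (matE (Var rrow) (Var 23) (Var 25)) (matE (Var rrow) (Var 24) (Var 25)))))
          (eEq (Var 23) (Var 24)))))))"

definition edgeE :: "nat \<Rightarrow> bool \<Rightarrow> exp" where
  "edgeE m positive = eEx 21 (Const (m + 1)) (eEx 22 (Const 2) (eAnd
     (eAll 23 (Var num_lead) (eIff (rowE (Var rrow) (Var 23))
        (eEx 24 (Var num_lead) (eAnd (eLess (Var 21) (Const m))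
          (eAnd (rowE (Var lrow) (Var 24)) (eEq (leadE m (Var 24) (Var 21)) (Var 23)))))))
     (eAnd
     (eAll 25 (Var num_prog) (eAll 23 (Var num_prog) (eIff (matE (Var rrow) (Var 25) (Var 23))
        (eEx 24 (Var num_prog) (eAnd (eLess (Var 21) (Const m))
          (eAnd (matE (Var lrow) (Var 25) (Var 24)) (eEq (progE m (Var 24) (Var 21)) (Var 23))))))))
     (eAnd
     (eAll 23 (Plus (Var num_prog) (Const 1)) (eIff (rowE (Var rrow) (Plus (Var num_lead) (Var 23)))
        (eOr (eAnd (Var 22) (eEx 24 (Var 23) (eAnd (eEq (Plus (Var 24) (Const 1)) (Var 23))
            (rowE (Var lrow) (Plus (Var num_lead) (Var 24))))))
          (eAnd (eNot (Var 22)) (rowE (Var lrow) (Plus (Var num_lead) (Var 23)))))))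
     (eImp (Var 22) (closesE m positive))))))"

lemma holds_rowE [simp]:
  "holds (rowE r i) \<sigma> \<alpha> \<longleftrightarrow> \<alpha> rows_arr (val r \<sigma> \<alpha> * \<sigma> row_len + val i \<sigma> \<alpha>) \<noteq> 0"
  by (simp add: rowE_def)

lemma holds_matE [simp]:
  "holds (matE r j y) \<sigma> \<alpha> \<longleftrightarrow> \<alpha> rows_arr (val r \<sigma> \<alpha> * \<sigma> row_len +
     search_graph.mat (\<sigma> num_lead) (\<sigma> num_prog) (val j \<sigma> \<alpha>) (val y \<sigma> \<alpha>)) \<noteq> 0"
  by (simp add: matE_def search_graph.mat_def)

lemma even_iff_bounded: "even (i::nat) \<longleftrightarrow> (\<exists>j<i + 1. 2 * j = i)"
  by (auto elim!: evenE)

lemma holds_closesE: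
  "holds (closesE m positive) \<sigma> \<alpha> \<longleftrightarrow> search_graph.closes (\<sigma> num_lead) (\<sigma> num_prog)
     (\<lambda>y. \<alpha> 0 (token_start (\<alpha> 0) (\<sigma> len) (\<sigma> pos) (2 + \<sigma> num_prog * m) + y) = 2)
     (\<lambda>j. \<alpha> prog_arr j \<noteq> 0) (token (\<alpha> 0) (\<sigma> len) (\<sigma> pos) 1) (\<sigma> qvar) positive
     (\<lambda>i. \<alpha> rows_arr (\<sigma> lrow * \<sigma> row_len + i) \<noteq> 0) (\<lambda>i. \<alpha> rows_arr (\<sigma> rrow * \<sigma> row_len + i) \<noteq> 0)"
  unfolding search_graph.closes_def closesE_def even_iff_bounded
  by (simp add: finalE_def table_endE_def)

lemma holds_edgeE:
  "holds (edgeE m positive) \<sigma> \<alpha> \<longleftrightarrow> search_graph.edge (\<sigma> num_lead) (\<sigma> num_prog) m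
     (\<lambda>y a. token (\<alpha> 0) (\<sigma> len) 0 (2 + y * m + a))
     (\<lambda>y a. token (\<alpha> 0) (\<sigma> len) (\<sigma> pos) (2 + y * m + a))
     (\<lambda>y. \<alpha> 0 (token_start (\<alpha> 0) (\<sigma> len) (\<sigma> pos) (2 + \<sigma> num_prog * m) + y) = 2)
     (\<lambda>j. \<alpha> prog_arr j \<noteq> 0) (token (\<alpha> 0) (\<sigma> len) (\<sigma> pos) 1) (\<sigma> qvar) positive
     (\<lambda>i. \<alpha> rows_arr (\<sigma> lrow * \<sigma> row_len + i) \<noteq> 0) (\<lambda>i. \<alpha> rows_arr (\<sigma> rrow * \<sigma> row_len + i) \<noteq> 0)"
  unfolding search_graph.edge_def edgeE_def
  by (simp add: holds_closesE leadE_def progE_def)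

text \<open>All indices that \<open>edge\<close> inspects lie within the row length. The array cells
  after a row belong to other rows, so they need not agree with the high bits of the code of the
  row.\<close>

lemma (in search_graph) edge_cong:
  assumes "\<And>i. i < N + (n + 1) + n * n \<Longrightarrow> X i = Y i" "\<And>i. i < N + (n + 1) + n * n \<Longrightarrow> X' i = Y' i"
    and "q < N" "ini < n"
  shows "edge X X' \<longleftrightarrow> edge Y Y'"
proof -
  have mat: "mat j y < N + (n + 1) + n * n" if "j < n" "y < n" for j y
  proof -
    have "j * n + y < Suc j * n" using that by simp
    also have "\<dots> \<le> n * n" using that by (intro mult_le_mono1) simp
    finally show ?thesis by (simp add: mat_def)
  qed
  have 1: "X y = Y y" "X' y = Y' y" if "y < N" for y using that assms by auto
  have 2: "X (mat j y) = Y (mat j y)" "X' (mat j y) = Y' (mat j y)" if "j < n" "y < n" for j y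
    using that assms mat by auto
  have 3: "X (N + i) = Y (N + i)" "X' (N + i) = Y' (N + i)" if "i < n + 1" for i
    using that assms by auto
  have 4: "X (N + i) = Y (N + i)" if "i < n" for i using that assms by auto
  have 5: "X (N + h) = Y (N + h)" if "h < i" "i < n + 1" for i h using that assms by auto
  show ?thesis
    unfolding edge_def closes_def
    using assms(3,4) by (simp add: 1 2 3 4 5 cong: conj_cong)
qed

text \<open>\<open>2 * row_len + 1\<close> is \<open>K + 1\<close>, both the range of the search and
  the value of \<open>eMu\<close> without a witness. If no level is in its first half, the right end
  is thus row \<open>K + 1\<close>, the target.\<close>

definition leafC :: "nat \<Rightarrow> bool \<Rightarrow> com" where
  "leafC m positive = Then
     (Assign lrow (eMu 21 22 (Plus (Times (Const 2) (Var row_len)) (Const 1)) (Cell phase_arr)))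
     (Then (Assign rrow (eMu 21 22 (Plus (Times (Const 2) (Var row_len)) (Const 1)) (\<lambda>y. eNot (Cell
         phase_arr y))))
     (Assign flag (eFlag (eOr
       (eAll 21 (Var row_len) (eIff (rowE (Var lrow) (Var 21)) (rowE (Var rrow) (Var 21))))
       (edgeE m positive)))))"

text \<open>A midpoint is incremented at its lowest zero bit: the bits below are cleared and this
  one is set. After a success of the second half the carry is put at \<open>row_len\<close>, so that
  success and exhaustion share the code that clears the row and goes up.\<close>

definition advanceC :: "nat \<Rightarrow> bool \<Rightarrow> com" where
  "advanceC m positive = Cond (eAnd (Var flag) (eNot (Cell phase_arr (Var level))))
     (Then (Write phase_arr (Var level) (Const 1)) (Then (leafC m positive) (Assign level (Const 0))))
     (Then (Cond (Var flag) (Assign carry (Var row_len))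
         (Assign carry (eMu 21 22 (Var row_len) (\<lambda>i. eNot (rowE (Var level) i)))))
     (Then (Fill ivar rows_arr (Times (Var level) (Var row_len)) (Var carry) (Const 0))
     (Then (Write phase_arr (Var level) (Const 0))
     (Cond (eLess (Var carry) (Var row_len))
       (Then (Write rows_arr (Plus (Times (Var level) (Var row_len)) (Var carry)) (Const 1))
         (Then (leafC m positive) (Assign level (Const 0))))
       (Assign level (Plus (Var level) (Const 1)))))))"

definition savitchC :: "nat \<Rightarrow> bool \<Rightarrow> com" where
  "savitchC m positive = Then (Assign level (Const 0)) (Then (leafC m positive)
     (Loop (eLess (Var level) (Times (Const 2) (Var row_len))) (advanceC m positive)))"

section \<open>Correctness of the search program\<close>

definition same_context :: "store \<Rightarrow> store \<Rightarrow> bool" where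
  "same_context s0 s \<longleftrightarrow>
     (\<forall>x. x \<notin> {level, flag, carry, ivar, lrow, rrow} \<longrightarrow> fst s x = fst s0 x) \<and>
     (\<forall>A. A \<notin> {rows_arr, phase_arr} \<longrightarrow> snd s A = snd s0 A)"

text \<open>The abstract search works with numbers below \<open>2 ^ L\<close>, the tape with their
  bits. \<open>ph K\<close> is kept true so that row \<open>K\<close> is always available as a left
  end.\<close>

definition rows_stored :: "nat \<Rightarrow> nat \<Rightarrow> (nat \<Rightarrow> nat) \<Rightarrow> (nat \<Rightarrow> bool) \<Rightarrow> (nat \<Rightarrow> nat \<Rightarrow> nat) \<Rightarrow> bool" where
  "rows_stored L K rows ph \<alpha> \<longleftrightarrow>
     (\<forall>r<K + 2. rows r < 2 ^ L \<and> (\<forall>i<L. \<alpha> rows_arr (r * L + i) \<noteq> 0 \<longleftrightarrow> bit (rows r) i)) \<and>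
     (\<forall>i\<le>K. \<alpha> phase_arr i \<noteq> 0 \<longleftrightarrow> ph i) \<and> ph K"

definition store_edge :: "nat \<Rightarrow> bool \<Rightarrow> store \<Rightarrow> (nat \<Rightarrow> bool) \<Rightarrow> (nat \<Rightarrow> bool) \<Rightarrow> bool" where
  "store_edge m positive s = (case s of (\<sigma>, \<alpha>) \<Rightarrow>
     search_graph.edge (\<sigma> num_lead) (\<sigma> num_prog) m
     (\<lambda>y a. token (\<alpha> 0) (\<sigma> len) 0 (2 + y * m + a))
     (\<lambda>y a. token (\<alpha> 0) (\<sigma> len) (\<sigma> pos) (2 + y * m + a))
     (\<lambda>y. \<alpha> 0 (token_start (\<alpha> 0) (\<sigma> len) (\<sigma> pos) (2 + \<sigma> num_prog * m) + y) = 2)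
     (\<lambda>j. \<alpha> prog_arr j \<noteq> 0) (token (\<alpha> 0) (\<sigma> len) (\<sigma> pos) 1) (\<sigma> qvar) positive)"

definition leaf_rel :: "nat \<Rightarrow> bool \<Rightarrow> store \<Rightarrow> nat \<Rightarrow> nat \<Rightarrow> bool" where
  "leaf_rel m positive s c d \<longleftrightarrow>
     (\<forall>i<fst s row_len. bit c i \<longleftrightarrow> bit d i) \<or> store_edge m positive s (bit c) (bit d)"

definition search_context :: "store \<Rightarrow> bool" where
  "search_context s \<longleftrightarrow> fst s row_len = fst s num_lead + (fst s num_prog + 1) + fst s num_prog * fst s
      num_prog \<and>
     fst s qvar < fst s num_lead \<and> token (snd s 0) (fst s len) (fst s pos) 1 < fst s num_prog"

lemma bounded_least_cong:
  "(\<And>i. i < n \<Longrightarrow> P i \<longleftrightarrow> P' i) \<Longrightarrow> bounded_least n P = bounded_least n P'"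
  using bounded_least[where n = n and P = P'] by (intro bounded_least_eqI) auto

lemma wp_leafC:
  assumes ctx: "search_context s0" "same_context s0 (\<sigma>, \<alpha>)"
    and L: "L = fst s0 row_len" "K = 2 * L" and rows: "rows_stored L K rows ph \<alpha>" and B: "K + 1 \<le> B"
    and Q: "\<And>\<sigma>'. (\<And>x. x \<notin> {flag, lrow, rrow} \<Longrightarrow> \<sigma>' x = \<sigma> x) \<Longrightarrow>
      (\<sigma>' flag \<noteq> 0 \<longleftrightarrow> leaf K (leaf_rel m positive s0) rows ph) \<Longrightarrow> Q (\<sigma>', \<alpha>)"
  shows "wp B (leafC m positive) Q (\<sigma>, \<alpha>)"
proof -
  obtain \<sigma>0 \<alpha>0 where s0: "s0 = (\<sigma>0, \<alpha>0)" by (cases s0)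
  define l where "l = left_row K ph 0"
  define r where "r = right_row K ph 0"
  have \<sigma>: "\<sigma> len = \<sigma>0 len" "\<sigma> num_lead = \<sigma>0 num_lead" "\<sigma> num_prog = \<sigma>0 num_prog" "\<sigma> row_len = L"
    "\<sigma> pos = \<sigma>0 pos" "\<sigma> qvar = \<sigma>0 qvar" "\<alpha> 0 = \<alpha>0 0" "\<alpha> prog_arr = \<alpha>0 prog_arr"
    using ctx(2) L by (auto simp: same_context_def s0)
  have ph: "\<alpha> phase_arr i \<noteq> 0 \<longleftrightarrow> ph i" if "i < K + 1" for i
    using rows that by (auto simp: rows_stored_def)
  have "ph K" using rows by (auto simp: rows_stored_def)
  then have l: "l \<le> K" and r: "r \<le> K + 1"
    using right_row_le[of 0 K ph] by (auto simp: l_def r_def left_row_le)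
  have bits: "\<alpha> rows_arr (l * L + i) \<noteq> 0 \<longleftrightarrow> bit (rows l) i" "\<alpha> rows_arr (r * L + i) \<noteq> 0 \<longleftrightarrow> bit (rows r) i"
    if "i < L" for i
    using rows that l r by (auto simp: rows_stored_def)
  let ?bd = "Plus (Times (Const 2) (Var row_len)) (Const 1)"
  have v1: "val (eMu 21 22 ?bd (Cell phase_arr)) \<sigma> \<alpha> = l"
  proof -
    have "val (eMu 21 22 ?bd (Cell phase_arr)) \<sigma> \<alpha> = bounded_least (val ?bd \<sigma> \<alpha>) (\<lambda>i. \<alpha> phase_arr i \<noteq> 0)"
      by (rule val_eMu) auto
    also have "val ?bd \<sigma> \<alpha> = K + 1" by (simp add: \<sigma> L(2))
    also have "bounded_least (K + 1) (\<lambda>i. \<alpha> phase_arr i \<noteq> 0) = l"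
      unfolding l_def left_row_bounded_least by (rule bounded_least_cong[OF ph])
    finally show ?thesis .
  qed
  have v2: "val (eMu 21 22 ?bd (\<lambda>y. eNot (Cell phase_arr y))) (\<sigma>(lrow := l)) \<alpha> = r"
  proof -
    have "val (eMu 21 22 ?bd (\<lambda>y. eNot (Cell phase_arr y))) (\<sigma>(lrow := l)) \<alpha> =
        bounded_least (val ?bd (\<sigma>(lrow := l)) \<alpha>) (\<lambda>i. \<not> \<alpha> phase_arr i \<noteq> 0)"
      by (rule val_eMu) auto
    also have "val ?bd (\<sigma>(lrow := l)) \<alpha> = K + 1" by (simp add: \<sigma> L(2))
    also have "bounded_least (K + 1) (\<lambda>i. \<not> \<alpha> phase_arr i \<noteq> 0) = r"
      unfolding r_def right_row_def left_row_bounded_least by (rule bounded_least_cong) (simp only: ph)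
    finally show ?thesis .
  qed
  let ?e = "eOr (eAll 21 (Var row_len) (eIff (rowE (Var lrow) (Var 21)) (rowE (Var rrow) (Var 21))))
      (edgeE m positive)"
  let ?\<sigma> = "\<sigma>(lrow := l, rrow := r)"
  have "holds (edgeE m positive) ?\<sigma> \<alpha> \<longleftrightarrow> store_edge m positive s0
      (\<lambda>i. \<alpha> rows_arr (l * L + i) \<noteq> 0) (\<lambda>i. \<alpha> rows_arr (r * L + i) \<noteq> 0)"
    unfolding holds_edgeE s0 store_edge_def prod.case by (simp add: \<sigma>)
  also have "\<dots> \<longleftrightarrow> store_edge m positive s0 (bit (rows l)) (bit (rows r))"
    unfolding s0 store_edge_def prod.case
    by (rule search_graph.edge_cong) (use bits ctx(1) L(1) s0 in \<open>auto simp: search_context_def\<close>)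
  finally have "holds ?e ?\<sigma> \<alpha> \<longleftrightarrow> leaf K (leaf_rel m positive s0) rows ph"
    using bits by (simp add: leaf_def leaf_rel_def \<sigma> l_def[symmetric] r_def[symmetric] L(1)[symmetric])
  then have v3: "val (eFlag ?e) ?\<sigma> \<alpha> = of_bool (leaf K (leaf_rel m positive s0) rows ph)" by simp
  show ?thesis
    unfolding leafC_def
    apply (rule wp_Then, rule wp_Assign, unfold v1)
    subgoal using l B by simp
    apply (rule wp_Then, rule wp_Assign, unfold v2)
    subgoal using r B by simp
    apply (rule wp_Assign, unfold v3)
    subgoal using B by simp
    by (rule Q) auto
qed

text \<open>A segment of at most \<open>L\<close> cells that starts at a row boundary does not leave
  its row, so changing bits of row \<open>l\<close> leaves the other rows alone.\<close>

lemma row_index: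
  assumes "i < L" "c \<le> (L :: nat)"
  shows "l * L \<le> r * L + i \<and> r * L + i < l * L + c \<longleftrightarrow> r = l \<and> i < c"
proof
  assume a: "l * L \<le> r * L + i \<and> r * L + i < l * L + c"
  have "\<not> r < l"
  proof
    assume "r < l"
    then have "Suc r * L \<le> l * L" by (intro mult_le_mono1) simp
    then show False using a assms by simp
  qed
  moreover have "\<not> l < r"
  proof
    assume "l < r"
    then have "Suc l * L \<le> r * L" by (intro mult_le_mono1) simp
    then show False using a assms by simp
  qed
  ultimately show "r = l \<and> i < c" using a by auto
qed auto

text \<open>Adding 1 clears the trailing ones and sets the first zero; the induction halves
  \<open>x\<close>.\<close>

lemma bit_Suc_carry:
  assumes "\<And>i. i < k \<Longrightarrow> bit x i" "\<not> bit (x :: nat) k"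
  shows "bit (Suc x) i \<longleftrightarrow> (if i < k then False else if i = k then True else bit x i)"
  using assms
proof (induction k arbitrary: x i)
  case 0
  then have "even x" by (simp add: bit_0)
  then show ?case by (cases i) (auto simp: bit_0 bit_Suc)
next
  case (Suc k)
  then have "odd x" by (force simp: bit_0)
  then have "Suc x div 2 = Suc (x div 2)" by presburger
  moreover have "bit (Suc (x div 2)) j \<longleftrightarrow> (if j < k then False else if j = k then True else bit (x div 2)
      j)" for j
    using Suc.prems by (intro Suc.IH) (auto simp: bit_Suc[symmetric])
  ultimately show ?case using \<open>odd x\<close> by (cases i) (auto simp: bit_0 bit_Suc)
qed

text \<open>Both sides say that \<open>x\<close> is not \<open>mask L\<close>, the number with
  \<open>L\<close> ones. Hence the carry position also tells whether the last midpoint has been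
  reached.\<close>

lemma carry_overflow:
  assumes "x < 2 ^ L"
  shows "Suc x < 2 ^ L \<longleftrightarrow> bounded_least L (\<lambda>i. \<not> bit x i) < L"
proof
  let ?k = "bounded_least L (\<lambda>i. \<not> bit x i)"
  show "?k < L" if "Suc x < 2 ^ L"
  proof (rule ccontr)
    assume "\<not> ?k < L"
    then have all: "bit x i" if "i < L" for i using bounded_least(3)[of i L "\<lambda>i. \<not> bit x i"] that by auto
    have "take_bit L x = mask L" using all by (auto simp: bit_eq_iff bit_take_bit_iff bit_mask_iff)
    then have "x = mask L" using assms by (simp add: take_bit_nat_eq_self)
    then show False using that by (simp add: mask_nat_def)
  qed
  show "Suc x < 2 ^ L" if "?k < L"
  proof (rule ccontr)
    assume "\<not> Suc x < 2 ^ L"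
    then have "x = mask L" using assms by (simp add: mask_nat_def)
    then show False using bounded_least(2)[OF that] that by (simp add: bit_mask_iff)
  qed
qed

definition search_inv :: "nat \<Rightarrow> nat \<Rightarrow> store \<Rightarrow> search \<Rightarrow> store \<Rightarrow> bool" where
  "search_inv L K s0 t s = (case t of (rows, ph, l, b) \<Rightarrow> same_context s0 s \<and>
     rows_stored L K rows ph (snd s) \<and> fst s level = l \<and> l \<le> K \<and> (fst s flag \<noteq> 0 \<longleftrightarrow> b))"

lemma rows_stored_upd:
  assumes "rows_stored L K rows ph \<alpha>" "x < 2 ^ L"
    and "\<And>i. i < L \<Longrightarrow> \<alpha>' rows_arr (l * L + i) \<noteq> 0 \<longleftrightarrow> bit x i"
    and "\<And>r i. r \<noteq> l \<Longrightarrow> i < L \<Longrightarrow> \<alpha>' rows_arr (r * L + i) = \<alpha> rows_arr (r * L + i)"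
    and "\<And>i. i \<le> K \<Longrightarrow> \<alpha>' phase_arr i \<noteq> 0 \<longleftrightarrow> ph' i" "ph' K"
  shows "rows_stored L K (rows(l := x)) ph' \<alpha>'"
  unfolding rows_stored_def
proof (intro conjI allI impI)
  fix r i assume r: "r < K + 2" 
  show "(rows(l := x)) r < 2 ^ L" using assms(1,2) r by (auto simp: rows_stored_def)
  assume "i < L"
  then show "\<alpha>' rows_arr (r * L + i) \<noteq> 0 \<longleftrightarrow> bit ((rows(l := x)) r) i"
    using assms(1,3,4) r by (cases "r = l") (auto simp: rows_stored_def)
qed (use assms(5,6) in auto)

lemma rows_stored_phase:
  assumes "rows_stored L K rows ph \<alpha>" "l < K" "v \<noteq> 0 \<longleftrightarrow> b"
  shows "rows_stored L K rows (ph(l := b)) (\<alpha>(phase_arr := (\<alpha> phase_arr)(l := v)))"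
  using assms by (auto simp: rows_stored_def)

lemma wp_leafC_restart:
  assumes "search_context s0" "same_context s0 (\<sigma>, \<alpha>)" "L = fst s0 row_len" "K = 2 * L"
    "rows_stored L K rows ph \<alpha>" "K + 1 \<le> B"
  shows "wp B (Then (leafC m positive) (Assign level (Const 0)))
    (search_inv L K s0 (rows, ph, 0, leaf K (leaf_rel m positive s0) rows ph)) (\<sigma>, \<alpha>)"
  by (rule wp_Then, rule wp_leafC[OF assms], rule wp_Assign)
     (use assms in \<open>auto simp: search_inv_def same_context_def\<close>)

lemma wp_advanceC:
  assumes ctx: "search_context s0" and L: "L = fst s0 row_len" "K = 2 * L" and B: "K + 1 \<le> B"
    and step: "search_step K (2 ^ L) (leaf_rel m positive s0) t t'"
    and inv: "search_inv L K s0 t (\<sigma>, \<alpha>)"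
  shows "holds (eLess (Var level) (Times (Const 2) (Var row_len))) \<sigma> \<alpha> \<and>
    wp B (advanceC m positive) (search_inv L K s0 t') (\<sigma>, \<alpha>)"
proof -
  obtain rows ph l b where t: "t = (rows, ph, l, b)" by (cases t)
  have same: "same_context s0 (\<sigma>, \<alpha>)" and rows: "rows_stored L K rows ph \<alpha>"
    and l: "\<sigma> level = l" and b: "\<sigma> flag \<noteq> 0 \<longleftrightarrow> b"
    using inv by (auto simp: search_inv_def t)
  have lK: "l < K" using step t by (auto elim: search_step.cases)
  have len: "\<sigma> row_len = L" using same L by (simp add: same_context_def)
  have ph: "\<alpha> phase_arr l \<noteq> 0 \<longleftrightarrow> ph l" and phK: "ph K" using rows lK by (auto simp: rows_stored_def)
  have bits: "\<alpha> rows_arr (l * L + i) \<noteq> 0 \<longleftrightarrow> bit (rows l) i" if "i < L" for i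
    using rows that lK by (simp add: rows_stored_def)
  have rl: "rows l < 2 ^ L" using rows lK by (simp add: rows_stored_def)
  \<comment> \<open>The final value of \<open>carry\<close>: after a success the whole row is to be
    cleared, and otherwise the trailing ones.\<close>
  define c where "c = (if b then L else bounded_least L (\<lambda>i. \<not> bit (rows l) i))"
  have cL: "c \<le> L" using bounded_least(1) by (simp add: c_def)
  have LK: "L \<le> K" using L by simp
  have carry: "wp B (Cond (Var flag) (Assign carry (Var row_len))
      (Assign carry (eMu 21 22 (Var row_len) (\<lambda>i. eNot (rowE (Var level) i))))) Q (\<sigma>, \<alpha>)"
    if "Q (\<sigma>(carry := c), \<alpha>)" for Q
  proof (rule wp_Cond)
    show "wp B (Assign carry (Var row_len)) Q (\<sigma>, \<alpha>)" if "holds (Var flag) \<sigma> \<alpha>"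
      using \<open>Q (\<sigma>(carry := c), \<alpha>)\<close> that b B LK by (intro wp_Assign) (auto simp: len c_def)
    have "val (eMu 21 22 (Var row_len) (\<lambda>i. eNot (rowE (Var level) i))) \<sigma> \<alpha> =
        bounded_least (val (Var row_len) \<sigma> \<alpha>) (\<lambda>i. \<not> bit (rows l) i)"
      by (rule val_eMu) (use bits in \<open>auto simp: l len\<close>)
    then show "wp B (Assign carry (eMu 21 22 (Var row_len) (\<lambda>i. eNot (rowE (Var level) i)))) Q (\<sigma>, \<alpha>)"
      if "\<not> holds (Var flag) \<sigma> \<alpha>"
      using \<open>Q (\<sigma>(carry := c), \<alpha>)\<close> that b B LK cL by (intro wp_Assign) (auto simp: len c_def)
  qed
  define \<sigma>1 where "\<sigma>1 = \<sigma>(carry := c, ivar := c)"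
  define f where "f = (\<lambda>p. if l * L \<le> p \<and> p < l * L + c then 0 else \<alpha> rows_arr p)"
  define \<alpha>1 where "\<alpha>1 = \<alpha>(rows_arr := f, phase_arr := (\<alpha> phase_arr)(l := 0))"
  have rest: "wp B (advanceC m positive) Q (\<sigma>, \<alpha>)"
    if "\<not> (b \<and> \<not> ph l)" and Q: "wp B (Cond (eLess (Var carry) (Var row_len))
       (Then (Write rows_arr (Plus (Times (Var level) (Var row_len)) (Var carry)) (Const 1))
         (Then (leafC m positive) (Assign level (Const 0))))
       (Assign level (Plus (Var level) (Const 1)))) Q (\<sigma>1, \<alpha>1)" for Q
    unfolding advanceC_def
    apply (rule wp_Cond)
    subgoal using that(1) b ph by (simp add: l)
    apply (rule wp_Then, rule carry, rule wp_Then, rule wp_Fill)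
    apply (simp_all add: l len)
    subgoal using cL LK B by simp
    apply (rule wp_Then, rule wp_Write)
    using Q by (simp add: \<sigma>1_def \<alpha>1_def f_def l cong: if_cong)
  have same1: "same_context s0 (\<sigma>1, \<alpha>1)" using same by (auto simp: same_context_def \<sigma>1_def \<alpha>1_def)
  have f: "f (r * L + i) = (if r = l \<and> i < c then 0 else \<alpha> rows_arr (r * L + i))" if "i < L" for r i
    unfolding f_def row_index[OF that cL] by simp
  have phase1: "\<alpha>1 phase_arr i \<noteq> 0 \<longleftrightarrow> (ph(l := False)) i" if "i \<le> K" for i
    using rows that by (auto simp: rows_stored_def \<alpha>1_def)
  \<comment> \<open>Success of the second half and exhaustion of the midpoints do the same to the
    store: row and phase are cleared, the level goes up and the flag is kept.\<close>
  have advance: "wp B (advanceC m positive) (search_inv L K s0 (rows(l := 0), ph(l := False), Suc l, b))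
      (\<sigma>, \<alpha>)"
    if "\<not> (b \<and> \<not> ph l)" "c = L"
  proof (rule rest[OF that(1)], rule wp_Cond)
    have "rows_stored L K (rows(l := 0)) (ph(l := False)) \<alpha>1"
      by (rule rows_stored_upd[OF rows]) (use f that phase1 phK lK in \<open>auto simp: \<alpha>1_def\<close>)
    then show "wp B (Assign level (Plus (Var level) (Const 1)))
       (search_inv L K s0 (rows(l := 0), ph(l := False), Suc l, b)) (\<sigma>1, \<alpha>1)"
      using same1 b lK B l
      by (intro wp_Assign) (auto simp: search_inv_def same_context_def \<sigma>1_def)
  qed (use that len in \<open>simp add: \<sigma>1_def\<close>)
  have "wp B (advanceC m positive) (search_inv L K s0 t') (\<sigma>, \<alpha>)"
    using step unfolding t
  proof (cases rule: search_step.cases)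
    case second_half
    have "rows_stored L K rows (ph(l := True)) (\<alpha>(phase_arr := (\<alpha> phase_arr)(l := 1)))"
      by (rule rows_stored_phase[OF rows lK]) simp
    moreover have "same_context s0 (\<sigma>, \<alpha>(phase_arr := (\<alpha> phase_arr)(l := 1)))"
      using same by (simp add: same_context_def)
    ultimately show ?thesis
      unfolding advanceC_def second_half(1)
      by (intro wp_Cond wp_Then[of B "Write _ _ _"] wp_Write)
         (use second_half b ph B in \<open>auto simp: l intro!: wp_leafC_restart ctx L\<close>)
  next
    case succeed
    then show ?thesis using advance by (simp add: c_def)
  next
    case next_midpoint
    have b: "\<not> b" using next_midpoint by simp
    have c: "c = bounded_least L (\<lambda>i. \<not> bit (rows l) i)" using b by (simp add: c_def)
    have "c < L" using next_midpoint carry_overflow[OF rl] c by simp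
    have "\<not> bit (rows l) c" using bounded_least(2) \<open>c < L\<close> c by metis
    moreover have "bit (rows l) i" if "i < c" for i using bounded_least(3) that c by metis
    ultimately have sucb: "bit (Suc (rows l)) i \<longleftrightarrow> (if i < c then False else if i = c then True else bit
        (rows l) i)" for i
      by (intro bit_Suc_carry)
    let ?\<alpha> = "\<alpha>1(rows_arr := f(l * L + c := 1))"
    have "rows_stored L K (rows(l := Suc (rows l))) (ph(l := False)) ?\<alpha>"
    proof (rule rows_stored_upd[OF rows])
      show "Suc (rows l) < 2 ^ L" using next_midpoint by simp
      show "?\<alpha> rows_arr (l * L + i) \<noteq> 0 \<longleftrightarrow> bit (Suc (rows l)) i" if "i < L" for i
        unfolding sucb using f[OF that] bits[OF that] by auto
      show "?\<alpha> rows_arr (r * L + i) = \<alpha> rows_arr (r * L + i)" if "r \<noteq> l" "i < L" for r i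
        using f[OF that(2)] row_index[OF that(2), of "Suc c" l r] row_index[OF that(2), of c l r] that
            \<open>c < L\<close>
        by auto
    qed (use phase1 phK lK in auto)
    moreover have "same_context s0 (\<sigma>1, ?\<alpha>)" using same1 by (simp add: same_context_def)
    ultimately show ?thesis
      by (intro rest wp_Cond wp_Then[of B "Write _ _ _"] wp_Write)
         (use next_midpoint b \<open>c < L\<close> B l len L in \<open>auto simp: \<sigma>1_def \<alpha>1_def intro!: wp_leafC_restart
             ctx L\<close>)
  next
    case fail
    have b: "\<not> b" using fail by simp
    then have "\<not> c < L" using fail carry_overflow[OF rl] by (simp add: c_def)
    then show ?thesis using advance b cL fail by simp
  qed
  then show ?thesis using lK by (simp add: l len L(2))
qed

lemma wp_savitchC:
  assumes ctx: "search_context s0" and same: "same_context s0 (\<sigma>, \<alpha>)"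
    and L: "L = fst s0 row_len" "K = 2 * L" and B: "K + 1 \<le> B"
    and rows: "rows_stored L K rows (\<lambda>i. i = K) \<alpha>" and zero: "\<And>i. i < K \<Longrightarrow> rows i = 0"
    and Q: "\<And>\<sigma>' \<alpha>'. same_context s0 (\<sigma>', \<alpha>') \<Longrightarrow>
      \<sigma>' flag \<noteq> 0 \<longleftrightarrow> bridge (2 ^ L) (leaf_rel m positive s0) K (rows K) (rows (K + 1)) \<Longrightarrow> Q (\<sigma>', \<alpha>')"
  shows "wp B (savitchC m positive) Q (\<sigma>, \<alpha>)"
proof -
  let ?P = "leaf_rel m positive s0" and ?ph = "\<lambda>i. i = K"
  let ?t = "(rows, ?ph, 0, leaf K ?P rows ?ph)"
  let ?t' = "(rows, ?ph, K, bridge (2 ^ L) ?P K (rows K) (rows (K + 1)))"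
  have steps: "(search_step K (2 ^ L) ?P)\<^sup>*\<^sup>* ?t ?t'"
    using search_computes_bridge[of "2 ^ L" K K rows ?ph ?P] zero
    by (simp add: left_row_top[of ?ph] right_row_top[of ?ph])
  have loop: "wp B (Loop (eLess (Var level) (Times (Const 2) (Var row_len))) (advanceC m positive)) Q s"
    if "search_inv L K s0 ?t s" for s
  proof (rule wp_Loop_simulation[where R = "search_step K (2 ^ L) ?P" and t = ?t and t' = ?t'
        and I = "search_inv L K s0"])
    show "(search_step K (2 ^ L) ?P)\<^sup>*\<^sup>* ?t ?t'" by (rule steps)
    show "search_inv L K s0 ?t s" by (rule that)
    show "holds (eLess (Var level) (Times (Const 2) (Var row_len))) \<sigma>' \<alpha>' \<and>
        wp B (advanceC m positive) (search_inv L K s0 t') (\<sigma>', \<alpha>')"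
      if "search_step K (2 ^ L) ?P t t'" "search_inv L K s0 t (\<sigma>', \<alpha>')" for t t' \<sigma>' \<alpha>'
      by (rule wp_advanceC[OF ctx L B that])
    show "\<not> holds (eLess (Var level) (Times (Const 2) (Var row_len))) \<sigma>' \<alpha>' \<and> Q (\<sigma>', \<alpha>')"
      if "search_inv L K s0 ?t' (\<sigma>', \<alpha>')" for \<sigma>' \<alpha>'
      using that L by (auto simp: search_inv_def same_context_def intro!: Q)
  qed
  have same0: "same_context s0 (\<sigma>(level := 0), \<alpha>)" using same by (simp add: same_context_def)
  show ?thesis
    unfolding savitchC_def
    apply (rule wp_Then, rule wp_Assign, simp)
    apply (rule wp_Then, simp)
    apply (rule wp_leafC[OF ctx same0 L rows B])
    apply (rule loop)
    using same0 rows by (auto simp: search_inv_def same_context_def)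
qed

section \<open>Persistent chains\<close>

abbreviation run :: "('a, 'z) automaton_scheme \<Rightarrow> 'a list \<Rightarrow> nat \<Rightarrow> nat" where
  "run A w s \<equiv> foldl (trans A) s w"

abbreviation iterate :: "'a list \<Rightarrow> nat \<Rightarrow> 'a list" where
  "iterate v i \<equiv> concat (replicate i v)"

lemma run_less:
  "complete_automaton A \<Longrightarrow> s < num_states A \<Longrightarrow> run A w s < num_states A"
  by (induction w arbitrary: s) (auto simp: complete_automaton_def)

lemma run_iterate: "run A (iterate v i) s = (run A v ^^ i) s"
proof (induction i arbitrary: s)
  case (Suc i)
  then show ?case using funpow_swap1[of "run A v" i s] by simp
qed simp

lemma reach_append: "reach A (u @ v) = run A v (reach A u)"
  by (simp add: reach_def)

lemma reach_less: "complete_automaton A \<Longrightarrow> reach A w < num_states A"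
  unfolding reach_def by (rule run_less) (auto simp: complete_automaton_def)

definition reachable :: "('a, 'z) automaton_scheme \<Rightarrow> nat set" where
  "reachable A = range (reach A)"

lemma run_reachable: "s \<in> reachable A \<Longrightarrow> run A w s \<in> reachable A"
  by (auto simp: reachable_def reach_append[symmetric])

lemma init_reachable: "init_state A \<in> reachable A"
  unfolding reachable_def by (rule range_eqI[of _ _ "[]"]) (simp add: reach_def)

lemma finite_reachable: "complete_automaton A \<Longrightarrow> reachable A \<subseteq> {..<num_states A} \<and> finite (reachable A)"
  by (auto simp: reachable_def reach_less intro: finite_subset[of _ "{..<num_states A}"])

text \<open>If \<open>T s\<close> and \<open>T t\<close> are periodic, a common period takes
  \<open>T (T s) = T (T t)\<close> back to \<open>T s = T t\<close>. Conversely, the orbit of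
  \<open>s\<close> repeats in the finite set, and injectivity on the image cancels applications of
  \<open>T\<close> down to the first.\<close>

lemma injective_on_image_iff_periodic:
  assumes "finite S" "T ` S \<subseteq> S"
  shows "(\<forall>s\<in>S. \<exists>i\<ge>2. T s = (T ^^ i) s) \<longleftrightarrow> (\<forall>s\<in>S. \<forall>t\<in>S. T (T s) = T (T t) \<longrightarrow> T s = T t)"
proof (intro iffI ballI impI)
  fix s t assume periodic: "\<forall>s\<in>S. \<exists>i\<ge>2. T s = (T ^^ i) s" and s: "s \<in> S" "t \<in> S" and eq: "T (T s) = T (T t)"
  obtain i j where i: "i \<ge> 2" "T s = (T ^^ i) s" and j: "j \<ge> 2" "T t = (T ^^ j) t"
    using periodic s by blast
  have "\<exists>d>0. (T ^^ d) (T x) = T x" if "k \<ge> 2" "T x = (T ^^ k) x" for k x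
  proof (intro exI conjI)
    show "0 < k - 1" using that by simp
    have "(T ^^ (k - 1)) (T x) = (T ^^ Suc (k - 1)) x" by (simp add: funpow_swap1)
    then show "(T ^^ (k - 1)) (T x) = T x" using that by simp
  qed
  then obtain d e where d: "d > 0" "(T ^^ d) (T s) = T s" and e: "e > 0" "(T ^^ e) (T t) = T t"
    using i j by metis
  have mult: "(T ^^ (a * b)) x = x" if "(T ^^ a) x = x" for a b x
    using that by (induction b) (auto simp: funpow_add)
  obtain r where r: "d * e = Suc r" using d(1) e(1) by (metis Suc_pred nat_0_less_mult_iff)
  have "T s = (T ^^ (d * e)) (T s)" using mult[OF d(2)] by simp
  also have "\<dots> = (T ^^ r) (T (T s))" unfolding r by (simp add: funpow_swap1)
  also have "\<dots> = (T ^^ (d * e)) (T t)" unfolding r eq by (simp add: funpow_swap1)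
  also have "\<dots> = T t" using mult[OF e(2), of d] by (simp add: mult.commute)
  finally show "T s = T t" .
next
  fix s assume inj: "\<forall>s\<in>S. \<forall>t\<in>S. T (T s) = T (T t) \<longrightarrow> T s = T t" and s: "s \<in> S"
  have in_S: "(T ^^ i) s \<in> S" for i using s assms(2) by (induction i) auto
  have "\<not> inj_on (\<lambda>i. (T ^^ i) s) {0..card S}"
  proof
    assume "inj_on (\<lambda>i. (T ^^ i) s) {0..card S}"
    then have "card {0..card S} \<le> card S"
      using in_S by (intro card_inj_on_le[OF _ _ assms(1)]) auto
    then show False by simp
  qed
  then obtain i j where "i < j" "(T ^^ i) s = (T ^^ j) s"
    unfolding inj_on_def by (metis linorder_neqE_nat)
  \<comment> \<open>All iterates from the first on lie in the image, so applications of
    \<open>T\<close> can be cancelled until one is left on the left-hand side.\<close>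
  have cancel: "(T ^^ Suc 0) s = (T ^^ Suc d) s" if "d > 0" "(T ^^ Suc i) s = (T ^^ (Suc i + d)) s" for i d
    using that(2)
  proof (induction i)
    case (Suc i)
    have "T (T ((T ^^ i) s)) = T (T ((T ^^ (i + d)) s))" using Suc.prems by simp
    then have "T ((T ^^ i) s) = T ((T ^^ (i + d)) s)" using inj in_S by blast
    then show ?case using Suc.IH by simp
  qed simp
  have "T ((T ^^ i) s) = T ((T ^^ j) s)" using \<open>(T ^^ i) s = (T ^^ j) s\<close> by simp
  then have "(T ^^ Suc i) s = (T ^^ (Suc i + (j - i))) s" using \<open>i < j\<close> by simp
  then have "(T ^^ Suc 0) s = (T ^^ Suc (j - i)) s" using cancel[of "j - i" i] \<open>i < j\<close> by simp
  then show "\<exists>i\<ge>2. T s = (T ^^ i) s" using \<open>i < j\<close> by (intro exI[of _ "Suc (j - i)"]) auto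
qed

text \<open>The word \<open>u\<close> enters only through \<open>q\<close>, and the powers in
  \<open>persistent\<close> are replaced by a condition on the map of \<open>v\<close> alone. The
  states are the reachable ones because \<open>z\<close> ranges over words.\<close>

definition persistent_at :: "'a fdfa \<Rightarrow> nat \<Rightarrow> 'a list \<Rightarrow> bool" where
  "persistent_at F q v \<longleftrightarrow> (let P = progress F q in
     run (leading F) v q = q \<and>
     run P v (run P v (init_state P)) = run P v (init_state P) \<and>
     (\<forall>s\<in>reachable P. \<forall>t\<in>reachable P. run P v (run P v s) = run P v (run P v t) \<longrightarrow>
        run P v s = run P v t))"

lemma persistent_iff:
  assumes "is_fdfa F" and q: "q = reach (leading F) u"
  shows "persistent F u v \<longleftrightarrow> v \<noteq> [] \<and> persistent_at F q v"
proof -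
  define P where "P = progress F q"
  have P: "progress_of F u = P" by (simp add: progress_of_def P_def q)
  have "q < num_states (leading F)" using assms by (auto simp: is_fdfa_def reach_less)
  then have "complete_automaton P" using assms by (simp add: is_fdfa_def P_def)
  then have fin: "finite (reachable P)" using finite_reachable by blast
  have "(\<forall>z. \<exists>i\<ge>2. reach P (z @ v) = reach P (z @ iterate v i)) \<longleftrightarrow>
      (\<forall>s\<in>reachable P. \<exists>i\<ge>2. run P v s = (run P v ^^ i) s)"
    by (auto simp: reach_append run_iterate reachable_def)
  also have "\<dots> \<longleftrightarrow> (\<forall>s\<in>reachable P. \<forall>t\<in>reachable P. run P v (run P v s) = run P v (run P v t) \<longrightarrow>
      run P v s = run P v t)"
    by (rule injective_on_image_iff_periodic[OF fin]) (auto intro: run_reachable)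
  finally show ?thesis
    unfolding persistent_def duo_normalized_def normalized_def P persistent_at_def
      Let_def P_def[symmetric] reach_append q[symmetric]
    by (auto simp: reach_def)
qed

text \<open>The language lets any decomposition of the omega-word accept; saturation lets
  \<open>(u, v)\<close> itself decide.\<close>

lemma in_fdfa_language_iff:
  assumes "saturated F" "duo_normalized F u v"
  shows "(u, v) \<in> fdfa_language F \<longleftrightarrow> v \<in> dfa_language (progress_of F u)"
proof -
  have "v \<noteq> []" using assms(2) by (simp add: duo_normalized_def normalized_def)
  then have "decomposition (u \<frown> v\<^sup>\<omega>) u v" by (simp add: decomposition_def)
  then show ?thesis
    using assms \<open>v \<noteq> []\<close> unfolding fdfa_language_def saturated_def by blast
qed

lemma iter_rotate:
  assumes "u \<noteq> []"
  shows "u \<frown> (v @ u)\<^sup>\<omega> = (u @ v)\<^sup>\<omega>"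
proof
  fix n
  define L where "L = length u + length v"
  have L: "0 < L" using assms by (simp add: L_def)
  show "(u \<frown> (v @ u)\<^sup>\<omega>) n = (u @ v)\<^sup>\<omega> n"
  proof (cases "n < length u")
    case True
    then show ?thesis using L by (simp add: L_def nth_append)
  next
    case False
    define k where "k = (n - length u) mod L"
    have "n mod L = (k + length u) mod L" using False by (simp add: k_def mod_simps)
    moreover have kL: "k < L" using L by (simp add: k_def)
    ultimately have "n mod L = (if k < length v then k + length u else k - length v)"
      by (auto simp: L_def le_mod_geq)
    then have "(u @ v) ! (n mod L) = (v @ u) ! k" using kL by (auto simp: nth_append L_def)
    then show ?thesis using False L by (simp add: L_def k_def add.commute)
  qed
qed

lemma common_period:
  assumes "finite A" "\<And>y. y \<in> A \<Longrightarrow> \<exists>d>0. (T ^^ d) y = y"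
  shows "\<exists>d>0. \<forall>y\<in>A. (T ^^ d) y = y"
  using assms
proof (induction A rule: finite_induct)
  case (insert x A)
  obtain d where d: "d > 0" "\<forall>y\<in>A. (T ^^ d) y = y" using insert by auto
  obtain e where e: "e > 0" "(T ^^ e) x = x" using insert.prems by auto
  have mult: "(T ^^ (a * b)) y = y" if "(T ^^ a) y = y" for a b y
    using that by (induction b) (auto simp: funpow_add)
  show ?case
  proof (intro exI conjI ballI)
    show "0 < d * e" using d e by simp
    show "(T ^^ (d * e)) y = y" if "y \<in> insert x A" for y
      using that d(2) mult[of d y e] mult[OF e(2), of d] by (auto simp: mult.commute)
  qed
qed auto

text \<open>Persistence gives each state of the image its own period; the image is finite, so one
  period serves all of it.\<close>

lemma persistent_period:
  assumes "is_fdfa F" "persistent F u v" and P: "P = progress_of F u"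
  shows "\<exists>d>0. \<forall>s\<in>reachable P. (run P v ^^ d) (run P v s) = run P v s"
proof -
  have "complete_automaton P" using assms(1) by (auto simp: is_fdfa_def P progress_of_def reach_less)
  then have "finite (run P v ` reachable P)" using finite_reachable by blast
  moreover have "\<exists>d>0. (run P v ^^ d) y = y" if y: "y \<in> run P v ` reachable P" for y
  proof -
    obtain z where z: "y = reach P (z @ v)" using y by (auto simp: reachable_def reach_append)
    then obtain i where i: "i \<ge> 2" "y = reach P (z @ iterate v i)"
      using assms(2) by (auto simp: persistent_def P)
    then obtain k where k: "i = Suc k" by (cases i) auto
    have "y = (run P v ^^ Suc k) (reach P z)" using i(2) by (simp only: k reach_append run_iterate)
    also have "\<dots> = (run P v ^^ k) y" using funpow_swap1[of "run P v" k "reach P z"]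
      by (simp add: z reach_append)
    finally have "(run P v ^^ k) y = y" ..
    then show ?thesis using i(1) k by (intro exI[of _ k]) auto
  qed
  ultimately show ?thesis using common_period[of "run P v ` reachable P" "run P v"] by auto
qed

text \<open>If the rank did not drop, suitable powers of \<open>v\<close> and \<open>v @ x\<close> would act as idempotents with
  the same kernel; then each absorbs the other, and the two rotations of the product of these
  powers would be decompositions of one \<open>\<omega>\<close>-word that saturation forbids.\<close>

lemma rank_decreases:
  assumes F: "is_fdfa F" "saturated F" and v: "persistent F u v" and v': "persistent F u (v @ x)"
    and P: "P = progress_of F u"
    and differ: "(u, v @ x) \<in> fdfa_language F \<longleftrightarrow> (u, v) \<notin> fdfa_language F"
  shows "card (run P (v @ x) ` reachable P) < card (run P v ` reachable P)"
proof (rule ccontr)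
  assume not_less: "\<not> ?thesis"
  define R where "R = reachable P"
  define T where "T = run P v"
  define T' where "T' = run P (v @ x)"
  have T': "T' s = run P x (T s)" for s by (simp add: T'_def T_def)
  have "complete_automaton P" using F(1) by (auto simp: is_fdfa_def P progress_of_def reach_less)
  then have fin: "finite (T ` R)" using finite_reachable by (auto simp: R_def)
  have "T' ` R = run P x ` (T ` R)" by (auto simp: T')
  then have "card (run P x ` (T ` R)) = card (T ` R)"
    using not_less card_image_le[OF fin, of "run P x"] by (simp add: T_def T'_def R_def)
  \<comment> \<open>If the rank does not drop, reading \<open>x\<close> merges no states of the
    image of \<open>T\<close>.\<close>
  then have inj: "inj_on (run P x) (T ` R)" using fin by (simp add: eq_card_imp_inj_on)
  obtain d where d: "d > 0" "\<And>s. s \<in> R \<Longrightarrow> (T ^^ d) (T s) = T s"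
    using persistent_period[OF F(1) v P] unfolding T_def R_def by blast
  obtain d' where d': "d' > 0" "\<And>s. s \<in> R \<Longrightarrow> (T' ^^ d') (T' s) = T' s"
    using persistent_period[OF F(1) v' P] unfolding T'_def R_def by blast
  define e where "e = T ^^ d"
  define e' where "e' = T' ^^ d'"
  have R: "T s \<in> R" "T' s \<in> R" if "s \<in> R" for s
    using that run_reachable unfolding T_def T'_def R_def by blast+
  have pow_R: "e s \<in> R" "e' s \<in> R" if "s \<in> R" for s
  proof -
    show "e s \<in> R" unfolding e_def using that R by (induction d) auto
    show "e' s \<in> R" unfolding e'_def using that R by (induction d') auto
  qed
  have 1: "T (e s) = T s" "T' (e' s) = T' s" if "s \<in> R" for s
    using d(2) d'(2) that by (simp_all add: e_def e'_def funpow_swap1)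
  \<comment> \<open>\<open>T'\<close> is \<open>T\<close> followed by \<open>x\<close>, and
    \<open>x\<close> can be cancelled from \<open>T' (e' s) = T' s\<close>.\<close>
  have 2: "T (e' s) = T s" if "s \<in> R" for s
    using inj 1(2)[OF that] pow_R(2)[OF that] that by (auto simp: T' inj_on_def)
  \<comment> \<open>The power applied last wins: the first equation uses that \<open>T'\<close>
    starts with \<open>T\<close>, the second the cancellation of \<open>x\<close>.\<close>
  have absorb: "e' (e s) = e' s" "e (e' s) = e s" if "s \<in> R" for s
  proof -
    obtain k where k: "d = Suc k" using d(1) by (cases d) auto
    obtain k' where k': "d' = Suc k'" using d'(1) by (cases d') auto
    have "T' (e s) = T' s" using 1(1)[OF that] by (simp add: T')
    then show "e' (e s) = e' s" by (simp add: e'_def k' funpow_swap1)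
    show "e (e' s) = e s" using 2[OF that] by (simp add: e_def k funpow_swap1)
  qed
  define q where "q = reach (leading F) u"
  define s0 where "s0 = init_state P"
  have s0: "s0 \<in> R" by (simp add: s0_def R_def init_reachable)
  have duo: "duo_normalized F u v" "duo_normalized F u (v @ x)"
    using v v' by (auto simp: persistent_def)
  have ne: "v \<noteq> []" using duo by (simp add: duo_normalized_def normalized_def)
  have fix0: "T (T s0) = T s0" "T' (T' s0) = T' s0"
    using duo unfolding duo_normalized_def P[symmetric] by (simp_all add: reach_def s0_def T_def T'_def)
  have loop: "run (leading F) v q = q" "run (leading F) (v @ x) q = q"
    using duo unfolding duo_normalized_def normalized_def reach_append q_def[symmetric] by blast+
  have pow: "(f ^^ i) (f y) = f y" if "f (f y) = f y" for f :: "nat \<Rightarrow> nat" and i y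
    using that by (induction i) auto
  \<comment> \<open>One \<open>v\<close> already takes \<open>s0\<close> to a fixed point, so the
    positive power \<open>e\<close> agrees with \<open>T\<close> on \<open>s0\<close>; likewise for
    \<open>e'\<close> and \<open>T'\<close>.\<close>
  have e0: "e (T s0) = T s0" "e' (T' s0) = T' s0" "e s0 = T s0" "e' s0 = T' s0"
  proof -
    show 3: "e (T s0) = T s0" "e' (T' s0) = T' s0" using pow fix0 by (simp_all add: e_def e'_def)
    obtain k where k: "d = Suc k" using d(1) by (cases d) auto
    show "e s0 = T s0" using pow[OF fix0(1)] by (simp add: e_def k funpow_swap1)
    obtain k where k: "d' = Suc k" using d'(1) by (cases d') auto
    show "e' s0 = T' s0" using pow[OF fix0(2)] by (simp add: e'_def k funpow_swap1)
  qed
  define w where "w = iterate v d"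
  define w' where "w' = iterate (v @ x) d'"
  have w: "w \<noteq> []" "w' \<noteq> []" using ne d(1) d'(1) by (auto simp: w_def w'_def gr0_conv_Suc)
  have run_w: "run P w s = e s" "run P w' s = e' s" for s
    by (simp_all only: w_def w'_def run_iterate e_def e'_def T_def T'_def)
  have fixpow: "(f ^^ i) y = y" if "f y = y" for f :: "nat \<Rightarrow> nat" and i y
    using that by (induction i) auto
  have loop_w: "run (leading F) w q = q" "run (leading F) w' q = q"
    unfolding w_def w'_def run_iterate
    by (rule fixpow[of "run (leading F) v" q d, OF loop(1)])
       (rule fixpow[of "run (leading F) (v @ x)" q d', OF loop(2)])
  have q': "reach (leading F) (u @ w) = q" using loop_w by (simp add: reach_append q_def[symmetric])
  then have P': "progress_of F (u @ w) = P" by (simp add: progress_of_def P q_def)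
  have A: "e' (e s0) = T' s0" "e' (e (T' s0)) = T' s0" "e (e' s0) = T s0" "e (e' (T s0)) = T s0"
    using absorb[OF s0] absorb(1)[OF R(2)[OF s0]] absorb(2)[OF R(1)[OF s0]] e0 by simp_all
  have "duo_normalized F u (w @ w')"
    unfolding duo_normalized_def normalized_def P[symmetric] reach_append q_def[symmetric]
    using w loop_w A by (simp add: reach_def s0_def[symmetric] run_w)
  moreover have "duo_normalized F (u @ w) (w' @ w)"
    unfolding duo_normalized_def normalized_def P' using w loop_w A q'
    by (simp add: reach_append q_def[symmetric]) (simp add: reach_def s0_def[symmetric] run_w)
  moreover have "decomposition (u \<frown> (w @ w')\<^sup>\<omega>) u (w @ w')" using w by (simp add: decomposition_def)
  moreover have "decomposition (u \<frown> (w @ w')\<^sup>\<omega>) (u @ w) (w' @ w)"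
    using w iter_rotate[OF w(1), of w'] by (simp add: decomposition_def flip: conc_conc)
  ultimately have "w @ w' \<in> dfa_language P \<longleftrightarrow> w' @ w \<in> dfa_language P"
    using F(2) unfolding saturated_def P P' by (metis P P')
  \<comment> \<open>From \<open>s0\<close>, the word \<open>w @ w'\<close> ends in
    \<open>T' s0\<close> and \<open>w' @ w\<close> in \<open>T s0\<close>, so the two decompositions
    compare the acceptance of \<open>v @ x\<close> with that of \<open>v\<close>.\<close>
  then have "final P (T' s0) \<longleftrightarrow> final P (T s0)"
    using A by (simp add: dfa_language_def reach_def s0_def[symmetric] run_w)
  then show False
    using differ in_fdfa_language_iff[OF F(2) duo(1)] in_fdfa_language_iff[OF F(2) duo(2)]
    unfolding P[symmetric] by (simp add: dfa_language_def reach_def s0_def[symmetric] T_def T'_def)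
qed

text \<open>Each link lowers the rank by at least one, so rank plus position never exceeds the
  number of states, and the rank of the last word is still positive.\<close>

lemma chain_length_le:
  assumes F: "is_fdfa F" "saturated F" and chain: "persistent_chain F u vs"
  shows "length vs \<le> num_states (progress_of F u)"
proof -
  define P where "P = progress_of F u"
  let ?rank = "\<lambda>i. card (run P (vs ! i) ` reachable P)"
  have "complete_automaton P" using F(1) by (auto simp: is_fdfa_def P_def progress_of_def reach_less)
  then have R: "finite (reachable P)" "card (reachable P) \<le> num_states P"
    using finite_reachable[of P] card_mono[of "{..<num_states P}" "reachable P"] by auto
  have le: "?rank i + i \<le> num_states P" if "i < length vs" for i
    using that
  proof (induction i)
    case 0
    show ?case using le_trans[OF card_image_le[OF R(1)] R(2)] by simp
  next
    case (Suc i)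
    obtain x where x: "vs ! Suc i = (vs ! i) @ x"
      using chain Suc.prems by (auto simp: persistent_chain_def strict_prefix_def prefix_def)
    have "?rank (Suc i) < ?rank i"
      unfolding x
      by (rule rank_decreases[OF F _ _ P_def]) (use chain Suc.prems x in \<open>auto simp: persistent_chain_def\<close>)
    then show ?case using Suc by simp
  qed
  have pos: "0 < ?rank i" for i using R(1) init_reachable[of P] by (auto simp: card_gt_0_iff)
  have "Suc i \<le> num_states P" if "i < length vs" for i
    using le[OF that] pos[of i] by linarith
  from this[of "length vs - 1"] show ?thesis
    unfolding P_def[symmetric] using chain by (cases vs) (auto simp: persistent_chain_def)
qed

text \<open>All members of a chain are prefixes of its last one, so a chain is a single word read
  letter by letter, with \<open>k\<close> of its prefixes selected. Each selection consumes a
  letter, which makes the members nonempty and strictly increasing.\<close>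

inductive chain_word :: "'a fdfa \<Rightarrow> nat \<Rightarrow> bool \<Rightarrow> 'a list \<Rightarrow> nat \<Rightarrow> bool" for F q b where
  chain_Nil: "chain_word F q b [] 0"
| chain_letter: "chain_word F q b w k \<Longrightarrow> chain_word F q b (w @ [a]) k"
| chain_close: "chain_word F q b w k \<Longrightarrow> persistent_at F q (w @ [a]) \<Longrightarrow>
    w @ [a] \<in> dfa_language (progress F q) \<longleftrightarrow> even k = b \<Longrightarrow> chain_word F q b (w @ [a]) (Suc k)"

lemma chain_word_append: "chain_word F q b w k \<Longrightarrow> chain_word F q b (w @ x) k"
  by (induction x rule: rev_induct) (auto simp flip: append_assoc intro: chain_letter)

definition signed_chain :: "bool \<Rightarrow> 'a fdfa \<Rightarrow> 'a list \<Rightarrow> 'a list list \<Rightarrow> bool" where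
  "signed_chain b F u vs \<longleftrightarrow> persistent_chain F u vs \<and> ((u, hd vs) \<in> fdfa_language F) = b"

lemma chain_word_of_chain:
  assumes F: "is_fdfa F" "saturated F" and chain: "signed_chain b F u vs" and q: "q = reach (leading F) u"
  shows "i < length vs \<Longrightarrow> chain_word F q b (vs ! i) (Suc i)"
proof (induction i)
  have P: "progress_of F u = progress F q" by (simp add: progress_of_def q)
  have lang: "vs ! j \<in> dfa_language (progress F q) \<longleftrightarrow> (u, vs ! j) \<in> fdfa_language F" if "j < length vs" for j
    using in_fdfa_language_iff[OF F(2), of u "vs ! j"] chain that
    by (auto simp: P signed_chain_def persistent_chain_def persistent_def)
  have sign: "(u, vs ! j) \<in> fdfa_language F \<longleftrightarrow> even j = b" if "j < length vs" for j
    using that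
  proof (induction j)
    case 0
    then show ?case using chain by (cases vs) (auto simp: signed_chain_def)
  next
    case (Suc j)
    then show ?case using chain by (auto simp: signed_chain_def persistent_chain_def)
  qed
  have pers: "persistent_at F q (vs ! j)" "vs ! j \<noteq> []" if "j < length vs" for j
    using chain that persistent_iff[OF F(1) q] by (auto simp: signed_chain_def persistent_chain_def)
  { case 0
    obtain w a where "vs ! 0 = w @ [a]" using pers(2)[OF 0] by (cases "vs ! 0" rule: rev_cases) auto
    moreover have "chain_word F q b w 0" using chain_word_append[OF chain_Nil, of F q b w] by simp
    ultimately show ?case using chain_close[of F q b w 0 a] pers(1)[OF 0] lang[OF 0] sign[OF 0] by simp
  next
    case (Suc i)
    have "strict_prefix (vs ! i) (vs ! Suc i)"
      using chain Suc.prems by (auto simp: signed_chain_def persistent_chain_def)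
    then obtain x where x: "vs ! Suc i = vs ! i @ x" "x \<noteq> []"
      by (auto simp: strict_prefix_def Sublist.prefix_def)
    then obtain y a where y: "x = y @ [a]" by (cases x rule: rev_cases) auto
    have "chain_word F q b (vs ! i @ y) (Suc i)" using Suc by (auto intro: chain_word_append)
    then show ?case
      using chain_close[of F q b "vs ! i @ y" "Suc i" a] pers(1)[OF Suc.prems] lang[OF Suc.prems]
        sign[OF Suc.prems] x y by simp
  }
qed

text \<open>Knowing that the last member is a prefix of the word read so far makes the next member a
  strict extension of it. Length 0 stands apart because the empty list is not a chain.\<close>

lemma chain_of_chain_word:
  assumes F: "is_fdfa F" "saturated F" and q: "q = reach (leading F) u"
  shows "chain_word F q b w k \<Longrightarrow> k = 0 \<or> (\<exists>vs. signed_chain b F u vs \<and> length vs = k \<and>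
      Sublist.prefix (last vs) w)"
proof (induction rule: chain_word.induct)
  case (chain_letter w k a)
  then show ?case by (auto intro: prefix_order.trans)
next
  case (chain_close w k a)
  let ?v = "w @ [a]"
  have P: "progress_of F u = progress F q" by (simp add: progress_of_def q)
  have pers: "persistent F u ?v" using persistent_iff[OF F(1) q] chain_close by simp
  have lang: "(u, ?v) \<in> fdfa_language F \<longleftrightarrow> even k = b"
    using in_fdfa_language_iff[OF F(2), of u ?v] pers chain_close by (simp add: persistent_def P)
  show ?case
  proof (cases "k = 0")
    case True
    have "signed_chain b F u [?v]" using pers lang True by (simp add: signed_chain_def persistent_chain_def)
    then show ?thesis using True by (intro disjI2 exI[of _ "[?v]"]) simp
  next
    case False
    then obtain vs where vs: "signed_chain b F u vs" "length vs = k" "Sublist.prefix (last vs) w"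
      using chain_close.IH by blast
    have sp: "strict_prefix (last vs) ?v"
      using vs(3) by (auto simp: strict_prefix_def Sublist.prefix_def)
    have ne: "vs \<noteq> []" using vs by (auto simp: signed_chain_def persistent_chain_def)
    have sign: "(u, vs ! j) \<in> fdfa_language F \<longleftrightarrow> even j = b" if "j < length vs" for j
      using that
    proof (induction j)
      case 0
      then show ?case using vs(1) by (cases vs) (auto simp: signed_chain_def)
    next
      case (Suc j)
      then show ?case using vs(1) by (auto simp: signed_chain_def persistent_chain_def)
    qed
    have "signed_chain b F u (vs @ [?v])"
      unfolding signed_chain_def persistent_chain_def
    proof (intro conjI allI impI)
      show "persistent F u ((vs @ [?v]) ! i)" if "i < length (vs @ [?v])" for i
        using that vs(1) pers by (auto simp: nth_append signed_chain_def persistent_chain_def less_Suc_eq)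
      fix i assume i: "Suc i < length (vs @ [?v])"
      show "strict_prefix ((vs @ [?v]) ! i) ((vs @ [?v]) ! Suc i)"
      proof (cases "Suc i = length vs")
        case True
        then have "vs ! i = last vs" using ne by (simp add: last_conv_nth flip: True)
        then show ?thesis using True sp by (simp add: nth_append)
      next
        case False
        then show ?thesis using vs(1) i by (simp add: nth_append signed_chain_def persistent_chain_def)
      qed
      show "(u, (vs @ [?v]) ! Suc i) \<in> fdfa_language F \<longleftrightarrow> (u, (vs @ [?v]) ! i) \<notin> fdfa_language F"
      proof (cases "Suc i = length vs")
        case True
        then show ?thesis using lang vs(2) sign[of i] by (auto simp: nth_append)
      next
        case False
        then show ?thesis using vs(1) i by (simp add: nth_append signed_chain_def persistent_chain_def)
      qed
    qed (use vs(1) ne in \<open>auto simp: signed_chain_def\<close>)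
    then show ?thesis using vs(2) by (intro disjI2 exI[of _ "vs @ [?v]"]) auto
  qed
qed auto

definition signed_diameter :: "bool \<Rightarrow> 'a fdfa \<Rightarrow> enat" where
  "signed_diameter b F = Sup {enat (length vs) | u vs. signed_chain b F u vs}"

lemma signed_diameter:
  "signed_diameter True F = positive_diameter F" "signed_diameter False F = negative_diameter F"
  by (simp_all add: signed_diameter_def positive_diameter_def negative_diameter_def signed_chain_def
      positive_chain_def negative_chain_def)

text \<open>\<open>high\<close> is asked only for \<open>k\<close> up to the number of progress
  states, the range that the program tries; \<open>chain_length_le\<close> covers the rest.\<close>

lemma signed_diameter_eqI:
  assumes F: "is_fdfa F" "saturated F"
    and low: "r = 0 \<or> (\<exists>q\<in>reachable (leading F). \<exists>w. chain_word F q b w r)"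
    and high: "\<And>q w k. q \<in> reachable (leading F) \<Longrightarrow> chain_word F q b w k \<Longrightarrow> k \<le> num_states (progress F q)
        \<Longrightarrow> k \<le> r"
  shows "signed_diameter b F = enat r"
  unfolding signed_diameter_def
proof (rule antisym)
  show "Sup {enat (length vs) | u vs. signed_chain b F u vs} \<le> enat r"
  proof (rule Sup_least)
    fix x assume "x \<in> {enat (length vs) | u vs. signed_chain b F u vs}"
    then obtain u vs where x: "x = enat (length vs)" and vs: "signed_chain b F u vs" by blast
    have ne: "vs \<noteq> []" using vs by (auto simp: signed_chain_def persistent_chain_def)
    let ?q = "reach (leading F) u"
    have "chain_word F ?q b (vs ! (length vs - 1)) (length vs)"
      using chain_word_of_chain[OF F vs refl, of "length vs - 1"] ne by simp
    moreover have "length vs \<le> num_states (progress F ?q)"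
      using chain_length_le[OF F, of u vs] vs by (simp add: signed_chain_def progress_of_def)
    ultimately show "x \<le> enat r"
      unfolding x using high[of ?q "vs ! (length vs - 1)" "length vs"] by (simp add: reachable_def)
  qed
  show "enat r \<le> Sup {enat (length vs) | u vs. signed_chain b F u vs}"
  proof (cases "r = 0")
    case True
    then show ?thesis by (simp add: zero_enat_def[symmetric])
  next
    case False
    then obtain u w where "chain_word F (reach (leading F) u) b w r" using low by (auto simp: reachable_def)
    then obtain vs where "signed_chain b F u vs" "length vs = r"
      using chain_of_chain_word[OF F refl] False by blast
    then show ?thesis by (intro Sup_upper) auto
  qed
qed

section \<open>Chains as paths between bit vectors\<close>

abbreviation letters :: "'a::enum itself \<Rightarrow> nat" where
  "letters _ \<equiv> length (enum_class.enum :: 'a list)"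

lemma letter_index: obtains i where "i < letters TYPE('a::enum)" "(a :: 'a) = enum_class.enum ! i"
  using enum_UNIV[where 'a = 'a] by (metis UNIV_I in_set_conv_nth)

lemma exists_bits: "\<exists>c<2 ^ L. \<forall>i<L. bit (c :: nat) i \<longleftrightarrow> X i"
proof (intro exI conjI allI impI)
  let ?c = "horner_sum of_bool 2 (map X [0..<L]) :: nat"
  show "?c < 2 ^ L" using horner_sum_of_bool_2_less[of "map X [0..<L]"] by simp
  show "bit ?c i \<longleftrightarrow> X i" if "i < L" for i using that by (simp add: bit_horner_sum_bit_iff)
qed

lemma bits_eqI: "c < 2 ^ L \<Longrightarrow> d < 2 ^ L \<Longrightarrow> (\<And>i. i < L \<Longrightarrow> bit c i \<longleftrightarrow> bit d i) \<Longrightarrow> c = (d :: nat)"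
  by (metis bit_take_bit_iff bit_eq_iff take_bit_nat_eq_self)

locale fdfa_search =
  fixes F :: "'a::enum fdfa" and q :: nat and b :: bool
  assumes F: "is_fdfa F" and q: "q < num_states (leading F)"
begin

abbreviation "Q \<equiv> leading F"
abbreviation "P \<equiv> progress F q"

sublocale search_graph "num_states Q" "num_states P" "letters TYPE('a)"
  "\<lambda>y a. trans Q y (enum_class.enum ! a)" "\<lambda>y a. trans P y (enum_class.enum ! a)"
  "final P" "\<lambda>j. j \<in> reachable P" "init_state P" q b .

abbreviation "N \<equiv> num_states Q"
abbreviation "n \<equiv> num_states P"
abbreviation "L \<equiv> N + (n + 1) + n * n"

definition word_coded :: "(nat \<Rightarrow> bool) \<Rightarrow> 'a list \<Rightarrow> bool" where
  "word_coded X w \<longleftrightarrow> (\<forall>y<N. X y \<longleftrightarrow> y = run Q w q) \<and> (\<forall>j<n. \<forall>y<n. X (mat j y) \<longleftrightarrow> y = run P w j)"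

definition word_flushed :: "(nat \<Rightarrow> bool) \<Rightarrow> bool" where
  "word_flushed X \<longleftrightarrow> (\<forall>y<N. \<not> X y) \<and> (\<forall>j<n. \<forall>y<n. \<not> X (mat j y))"

definition length_coded :: "(nat \<Rightarrow> bool) \<Rightarrow> nat \<Rightarrow> bool" where
  "length_coded X k \<longleftrightarrow> (\<forall>h<n + 1. X (N + h) \<longleftrightarrow> h = k)"

lemma complete: "complete_automaton Q" "complete_automaton P"
  using F q by (auto simp: is_fdfa_def)

lemma run_Q_less: "run Q w q < N"
  by (rule run_less[OF complete(1) q])

lemma run_P_less: "j < n \<Longrightarrow> run P w j < n"
  by (rule run_less[OF complete(2)])

lemma reachable_less: "j \<in> reachable P \<Longrightarrow> j < n"
  using finite_reachable[OF complete(2)] by auto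

lemma index_cases:
  assumes "i < L"
  obtains "i < N" | h where "h < n + 1" "i = N + h" | j y where "j < n" "y < n" "i = mat j y"
proof -
  consider "i < N" | "N \<le> i" "i < N + (n + 1)" | "N + (n + 1) \<le> i" by linarith
  then show thesis
  proof cases
    case 2
    then show ?thesis using that(2)[of "i - N"] by auto
  next
    case 3
    define r where "r = i - (N + (n + 1))"
    have r: "r < n * n" "i = N + (n + 1) + r" using 3 assms by (auto simp: r_def)
    have "0 < n" using r(1) by (cases n) auto
    then have "r div n < n" "r mod n < n" using r(1) by (auto simp: less_mult_imp_div_less)
    moreover have "i = mat (r div n) (r mod n)" using r(2) by (simp add: mat_def)
    ultimately show ?thesis by (rule that(3))
  qed (rule that(1))
qed

text \<open>State, length and matrix together fill all \<open>L\<close> bits, so a configuration has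
  no more than one code below \<open>2 ^ L\<close>.\<close>

lemma coded_unique:
  assumes "length_coded X k" "length_coded Y k"
    "word_coded X w \<and> word_coded Y w \<or> word_flushed X \<and> word_flushed Y" "i < L"
  shows "X i \<longleftrightarrow> Y i"
  using assms(4)
proof (cases rule: index_cases)
  case 1
  then show ?thesis using assms(3) by (auto simp: word_coded_def word_flushed_def)
next
  case (2 h)
  then show ?thesis using assms(1,2) by (auto simp: length_coded_def)
next
  case (3 j y)
  then show ?thesis using assms(3) by (auto simp: word_coded_def word_flushed_def)
qed

lemma exists_code:
  "\<exists>c::nat. c < 2 ^ L \<and> length_coded (bit c) k \<and> word_coded (bit c) w"
  "\<exists>c::nat. c < 2 ^ L \<and> length_coded (bit c) k \<and> word_flushed (bit c)"
proof -
  have mat_less: "mat j y < L" if "j < n" "y < n" for j y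
  proof -
    have "j * n + y < Suc j * n" using that by simp
    also have "\<dots> \<le> n * n" using that by (intro mult_le_mono1) simp
    finally show ?thesis by (simp add: mat_def)
  qed
  have ge: "\<not> mat j y < N" "\<not> mat j y < Suc (N + n)" "mat j y - (N + (n + 1)) = j * n + y" for j y
    by (auto simp: mat_def)
  \<comment> \<open>\<open>g\<close> tells a coded word from a flushed one; an index of the matrix
    block is split into row and column by \<open>div\<close> and \<open>mod\<close>.\<close>
  let ?X = "\<lambda>g i. if i < N then g \<and> i = run Q w q else if i < N + (n + 1) then i - N = k
    else g \<and> (i - (N + (n + 1))) mod n = run P w ((i - (N + (n + 1))) div n)"
  obtain c :: nat where c: "c < 2 ^ L" "\<And>i. i < L \<Longrightarrow> bit c i \<longleftrightarrow> ?X True i"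
    using exists_bits[of L "?X True"] by blast
  obtain d :: nat where d: "d < 2 ^ L" "\<And>i. i < L \<Longrightarrow> bit d i \<longleftrightarrow> ?X False i"
    using exists_bits[of L "?X False"] by blast
  have "length_coded (bit c) k" "length_coded (bit d) k" using c(2) d(2) by (auto simp: length_coded_def)
  moreover have "bit c (mat j y) \<longleftrightarrow> y = run P w j" "\<not> bit d (mat j y)" if "j < n" "y < n" for j y
    using that c(2)[OF mat_less[OF that]] d(2)[OF mat_less[OF that]] unfolding ge(3) by (auto simp: ge)
  then have "word_coded (bit c) w" "word_flushed (bit d)"
    using c(2) d(2) by (auto simp: word_coded_def word_flushed_def)
  ultimately show "\<exists>c::nat. c < 2 ^ L \<and> length_coded (bit c) k \<and> word_coded (bit c) w"
    "\<exists>c::nat. c < 2 ^ L \<and> length_coded (bit c) k \<and> word_flushed (bit c)"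
    using c(1) d(1) by blast+
qed

text \<open>One-hot coding turns the bounded quantifiers of \<open>closes\<close> into statements
  about the map of \<open>w\<close>. The condition \<open>k < n\<close> leaves room for the
  incremented length among the \<open>n + 1\<close> bits.\<close>

lemma closes_iff:
  assumes X: "length_coded X k" and X': "word_coded X' w"
  shows "closes X X' \<longleftrightarrow> k < n \<and> persistent_at F q w \<and> (w \<in> dfa_language P \<longleftrightarrow> even k = b)"
proof -
  let ?T = "run P w"
  have ini: "init_state P < n" "?T (init_state P) < n"
    using reachable_less[OF init_reachable] run_P_less by auto
  have 1: "X' q \<longleftrightarrow> run Q w q = q" using X' q by (auto simp: word_coded_def)
  have 2: "(\<exists>i<n. X (N + i) \<and> (f \<longleftrightarrow> even i = b)) \<longleftrightarrow> k < n \<and> (f \<longleftrightarrow> even k = b)" for f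
  proof -
    have "X (N + i) \<longleftrightarrow> i = k" if "i < n" for i using X that by (simp add: length_coded_def)
    then show ?thesis by blast
  qed
  have M: "X' (mat j y) \<longleftrightarrow> y = ?T j" if "j < n" "y < n" for j y
    using X' that by (auto simp: word_coded_def)
  have 3: "(\<exists>y<n. X' (mat (init_state P) y) \<and> X' (mat y y) \<and> f y) \<longleftrightarrow>
      ?T (?T (init_state P)) = ?T (init_state P) \<and> f (?T (init_state P))" for f
  proof
    assume "\<exists>y<n. X' (mat (init_state P) y) \<and> X' (mat y y) \<and> f y"
    then obtain y where y: "y < n" "X' (mat (init_state P) y)" "X' (mat y y)" "f y" by blast
    have "y = ?T (init_state P)" "y = ?T y" using M[OF ini(1) y(1)] M[OF y(1) y(1)] y(2,3) by simp_all
    then show "?T (?T (init_state P)) = ?T (init_state P) \<and> f (?T (init_state P))" using y(4) by metis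
  next
    assume "?T (?T (init_state P)) = ?T (init_state P) \<and> f (?T (init_state P))"
    then show "\<exists>y<n. X' (mat (init_state P) y) \<and> X' (mat y y) \<and> f y"
      using M[OF ini] M[OF ini(2) ini(2)] ini(2) by (intro exI[of _ "?T (init_state P)"]) simp
  qed
  have 4: "(\<exists>j<n. j \<in> reachable P \<and> X' (mat j y)) \<longleftrightarrow> y \<in> ?T ` reachable P" if "y < n" for y
    using that M reachable_less by auto
  have 5: "(\<forall>y<n. \<forall>z<n. \<forall>r<n. (\<exists>j<n. j \<in> reachable P \<and> X' (mat j y)) \<and>
      (\<exists>j<n. j \<in> reachable P \<and> X' (mat j z)) \<and> X' (mat y r) \<and> X' (mat z r) \<longrightarrow> y = z) \<longleftrightarrow>
    (\<forall>s\<in>reachable P. \<forall>t\<in>reachable P. ?T (?T s) = ?T (?T t) \<longrightarrow> ?T s = ?T t)" (is "?A \<longleftrightarrow> ?B")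
  proof
    assume A: ?A
    show ?B
    proof (intro ballI impI)
      fix s t assume s: "s \<in> reachable P" "t \<in> reachable P" "?T (?T s) = ?T (?T t)"
      have l: "?T s < n" "?T t < n" "?T (?T s) < n" using s reachable_less run_P_less by auto
      show "?T s = ?T t"
        using A[rule_format, of "?T s" "?T t" "?T (?T s)"] l s 4[of "?T s"] 4[of "?T t"] M by auto
    qed
  next
    assume B: ?B
    show ?A
    proof (intro allI impI)
      fix y z r assume l: "y < n" "z < n" "r < n" and
        a: "(\<exists>j<n. j \<in> reachable P \<and> X' (mat j y)) \<and> (\<exists>j<n. j \<in> reachable P \<and> X' (mat j z)) \<and>
          X' (mat y r) \<and> X' (mat z r)"
      then have "y \<in> ?T ` reachable P" "z \<in> ?T ` reachable P" "?T y = ?T z"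
        using 4 M by auto
      then show "y = z" using B by auto
    qed
  qed
  show ?thesis
    unfolding closes_def 1 2 3 5 persistent_at_def Let_def by (auto simp: dfa_language_def reach_def)
qed

lemma coded_step:
  assumes "word_coded X w"
  shows "(\<exists>y<N. X y \<and> trans Q y a = y') \<longleftrightarrow> y' = run Q (w @ [a]) q"
    "j < n \<Longrightarrow> (\<exists>y<n. X (mat j y) \<and> trans P y a = y') \<longleftrightarrow> y' = run P (w @ [a]) j"
proof -
  have 1: "X y \<longleftrightarrow> y = run Q w q" if "y < N" for y using assms that by (simp add: word_coded_def)
  show "(\<exists>y<N. X y \<and> trans Q y a = y') \<longleftrightarrow> y' = run Q (w @ [a]) q"
    using 1 run_Q_less[of w] by auto
  have 2: "X (mat j y) \<longleftrightarrow> y = run P w j" if "j < n" "y < n" for y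
    using assms that by (simp add: word_coded_def)
  show "(\<exists>y<n. X (mat j y) \<and> trans P y a = y') \<longleftrightarrow> y' = run P (w @ [a]) j" if "j < n"
    using 2[OF that] run_P_less[OF that, of w] by auto
qed

lemma letter_coded:
  assumes X: "word_coded X w" and a: "a < letters TYPE('a)"
    and Q: "\<And>y'. y' < N \<Longrightarrow> X' y' \<longleftrightarrow> (\<exists>y<N. a < letters TYPE('a) \<and> X y \<and> trans Q y (enum_class.enum ! a) = y')"
    and P: "\<And>j y'. j < n \<Longrightarrow> y' < n \<Longrightarrow> X' (mat j y') \<longleftrightarrow>
      (\<exists>y<n. a < letters TYPE('a) \<and> X (mat j y) \<and> trans P y (enum_class.enum ! a) = y')"
  shows "word_coded X' (w @ [enum_class.enum ! a])"
  unfolding word_coded_def using Q P coded_step[OF X] a by simp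

text \<open>Flushing forgets the word but not the length, so a flushed node is sound if any word
  witnesses its length.\<close>

definition sound :: "(nat \<Rightarrow> bool) \<Rightarrow> bool" where
  "sound X \<longleftrightarrow> (\<exists>w k. k \<le> n \<and> chain_word F q b w k \<and> length_coded X k \<and> (word_coded X w \<or> word_flushed X))"

lemma edge_sound:
  assumes "sound X" "edge X X'"
  shows "sound X'"
proof -
  obtain w k where k: "k \<le> n" "chain_word F q b w k" "length_coded X k" and X: "word_coded X w \<or>
      word_flushed X"
    using assms(1) by (auto simp: sound_def)
  obtain a g where
      Qe': "\<forall>y'<N. X' y' \<longleftrightarrow> (\<exists>y<N. a < letters TYPE('a) \<and> X y \<and> trans Q y (enum_class.enum ! a) = y')"
    and Pe': "\<forall>j<n. \<forall>y'<n. X' (mat j y') \<longleftrightarrow>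
      (\<exists>y<n. a < letters TYPE('a) \<and> X (mat j y) \<and> trans P y (enum_class.enum ! a) = y')"
    and Ke': "\<forall>i<n + 1. X' (N + i) \<longleftrightarrow>
      ((g :: nat) \<noteq> 0 \<and> (\<exists>h<i. h + 1 = i \<and> X (N + h)) \<or> g = 0 \<and> X (N + i))"
    and G': "g \<noteq> 0 \<longrightarrow> closes X X'"
    using assms(2) unfolding edge_def by (elim exE conjE)
  note Qe = Qe'[rule_format] and Pe = Pe'[rule_format] and Ke = Ke'[rule_format] and G = G'[rule_format]
  have g0: "length_coded X' k" if "g = 0" using k(3) Ke that by (auto simp: length_coded_def)
  show ?thesis
  proof (cases "word_coded X w \<and> a < letters TYPE('a)")
    case True
    let ?w = "w @ [enum_class.enum ! a]"
    have X': "word_coded X' ?w" by (rule letter_coded[OF _ _ Qe Pe]) (use True in auto)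
    show ?thesis
    proof (cases "g = 0")
      case True
      then show ?thesis using X' k chain_letter[OF k(2)] g0 unfolding sound_def by blast
    next
      case False
      then have c: "k < n" "persistent_at F q ?w" "?w \<in> dfa_language P \<longleftrightarrow> even k = b"
        using closes_iff[OF k(3) X'] G by auto
      have "length_coded X' (Suc k)" using k(3) Ke False by (auto simp: length_coded_def)
      then show ?thesis using X' c chain_close[OF k(2) c(2,3)] unfolding sound_def by (metis Suc_leI)
    qed
  next
    case False
    \<comment> \<open>With the clearing letter, or from a flushed node, no word is left. Then
      \<open>closes\<close> fails at \<open>q\<close>, so the length is kept and the old witness
      still serves.\<close>
    then have X': "word_flushed X'" using X Qe Pe by (auto simp: word_flushed_def)
    then have "\<not> closes X X'" using q by (auto simp: closes_def word_flushed_def)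
    then show ?thesis using k G g0 X' unfolding sound_def by blast
  qed
qed

lemma edge_letter:
  assumes X: "word_coded X w" "length_coded X k" and X': "word_coded X' (w @ [a])" "length_coded X' k"
  shows "edge X X'"
proof -
  obtain i where i: "i < letters TYPE('a)" "a = enum_class.enum ! i" by (rule letter_index)
  show ?thesis
    unfolding edge_def
    by (rule exI[of _ i], intro conjI, use i in simp, rule exI[of _ 0])
       (use X' i coded_step[OF X(1)] X(2) in \<open>simp add: word_coded_def length_coded_def\<close>)
qed

lemma edge_close:
  assumes X: "word_coded X w" "length_coded X k" and X': "word_coded X' (w @ [a])" "length_coded X' (Suc k)"
    and c: "closes X X'"
  shows "edge X X'"
proof -
  obtain i where i: "i < letters TYPE('a)" "a = enum_class.enum ! i" by (rule letter_index)
  show ?thesis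
    unfolding edge_def
    by (rule exI[of _ i], intro conjI, use i in simp, rule exI[of _ 1])
       (use X' i coded_step[OF X(1)] X(2) c in \<open>auto simp: word_coded_def length_coded_def\<close>)
qed

lemma edge_flush:
  assumes X: "length_coded X k" and X': "word_flushed X'" "length_coded X' k"
  shows "edge X X'"
  unfolding edge_def
  by (rule exI[of _ "letters TYPE('a)"], intro conjI, simp, rule exI[of _ 0])
     (use X X' in \<open>auto simp: word_flushed_def length_coded_def\<close>)

definition code_edge :: "nat \<Rightarrow> nat \<Rightarrow> bool" where
  "code_edge c d \<longleftrightarrow> c < 2 ^ L \<and> d < 2 ^ L \<and> edge (bit c) (bit d)"

text \<open>Left to right, \<open>sound\<close> is an invariant of the path. Right to left, the path
  follows the letters of a chain word through the codes of its prefixes, and one flushing edge leads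
  from there to \<open>d\<close>.\<close>

lemma code_reach_iff:
  assumes start: "c < 2 ^ L" "word_coded (bit c) []" "length_coded (bit c) 0"
    and target: "d < 2 ^ L" "word_flushed (bit d)" "length_coded (bit d) k" and k: "k \<le> n"
  shows "code_edge\<^sup>*\<^sup>* c d \<longleftrightarrow> (\<exists>w. chain_word F q b w k)"
proof
  assume "code_edge\<^sup>*\<^sup>* c d"
  then have "sound (bit d)"
  proof (induction rule: rtranclp_induct)
    case base
    show ?case using start chain_Nil[of F q b] by (auto simp: sound_def)
  qed (auto simp: code_edge_def intro: edge_sound)
  then obtain w k' where k': "k' \<le> n" "chain_word F q b w k'" "length_coded (bit d) k'"
    by (auto simp: sound_def)
  then have "k' = k" using target(3) k unfolding length_coded_def by (metis less_add_one le_less_trans)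
  then show "\<exists>w. chain_word F q b w k" using k' by blast
next
  assume "\<exists>w. chain_word F q b w k"
  then obtain w where "chain_word F q b w k" ..
  then have "\<And>e. k \<le> n \<Longrightarrow> e < 2 ^ L \<Longrightarrow> word_coded (bit e) w \<Longrightarrow> length_coded (bit e) k \<Longrightarrow> code_edge\<^sup>*\<^sup>* c e"
  proof (induction rule: chain_word.induct)
    case chain_Nil
    then have "e = c" using start coded_unique[of "bit e" 0 "bit c" "[]"] by (intro bits_eqI[of e L c]) auto
    then show ?case by simp
  next
    case (chain_letter w k a)
    obtain e' :: nat where e': "e' < 2 ^ L" "length_coded (bit e') k" "word_coded (bit e') w"
      using exists_code(1) by blast
    have "code_edge e' e"
      using edge_letter[OF e'(3,2)] chain_letter.prems e'(1) by (auto simp: code_edge_def)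
    moreover have "code_edge\<^sup>*\<^sup>* c e'" using chain_letter e' by blast
    ultimately show ?case by (simp add: rtranclp.rtrancl_into_rtrancl)
  next
    case (chain_close w k a)
    obtain e' :: nat where e': "e' < 2 ^ L" "length_coded (bit e') k" "word_coded (bit e') w"
      using exists_code(1) by blast
    have "closes (bit e') (bit e)"
      using closes_iff[OF e'(2) chain_close.prems(3)] chain_close by auto
    then have "code_edge e' e"
      using edge_close[OF e'(3,2)] chain_close.prems e'(1) by (auto simp: code_edge_def)
    moreover have "code_edge\<^sup>*\<^sup>* c e'" using chain_close e' by simp
    ultimately show ?case by (simp add: rtranclp.rtrancl_into_rtrancl)
  qed
  moreover obtain e :: nat where e: "e < 2 ^ L" "length_coded (bit e) k" "word_coded (bit e) w"
    using exists_code(1) by blast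
  ultimately have "code_edge\<^sup>*\<^sup>* c e" using k by blast
  moreover have "code_edge e d" using edge_flush[OF e(2) target(2,3)] e target by (simp add: code_edge_def)
  ultimately show "code_edge\<^sup>*\<^sup>* c d" by (simp add: rtranclp.rtrancl_into_rtrancl)
qed

end

section \<open>Reading the encoding\<close>

definition stored :: "(nat \<Rightarrow> nat) \<Rightarrow> nat \<Rightarrow> bool list \<Rightarrow> bool" where
  "stored f p ys \<longleftrightarrow> (\<forall>i<length ys. f (p + i) = bit_symbol (ys ! i))"

lemma stored_append: "stored f p (xs @ ys) \<longleftrightarrow> stored f p xs \<and> stored f (p + length xs) ys"
proof
  assume a: "stored f p (xs @ ys)"
  show "stored f p xs \<and> stored f (p + length xs) ys"
    unfolding stored_def
  proof (intro conjI allI impI)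
    show "f (p + i) = bit_symbol (xs ! i)" if "i < length xs" for i
      using a that by (auto simp: stored_def nth_append dest!: spec[of _ i])
    show "f (p + length xs + i) = bit_symbol (ys ! i)" if "i < length ys" for i
      using a that by (auto simp: stored_def nth_append add.assoc dest!: spec[of _ "length xs + i"])
  qed
next
  assume a: "stored f p xs \<and> stored f (p + length xs) ys"
  show "stored f p (xs @ ys)"
    unfolding stored_def
  proof (intro allI impI)
    fix i assume i: "i < length (xs @ ys)"
    show "f (p + i) = bit_symbol ((xs @ ys) ! i)"
    proof (cases "i < length xs")
      case False
      then have "i - length xs < length ys" using i by auto
      then have "f (p + length xs + (i - length xs)) = bit_symbol (ys ! (i - length xs))"
        using a unfolding stored_def by blast
      then show ?thesis using False by (simp add: nth_append)
    qed (use a in \<open>simp add: stored_def nth_append\<close>)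
  qed
qed

lemma stored_encode_nat:
  "stored f p (encode_nat n) \<longleftrightarrow> (\<forall>l<n. f (p + l) = 2) \<and> f (p + n) = 1"
  unfolding encode_nat_def stored_append
  by (auto simp: stored_def bit_symbol_def)

abbreviation encode_nats :: "nat list \<Rightarrow> bool list" where
  "encode_nats xs \<equiv> concat (map encode_nat xs)"

lemma sum_of_bool_less: "s \<le> (w :: nat) \<Longrightarrow> (\<Sum>i<w. of_bool (i < s)) = s"
proof -
  assume "s \<le> w"
  then have "{..<w} \<inter> {i. i < s} = {..<s}" by auto
  then show ?thesis by (simp add: sum_of_bool_eq)
qed

text \<open>The number of separators among the first \<open>i\<close> cells is below
  \<open>j\<close> exactly for the \<open>i\<close> before the start of the number with index
  \<open>j\<close>. Counting these \<open>i\<close> gives its offset.\<close>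

lemma token_start_eq:
  assumes st: "stored f p (encode_nats xs)" and j: "j \<le> length xs" and w: "length (encode_nats xs) \<le> w"
  shows "token_start f w p j = p + length (encode_nats (take j xs))"
proof -
  define c where "c i = (\<Sum>l<i. of_bool (f (p + l) = 1) :: nat)" for i
  define s where "s j = length (encode_nats (take j xs))" for j
  have mono: "c i \<le> c i'" if "i \<le> i'" for i i' unfolding c_def using that by (intro sum_mono2) auto
  have "c (s j) = j \<and> (\<forall>i<s j. c i < j)" if "j \<le> length xs" for j
    using that
  proof (induction j)
    case 0
    then show ?case by (simp add: s_def c_def)
  next
    case (Suc j)
    then have jl: "j < length xs" by simp
    have take: "take (Suc j) xs = take j xs @ [xs ! j]" using jl by (rule take_Suc_conv_app_nth)
    have s: "s (Suc j) = s j + Suc (xs ! j)" by (simp add: s_def take encode_nat_def)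
    have "xs = take j xs @ xs ! j # drop (Suc j) xs" using jl by (rule id_take_nth_drop)
    then have "stored f p (encode_nats (take j xs) @ encode_nat (xs ! j) @ encode_nats (drop (Suc j) xs))"
      using st by (metis concat.simps(2) concat_append list.simps(9) map_append)
    then have x: "f (p + s j + l) = 2" if "l < xs ! j" for l
      using that by (simp add: stored_append stored_encode_nat s_def)
    have y: "f (p + s j + xs ! j) = 1"
      using \<open>stored f p (encode_nats (take j xs) @ _)\<close> by (simp add: stored_append stored_encode_nat s_def)
    have IH: "c (s j) = j" "\<And>i. i < s j \<Longrightarrow> c i < j" using Suc by auto
    have flat: "c (s j + t) = j" if "t \<le> xs ! j" for t
      using that
    proof (induction t)
      case (Suc t)
      then show ?case using x[of t] by (simp add: c_def add.assoc)
    qed (simp add: IH)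
    have "c (s (Suc j)) = Suc j" using flat[of "xs ! j"] y by (simp add: s c_def add.assoc)
    moreover have "c i < Suc j" if "i < s (Suc j)" for i
    proof (cases "i < s j")
      case False
      then have "c i = j" using flat[of "i - s j"] that s by simp
      then show ?thesis by simp
    qed (use IH(2)[of i] in simp)
    ultimately show ?case by blast
  qed
  then have cj: "c (s j) = j" "\<And>i. i < s j \<Longrightarrow> c i < j" using j by auto
  have less: "c i < j \<longleftrightarrow> i < s j" for i using cj mono[of "s j" i] by (metis not_le)
  have "s j \<le> w"
  proof -
    have "encode_nats xs = encode_nats (take j xs) @ encode_nats (drop j xs)"
      by (metis append_take_drop_id concat_append map_append)
    then show ?thesis using w by (simp add: s_def)
  qed
  then show ?thesis
    unfolding token_start_def c_def[symmetric] less by (simp only: sum_of_bool_less s_def)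
qed

lemma token_eq:
  assumes st: "stored f p (encode_nats xs)" and j: "j < length xs" and w: "length (encode_nats xs) \<le> w"
  shows "token f w p j = xs ! j"
proof -
  define s where "s = p + length (encode_nats (take j xs))"
  have start: "token_start f w p j = s" using token_start_eq[OF st _ w, of j] j by (simp add: s_def)
  have xs: "xs = take j xs @ xs ! j # drop (Suc j) xs" using j by (rule id_take_nth_drop)
  then have eq: "encode_nats xs = encode_nats (take j xs) @ encode_nat (xs ! j) @ encode_nats (drop (Suc
      j) xs)"
    by (metis concat.simps(2) concat_append list.simps(9) map_append)
  have "\<forall>l<xs ! j. f (s + l) = 2" "f (s + xs ! j) = 1"
    using st unfolding eq stored_append stored_encode_nat s_def by auto
  then have run: "(\<forall>l\<le>i. f (s + l) = 2) \<longleftrightarrow> i < xs ! j" for i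
    by (metis le_less_trans not_less numeral_eq_one_iff semiring_norm(85))
  have "xs ! j \<le> w" using w unfolding eq by (simp add: encode_nat_def)
  then show ?thesis unfolding token_def start run by (intro sum_of_bool_less)
qed

definition automaton_tokens :: "('a::enum, 'z) automaton_scheme \<Rightarrow> nat list" where
  "automaton_tokens A = num_states A # init_state A #
     concat (map (\<lambda>q. map (trans A q) enum_class.enum) [0..<num_states A])"

lemma length_transitions:
  "length (concat (map (\<lambda>q. map (trans (A :: ('a::enum, 'z) automaton_scheme) q) enum_class.enum)
      [0..<k])) = k * letters TYPE('a)"
  by (induction k) auto

lemma nth_transitions:
  fixes A :: "('a::enum, 'z) automaton_scheme"
  assumes "a < letters TYPE('a)"
  shows "q < k \<Longrightarrow> concat (map (\<lambda>q. map (trans A q) enum_class.enum) [0..<k]) ! (q * letters TYPE('a) + a)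
    = trans A q (enum_class.enum ! a)"
proof (induction k)
  case (Suc k)
  show ?case
  proof (cases "q < k")
    case True
    have "q * letters TYPE('a) + a < Suc q * letters TYPE('a)" using assms by simp
    also have "\<dots> \<le> k * letters TYPE('a)" using True by (intro mult_le_mono1) simp
    finally show ?thesis using Suc True by (simp add: nth_append length_transitions)
  next
    case False
    then show ?thesis using Suc.prems assms by (simp add: nth_append length_transitions less_Suc_eq)
  qed
qed simp

lemma encode_automaton_tokens: "encode_automaton A = encode_nats (automaton_tokens A)"
  by (simp add: encode_automaton_def automaton_tokens_def map_concat o_def)

definition encodes :: "(nat \<Rightarrow> nat) \<Rightarrow> nat \<Rightarrow> nat \<Rightarrow> ('a::enum, 'z) automaton_scheme \<Rightarrow> bool" where
  "encodes f w p A \<longleftrightarrow> stored f p (encode_automaton A) \<and> length (encode_automaton A) \<le> w"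

text \<open>The index 2 skips the number of states and the initial state. The last equation locates
  the end of the transition table, where the acceptance bits of a DFA follow.\<close>

lemma encodes_tokens:
  fixes A :: "('a::enum, 'z) automaton_scheme"
  assumes "encodes f w p A"
  shows "token f w p 0 = num_states A" "token f w p 1 = init_state A"
    "y < num_states A \<Longrightarrow> a < letters TYPE('a) \<Longrightarrow>
      token f w p (2 + y * letters TYPE('a) + a) = trans A y (enum_class.enum ! a)"
    "token_start f w p (2 + num_states A * letters TYPE('a)) = p + length (encode_automaton A)"
proof -
  let ?xs = "automaton_tokens A"
  have st: "stored f p (encode_nats ?xs)" "length (encode_nats ?xs) \<le> w"
    using assms by (simp_all add: encodes_def encode_automaton_tokens)
  have len: "length ?xs = 2 + num_states A * letters TYPE('a)"
    by (simp add: automaton_tokens_def length_transitions)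
  show "token f w p 0 = num_states A"
    using token_eq[OF st(1) _ st(2), of 0] len by (simp add: automaton_tokens_def)
  show "token f w p 1 = init_state A"
    using token_eq[OF st(1) _ st(2), of 1] len by (simp add: automaton_tokens_def)
  show "token f w p (2 + y * letters TYPE('a) + a) = trans A y (enum_class.enum ! a)"
    if "y < num_states A" "a < letters TYPE('a)"
  proof -
    have "y * letters TYPE('a) + a < Suc y * letters TYPE('a)" using that by simp
    also have "\<dots> \<le> num_states A * letters TYPE('a)" using that by (intro mult_le_mono1) simp
    finally have "token f w p (2 + y * letters TYPE('a) + a) = ?xs ! (2 + y * letters TYPE('a) + a)"
      using token_eq[OF st(1) _ st(2), of "2 + y * letters TYPE('a) + a"] len by simp
    then show ?thesis using nth_transitions[OF that(2) that(1), of A] by (simp add: automaton_tokens_def)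
  qed
  show "token_start f w p (2 + num_states A * letters TYPE('a)) = p + length (encode_automaton A)"
    using token_start_eq[OF st(1) _ st(2), of "length ?xs"] len by (simp add: encode_automaton_tokens)
qed

definition progress_position :: "'a::enum fdfa \<Rightarrow> nat \<Rightarrow> nat" where
  "progress_position F q = length (encode_automaton (leading F)) +
     length (concat (map (\<lambda>q. encode_dfa (progress F q)) [0..<q]))"

lemma encode_fdfa_stored:
  assumes f: "stored f 0 (encode_fdfa F)" and w: "w = length (encode_fdfa F)"
  shows "encodes f w 0 (leading F)"
    "q < num_states (leading F) \<Longrightarrow> encodes f w (progress_position F q) (progress F q)"
    "q < num_states (leading F) \<Longrightarrow> y < num_states (progress F q) \<Longrightarrow>
      f (progress_position F q + length (encode_automaton (progress F q)) + y) = 2 \<longleftrightarrow> final (progress F q) y"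
    "progress_position F (Suc q) =
      progress_position F q + length (encode_automaton (progress F q)) + num_states (progress F q)"
    "q \<le> num_states (leading F) \<Longrightarrow> progress_position F q \<le> w"
    "num_states (leading F) \<le> w"
    "q < num_states (leading F) \<Longrightarrow> num_states (progress F q) \<le> w"
proof -
  let ?d = "\<lambda>q. encode_dfa (progress F q)"
  let ?N = "num_states (leading F)"
  have len: "num_states A \<le> length (encode_automaton A)" for A :: "('a, 'z) automaton_scheme"
    by (simp add: encode_automaton_def encode_nat_def)
  show "encodes f w 0 (leading F)"
    using f w unfolding encode_fdfa_def encodes_def stored_append by simp
  show "?N \<le> w" using len[of "leading F"] by (simp add: w encode_fdfa_def)
  have split: "concat (map ?d [0..<?N]) = concat (map ?d [0..<q]) @ ?d q @ concat (map ?d [Suc q..<?N])"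
    if "q < ?N" for q
  proof -
    have "[0..<?N] = [0..<q] @ q # [Suc q..<?N]"
      using that upt_add_eq_append[of 0 q "?N - q"] by (simp add: upt_conv_Cons)
    then show ?thesis by simp
  qed
  have d: "stored f (progress_position F q) (?d q)" "length (?d q) \<le> w" if "q < ?N" for q
    using f w split[OF that] unfolding encode_fdfa_def progress_position_def
    by (simp_all add: stored_append)
  show "encodes f w (progress_position F q) (progress F q)" if "q < ?N"
    using d[OF that] unfolding encode_dfa_def encodes_def stored_append by simp
  show "num_states (progress F q) \<le> w" if "q < ?N"
    using d(2)[OF that] by (simp add: encode_dfa_def)
  show "f (progress_position F q + length (encode_automaton (progress F q)) + y) = 2 \<longleftrightarrow>
      final (progress F q) y"
    if "q < ?N" "y < num_states (progress F q)"
    using d(1)[OF that(1)] that(2) unfolding encode_dfa_def stored_append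
    by (auto simp: stored_def bit_symbol_def)
  show "progress_position F (Suc q) =
      progress_position F q + length (encode_automaton (progress F q)) + num_states (progress F q)"
    by (simp add: progress_position_def encode_dfa_def)
  show "progress_position F q \<le> w" if "q \<le> ?N"
  proof -
    have "[0..<?N] = [0..<q] @ [q..<?N]"
      using that upt_add_eq_append[of 0 q "?N - q"] by simp
    then show ?thesis by (simp add: w progress_position_def encode_fdfa_def)
  qed
qed

text \<open>Tables read from the tape agree with the automata only for states and letters in range;
  \<open>edge\<close> asks for no others.\<close>

lemma search_edge_cong:
  assumes "\<And>y a. y < N \<Longrightarrow> a < m \<Longrightarrow> dQ y a = dQ' y a" "\<And>y a. y < n \<Longrightarrow> a < m \<Longrightarrow> dP y a = dP' y a"
    "\<And>y. y < n \<Longrightarrow> fin y = fin' y" "\<And>j. j < n \<Longrightarrow> S j = S' j"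
  shows "search_graph.edge N n m dQ dP fin S ini q b X X' \<longleftrightarrow> search_graph.edge N n m dQ' dP' fin' S' ini
      q b X X'"
  unfolding search_graph.edge_def search_graph.closes_def using assms by (simp cong: conj_cong)

definition progress_store :: "'a::enum fdfa \<Rightarrow> nat \<Rightarrow> store \<Rightarrow> bool" where
  "progress_store F q s \<longleftrightarrow> (case s of (\<sigma>, \<alpha>) \<Rightarrow>
     stored (\<alpha> 0) 0 (encode_fdfa F) \<and> q < num_states (leading F) \<and>
     \<sigma> len = length (encode_fdfa F) \<and> \<sigma> num_lead = num_states (leading F) \<and> \<sigma> qvar = q \<and>
     \<sigma> pos = progress_position F q \<and> \<sigma> num_prog = num_states (progress F q) \<and>
     \<sigma> row_len = \<sigma> num_lead + (\<sigma> num_prog + 1) + \<sigma> num_prog * \<sigma> num_prog \<and>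
     (\<forall>j<\<sigma> num_prog. \<alpha> prog_arr j \<noteq> 0 \<longleftrightarrow> j \<in> reachable (progress F q)))"

lemma progress_store_search:
  fixes F :: "'a::enum fdfa"
  assumes F: "is_fdfa F" and s: "progress_store F q s"
  shows "search_context s"
    "c < 2 ^ fst s row_len \<Longrightarrow> d < 2 ^ fst s row_len \<Longrightarrow>
      leaf_rel (letters TYPE('a)) b s c d \<longleftrightarrow> c = d \<or> fdfa_search.code_edge F q b c d"
proof -
  obtain \<sigma> \<alpha> where s': "s = (\<sigma>, \<alpha>)" by (cases s)
  have q: "q < num_states (leading F)" using s by (simp add: progress_store_def s')
  interpret fdfa_search F q b by unfold_locales (use F q in auto)
  have st: "stored (\<alpha> 0) 0 (encode_fdfa F)" "\<sigma> len = length (encode_fdfa F)"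
    using s by (simp_all add: progress_store_def s')
  have v: "\<sigma> num_lead = N" "\<sigma> pos = progress_position F q" "\<sigma> num_prog = n" "\<sigma> qvar = q" "\<sigma> row_len = L"
    using s by (simp_all add: progress_store_def s')
  note enc = encode_fdfa_stored[OF st]
  note tQ = encodes_tokens[OF enc(1)] and tP = encodes_tokens[OF enc(2)[OF q]]
  have "init_state P < n" using complete by (simp add: complete_automaton_def)
  then show "search_context s" using q tP(2) by (simp add: search_context_def s' v)
  have "store_edge (letters TYPE('a)) b s X X' \<longleftrightarrow> edge X X'" for X X'
    unfolding s' store_edge_def prod.case v tP(2)
    by (rule search_edge_cong)
       (use tQ tP enc(3)[OF q] s in \<open>simp_all add: v progress_store_def s'\<close>)
  then show "leaf_rel (letters TYPE('a)) b s c d \<longleftrightarrow> c = d \<or> code_edge c d"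
    if "c < 2 ^ fst s row_len" "d < 2 ^ fst s row_len"
    using that bits_eqI[of c L d] by (auto simp: leaf_rel_def s' v code_edge_def)
qed

section \<open>Deciding one chain length\<close>

text \<open>Row \<open>2 * row_len\<close> gets the code of the empty word: leading state
  \<open>q\<close>, length 0 and the identity matrix. The next row gets the flushed node of length
  \<open>kvar\<close>, with a single bit set.\<close>

definition endpointsE :: exp where
  "endpointsE = (let s = Times (Times (Const 2) (Var row_len)) (Var row_len) in
     eOr (eEq (Var ivar) (Plus s (Var qvar))) (eOr (eEq (Var ivar) (Plus s (Var num_lead)))
       (eOr (eEx 21 (Var num_prog) (eEq (Var ivar) (Plus s
           (Plus (Plus (Plus (Var num_lead) (Plus (Var num_prog) (Const 1)))
             (Times (Var 21) (Var num_prog))) (Var 21)))))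
         (eEq (Var ivar) (Plus (Plus s (Var row_len)) (Plus (Var num_lead) (Var kvar)))))))"

definition prepareC :: com where
  "prepareC = Then
     (Fill ivar phase_arr (Const 0) (Plus (Times (Const 2) (Var row_len)) (Const 1))
        (eEq (Var ivar) (Times (Const 2) (Var row_len))))
     (Fill ivar rows_arr (Const 0) (Times (Plus (Times (Const 2) (Var row_len)) (Const 2)) (Var row_len))
        endpointsE)"

definition queryC :: "nat \<Rightarrow> bool \<Rightarrow> com" where
  "queryC m b = Then prepareC (savitchC m b)"

lemma bridge_cong:
  "(\<And>c d. c < M \<Longrightarrow> d < M \<Longrightarrow> P c d \<longleftrightarrow> P' c d) \<Longrightarrow> c < M \<Longrightarrow> d < M \<Longrightarrow> bridge M P l c d \<longleftrightarrow> bridge M P' l c d"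
proof (induction l arbitrary: c d)
  case (Suc l)
  then show ?case by (simp cong: conj_cong)
qed simp

lemma row_eq_iff:
  assumes "i < L" "i' < (L :: nat)"
  shows "r * L + i = r' * L + i' \<longleftrightarrow> r = r' \<and> i = i'"
  using row_index[OF assms(1), of "Suc i'" r' r] assms(2) by auto

lemma exp_arrays_endpointsE [simp]: "exp_arrays endpointsE = {}"
  by (simp add: endpointsE_def Let_def)

lemma wp_queryC:
  fixes F :: "'a::enum fdfa"
  assumes F: "is_fdfa F" and s: "progress_store F q (\<sigma>, \<alpha>)" and k: "\<sigma> kvar = k" "k \<le> \<sigma> num_prog"
    and L: "L = \<sigma> row_len" and B: "(2 * L + 2) * L \<le> B" "2 * L + 2 \<le> B"
    and Q: "\<And>\<sigma>' \<alpha>'. same_context (\<sigma>, \<alpha>) (\<sigma>', \<alpha>') \<Longrightarrow>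
      (\<sigma>' flag \<noteq> 0 \<longleftrightarrow> (\<exists>w. chain_word F q b w k)) \<Longrightarrow> Q (\<sigma>', \<alpha>')"
  shows "wp B (queryC (letters TYPE('a)) b) Q (\<sigma>, \<alpha>)"
proof -
  have q: "q < num_states (leading F)" using s by (simp add: progress_store_def)
  interpret fdfa_search F q b by unfold_locales (use F q in auto)
  have v: "\<sigma> num_lead = N" "\<sigma> num_prog = n" "\<sigma> qvar = q" "L = N + (n + 1) + n * n"
    using s by (simp_all add: progress_store_def L)
  define K where "K = 2 * L"
  let ?start = "\<lambda>i. i = q \<or> i = N \<or> (\<exists>j<n. i = mat j j)"
  let ?target = "\<lambda>i. i = N + k"
  obtain c :: nat where c: "c < 2 ^ L" "\<And>i. i < L \<Longrightarrow> bit c i \<longleftrightarrow> ?start i"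
    using exists_bits[of L ?start] by blast
  obtain d :: nat where d: "d < 2 ^ L" "\<And>i. i < L \<Longrightarrow> bit d i \<longleftrightarrow> ?target i"
    using exists_bits[of L ?target] by blast
  have mat_less: "mat j y < L" if "j < n" "y < n" for j y
  proof -
    have "j * n + y < Suc j * n" using that by simp
    also have "\<dots> \<le> n * n" using that by (intro mult_le_mono1) simp
    finally show ?thesis by (simp add: mat_def v)
  qed
  have mat_inj: "mat j y = mat j' y' \<longleftrightarrow> j = j' \<and> y = y'" if "y < n" "y' < n" for j y j' y'
    using row_eq_iff[OF that, of j j'] by (simp add: mat_def)
  have "word_coded (bit c) []" "length_coded (bit c) 0"
    unfolding word_coded_def length_coded_def
    using c(2) q mat_less mat_inj by (auto simp: v mat_def)
  moreover have "word_flushed (bit d)" "length_coded (bit d) k"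
    unfolding word_flushed_def length_coded_def
    using d(2) mat_less k v by (auto simp: mat_def)
  ultimately have reach: "code_edge\<^sup>*\<^sup>* c d \<longleftrightarrow> (\<exists>w. chain_word F q b w k)"
    using code_reach_iff[of c d k] c(1) d(1) k v by simp
  define rows where "rows = (\<lambda>r. if r = K then c else if r = K + 1 then d else 0)"
  have B': "K + 1 \<le> B" "(K + 2) * L \<le> B" using B by (simp_all add: K_def)
  let ?\<sigma> = "\<sigma>(ivar := (K + 2) * L)"
  let ?g = "\<lambda>p. if p < K + 1 then of_bool (p = K) else \<alpha> phase_arr p"
  let ?h = "\<lambda>p. if p < (K + 2) * L then min (val endpointsE (\<sigma>(ivar := p)) (\<alpha>(phase_arr := ?g))) 2
     else \<alpha> rows_arr p"
  let ?\<alpha> = "\<alpha>(phase_arr := ?g, rows_arr := ?h)"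
  have ends: "holds endpointsE (\<sigma>(ivar := p)) \<beta> \<longleftrightarrow> p = K * L + q \<or> p = K * L + N \<or>
      (\<exists>j<n. p = K * L + mat j j) \<or> p = (K + 1) * L + (N + k)" for p \<beta>
    unfolding endpointsE_def Let_def
    by (simp add: v L[symmetric] K_def mat_def k(1))
  have less: "q < L" "N < L" "N + k < L" using q k v by auto
  have rows: "rows_stored L K rows (\<lambda>i. i = K) ?\<alpha>"
    unfolding rows_stored_def
  proof (intro conjI allI impI)
    fix r i assume r: "r < K + 2"
    show "rows r < 2 ^ L" using c(1) d(1) by (simp add: rows_def)
    assume i: "i < L"
    have "r * L + i < Suc r * L" using i by simp
    also have "\<dots> \<le> (K + 2) * L" using r by (intro mult_le_mono1) simp
    finally have "?\<alpha> rows_arr (r * L + i) \<noteq> 0 \<longleftrightarrow> holds endpointsE (\<sigma>(ivar := r * L + i)) (\<alpha>(phase_arr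
        := ?g))"
      by (simp add: holds_def min_def)
    also have "\<dots> \<longleftrightarrow> r = K \<and> ?start i \<or> r = K + 1 \<and> ?target i"
    proof -
      have "(\<exists>j<n. r * L + i = K * L + mat j j) \<longleftrightarrow> r = K \<and> (\<exists>j<n. i = mat j j)"
        using row_eq_iff[OF i mat_less] by auto
      then show ?thesis unfolding ends row_eq_iff[OF i less(1)] row_eq_iff[OF i less(2)] row_eq_iff[OF i
          less(3)]
        by blast
    qed
    also have "\<dots> \<longleftrightarrow> bit (rows r) i" using c(2)[OF i] d(2)[OF i] by (auto simp: rows_def)
    finally show "?\<alpha> rows_arr (r * L + i) \<noteq> 0 \<longleftrightarrow> bit (rows r) i" .
  qed auto
  have same: "same_context (\<sigma>, \<alpha>) (?\<sigma>, ?\<alpha>)" by (simp add: same_context_def)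
  have "bridge (2 ^ L) (leaf_rel (letters TYPE('a)) b (\<sigma>, \<alpha>)) K (rows K) (rows (K + 1)) \<longleftrightarrow>
      bridge (2 ^ L) (\<lambda>c d. c = d \<or> code_edge c d) K c d"
    unfolding rows_def using progress_store_search(2)[OF F s, of _ _ b] c(1) d(1)
    by (simp, intro bridge_cong) (simp_all add: L)
  also have "\<dots> \<longleftrightarrow> code_edge\<^sup>*\<^sup>* c d"
  proof (rule bridge_iff_reach[OF refl _ _ c(1)])
    show "x < 2 ^ L \<and> y < 2 ^ L" if "code_edge x y" for x y using that v by (simp add: code_edge_def)
    \<comment> \<open>With \<open>2 ^ L\<close> codes there are at most \<open>2 ^ K\<close> edges,
      which is what \<open>K\<close> levels can cover.\<close>
    show "(2 :: nat) ^ L * 2 ^ L \<le> 2 ^ K" by (simp add: K_def mult_2 power_add)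
  qed
  also note reach
  finally have result: "bridge (2 ^ L) (leaf_rel (letters TYPE('a)) b (\<sigma>, \<alpha>)) K (rows K) (rows (K + 1))
      \<longleftrightarrow> (\<exists>w. chain_word F q b w k)" .
  have run: "wp B (savitchC (letters TYPE('a)) b) Q (?\<sigma>, ?\<alpha>)"
    by (rule wp_savitchC[OF progress_store_search(1)[OF F s] same _ K_def B'(1) rows])
       (use L Q result in \<open>auto simp: rows_def\<close>)
  show ?thesis
    unfolding queryC_def prepareC_def
    apply (rule wp_Then, rule wp_Then, rule wp_Fill)
    apply (simp_all add: L[symmetric])
    subgoal using B' by (simp add: K_def)
    apply (rule wp_Fill)
    apply (simp_all add: L[symmetric])
    subgoal using B' by (simp add: K_def)
    using run by (simp add: K_def L[symmetric] cong: if_cong)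
qed

section \<open>Marking the reachable states\<close>

definition candidateE :: "nat \<Rightarrow> nat \<Rightarrow> exp \<Rightarrow> exp \<Rightarrow> exp \<Rightarrow> exp" where
  "candidateE m A n p y = eAnd (eNot (Cell A y)) (eEx 24 n (eEx 25 (Const m) (eAnd (Cell A (Var 24))
     (eEq (tokenE p (Plus (Plus (Const 2) (Times (Var 24) (Const m))) (Var 25))) y))))"

definition closureC :: "nat \<Rightarrow> nat \<Rightarrow> exp \<Rightarrow> exp \<Rightarrow> com" where
  "closureC m A n p = Then (Write A (tokenE p (Const 1)) (Const 1))
     (Loop (eEx 21 n (candidateE m A n p (Var 21)))
       (Then (Assign yvar (eMu 21 22 n (candidateE m A n p))) (Write A (Var yvar) (Const 1))))"

lemma holds_candidateE:
  assumes "24 \<notin> exp_vars p" "25 \<notin> exp_vars p" "exp_vars p \<inter> {30, 31, 32, 33} = {}" "z \<noteq> 24" "z \<noteq> 25"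
  shows "holds (candidateE m A n p (Var z)) \<sigma> \<alpha> \<longleftrightarrow> \<alpha> A (\<sigma> z) = 0 \<and>
    (\<exists>x<val n \<sigma> \<alpha>. \<exists>a<m. \<alpha> A x \<noteq> 0 \<and> token (\<alpha> 0) (\<sigma> len) (val p \<sigma> \<alpha>) (2 + x * m + a) = \<sigma> z)"
  using assms by (simp add: candidateE_def)

text \<open>Marked states are reachable throughout, and each round lowers the number of unmarked
  ones. When no candidate is left, the marks contain the initial state and are closed under
  transitions.\<close>

lemma wp_closureC:
  fixes D :: "('a::enum, 'z) automaton_scheme"
  assumes D: "complete_automaton D" and enc: "encodes (\<alpha> 0) (\<sigma> len) (val p \<sigma> \<alpha>) D"
    and n: "val n \<sigma> \<alpha> = num_states D"
    and vars: "exp_vars n \<union> exp_vars p \<subseteq> {..<20}" "exp_arrays n = {}" "exp_arrays p = {}"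
    and A: "A \<noteq> 0" and zero: "\<And>j. j < num_states D \<Longrightarrow> \<alpha> A j = 0" and B: "num_states D \<le> B"
    and Q: "\<And>v g. (\<And>j. j < num_states D \<Longrightarrow> g j \<noteq> 0 \<longleftrightarrow> j \<in> reachable D) \<Longrightarrow> Q (\<sigma>(yvar := v), \<alpha>(A := g))"
  shows "wp B (closureC (letters TYPE('a)) A n p) Q (\<sigma>, \<alpha>)"
proof -
  let ?m = "letters TYPE('a)" and ?N = "num_states D"
  have fresh: "x \<notin> exp_vars n" "x \<notin> exp_vars p" if "20 \<le> x" for x using vars(1) that by auto
  have fresh_set: "exp_vars p \<inter> {30, 31, 32, 33} = {}" using fresh(2) by auto
  define cand where "cand g y \<longleftrightarrow> g y = (0::nat) \<and>
    (\<exists>x<?N. \<exists>a<?m. g x \<noteq> 0 \<and> trans D x (enum_class.enum ! a) = y)" for g y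
  note tok = encodes_tokens[OF enc]
  have holds_cand: "holds (candidateE ?m A n p (Var z)) (\<sigma>(yvar := v, x := i, z := j)) (\<alpha>(A := g)) \<longleftrightarrow>
      cand g j"
    if "z = 21 \<or> z = 22" "x = 21 \<or> x = 22" for z x v i j g
  proof -
    let ?\<sigma> = "\<sigma>(yvar := v, x := i, z := j)" and ?\<alpha> = "\<alpha>(A := g)"
    have "20 \<le> x" "20 \<le> z" using that by auto
    then have "x \<notin> exp_vars n" "z \<notin> exp_vars n" "yvar \<notin> exp_vars n" "x \<notin> exp_vars p" "z \<notin> exp_vars p"
        "yvar \<notin> exp_vars p"
      by (simp_all add: fresh)
    then have "val n ?\<sigma> ?\<alpha> = ?N" "val p ?\<sigma> ?\<alpha> = val p \<sigma> \<alpha>" using vars n by simp_all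
    moreover have "24 \<notin> exp_vars p" "25 \<notin> exp_vars p" by (simp_all add: fresh)
    moreover have "?\<sigma> len = \<sigma> len" "?\<sigma> z = j" "?\<alpha> 0 = \<alpha> 0" "?\<alpha> A = g" "z \<noteq> 24" "z \<noteq> 25"
      using that A by auto
    ultimately show ?thesis
      unfolding cand_def by (subst holds_candidateE) (simp_all add: fresh_set tok(3)[simplified] cong:
          conj_cong)
  qed
  have holds_ex: "holds (eEx 21 n (candidateE ?m A n p (Var 21))) (\<sigma>(yvar := v)) (\<alpha>(A := g)) \<longleftrightarrow>
      (\<exists>y<?N. cand g y)" for v g
    using holds_cand[of 21 21 v 0 _ g] fresh vars n by simp
  have mu: "val (eMu 21 22 n (candidateE ?m A n p)) (\<sigma>(yvar := v)) (\<alpha>(A := g)) = bounded_least ?N (cand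
      g)" for v g
  proof -
    have "val n (\<sigma>(yvar := v)) (\<alpha>(A := g)) = ?N" using fresh vars n by simp
    then show ?thesis
      using val_eMu[of n "\<sigma>(yvar := v)" "\<alpha>(A := g)" "candidateE ?m A n p" 22 21 "cand g"] holds_cand[of
          22 21 v _ _ g]
      by simp
  qed
  let ?I = "\<lambda>s. \<exists>v g. s = (\<sigma>(yvar := v), \<alpha>(A := g)) \<and> (\<forall>j<?N. g j \<noteq> 0 \<longrightarrow> j \<in> reachable D) \<and>
      g (init_state D) \<noteq> 0"
  have loop: "wp B (Loop (eEx 21 n (candidateE ?m A n p (Var 21)))
      (Then (Assign yvar (eMu 21 22 n (candidateE ?m A n p))) (Write A (Var yvar) (Const 1)))) Q s"
          if "?I s" for s
  proof (rule wp_Loop[where I = ?I and f = "\<lambda>s. card {j. j < ?N \<and> snd s A j = 0}", OF that])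
    fix \<sigma>' \<alpha>' assume "?I (\<sigma>', \<alpha>')" and h: "holds (eEx 21 n (candidateE ?m A n p (Var 21))) \<sigma>' \<alpha>'"
    then obtain v g where s: "\<sigma>' = \<sigma>(yvar := v)" "\<alpha>' = \<alpha>(A := g)"
      and g: "\<forall>j<?N. g j \<noteq> 0 \<longrightarrow> j \<in> reachable D" "g (init_state D) \<noteq> 0" by blast
    define y where "y = bounded_least ?N (cand g)"
    obtain y0 where "y0 < ?N" "cand g y0" using h unfolding s holds_ex by blast
    then have y: "y < ?N" "cand g y"
      using bounded_least[where n = ?N and P = "cand g"] unfolding y_def by (metis not_le le_less_trans)+
    then obtain x a where x: "x < ?N" "g x \<noteq> 0" "trans D x (enum_class.enum ! a) = y"
        by (auto simp: cand_def)
    then have "y \<in> reachable D" using run_reachable[of x D "[enum_class.enum ! a]"] g(1) by auto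
    then have I: "?I (\<sigma>(yvar := y), \<alpha>(A := g(y := 1)))" using g
        by (intro exI[of _ y] exI[of _ "g(y := 1)"]) auto
    have "{j. j < ?N \<and> (g(y := 1)) j = 0} \<subset> {j. j < ?N \<and> g j = 0}" using y by (auto simp: cand_def)
    then have "card {j. j < ?N \<and> (g(y := 1)) j = 0} < card {j. j < ?N \<and> g j = 0}"
      by (intro psubset_card_mono) auto
    then show "wp B (Then (Assign yvar (eMu 21 22 n (candidateE ?m A n p))) (Write A (Var yvar) (Const 1)))
        (\<lambda>s'. ?I s' \<and> card {j. j < ?N \<and> snd s' A j = 0} < card {j. j < ?N \<and> snd (\<sigma>', \<alpha>') A j = 0}) (\<sigma>', \<alpha>')"
      using I y B unfolding s
      by (intro wp_Then wp_Assign wp_Write) (simp_all add: mu y_def[symmetric])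
  next
    fix \<sigma>' \<alpha>' assume "?I (\<sigma>', \<alpha>')" and h: "\<not> holds (eEx 21 n (candidateE ?m A n p (Var 21))) \<sigma>' \<alpha>'"
    then obtain v g where s: "\<sigma>' = \<sigma>(yvar := v)" "\<alpha>' = \<alpha>(A := g)"
      and g: "\<forall>j<?N. g j \<noteq> 0 \<longrightarrow> j \<in> reachable D" "g (init_state D) \<noteq> 0" by blast
    have closed: "\<not> cand g y" if "y < ?N" for y using h that unfolding s holds_ex by blast
    have "g (reach D w) \<noteq> 0" for w
    proof (induction w rule: rev_induct)
      case Nil
      then show ?case using g(2) by (simp add: reach_def)
    next
      case (snoc c w)
      obtain i where i: "i < ?m" "c = enum_class.enum ! i" by (rule letter_index)
      have "trans D (reach D w) c = reach D (w @ [c])" by (simp add: reach_def)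
      then show ?case
        using closed[OF reach_less[OF D, of "w @ [c]"]] snoc reach_less[OF D, of w] i unfolding cand_def
            by auto
    qed
    then have "g j \<noteq> 0 \<longleftrightarrow> j \<in> reachable D" if "j < ?N" for j using g(1) that by (auto simp: reachable_def)
    then show "Q (\<sigma>', \<alpha>')" unfolding s by (rule Q)
  qed
  have init: "?I (\<sigma>, \<alpha>(A := (\<alpha> A)(init_state D := 1)))"
    using zero init_reachable[of D] by (intro exI[of _ "\<sigma> yvar"] exI[of _ "(\<alpha> A)(init_state D := 1)"]) auto
  show ?thesis
    unfolding closureC_def
    by (intro wp_Then wp_Write loop) (use init tok(2) fresh_set in simp)
qed

section \<open>The outer loops and their invariants\<close>

definition lengthC :: "nat \<Rightarrow> bool \<Rightarrow> com" where
  "lengthC m b = Then (queryC m b)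
     (Then (Cond (eAnd (Var flag) (eAnd (Cell lead_arr (Var qvar)) (eLess (Var result) (Var kvar))))
        (Assign result (Var kvar)) Nop)
     (Assign kvar (Plus (Var kvar) (Const 1))))"

text \<open>Lengths are tried only up to the number of progress states, which suffices by
  \<open>chain_length_le\<close>. At the end \<open>pos\<close> is moved behind the acceptance bits,
  to the next progress automaton.\<close>

definition stateC :: "nat \<Rightarrow> bool \<Rightarrow> com" where
  "stateC m b = Then (Assign num_prog (tokenE (Var pos) (Const 0)))
     (Then (Assign row_len (Plus (Plus (Var num_lead) (Plus (Var num_prog) (Const 1)))
        (Times (Var num_prog) (Var num_prog))))
     (Then (Fill ivar prog_arr (Const 0) (Var num_prog) (Const 0))
     (Then (closureC m prog_arr (Var num_prog) (Var pos))
     (Then (Assign kvar (Const 1))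
     (Then (Loop (eLess (Var kvar) (Plus (Var num_prog) (Const 1))) (lengthC m b))
     (Then (Assign pos (Plus (table_endE m) (Var num_prog)))
       (Assign qvar (Plus (Var qvar) (Const 1)))))))))"

text \<open>Counts the \<open>x\<close> with \<open>2 * x + 1 < result\<close>, that is
  \<open>x < result div 2\<close>; expressions have no division.\<close>

definition halfE :: exp where
  "halfE = Sum 21 (Var result) (eFlag (eLess (Plus (Times (Const 2) (Var 21)) (Const 1)) (Var result)))"

text \<open>The remainder modulo 2 plus 1 is the tape symbol of the least significant bit.\<close>

definition outputC :: com where
  "outputC = Then (Assign ivar (Const 0)) (Loop (Var result)
     (Then (Write 1 (Var ivar) (Plus (Const 1) (Minus (Var result) (Times (Const 2) halfE))))
     (Then (Assign result halfE) (Assign ivar (Plus (Var ivar) (Const 1))))))"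

text \<open>The input length is found by scanning for the first blank, as both bits are written as
  nonzero symbols.\<close>

definition mainC :: "nat \<Rightarrow> bool \<Rightarrow> com" where
  "mainC m b = Then (Loop (Cell 0 (Var len)) (Assign len (Plus (Var len) (Const 1))))
     (Then (Assign num_lead (tokenE (Const 0) (Const 0)))
     (Then (closureC m lead_arr (Var num_lead) (Const 0))
     (Then (Assign pos (startE (Const 0) (Plus (Const 2) (Times (Var num_lead) (Const m)))))
     (Then (Loop (eLess (Var qvar) (Var num_lead)) (stateC m b)) outputC))))"

definition lead_store :: "'a::enum fdfa \<Rightarrow> store \<Rightarrow> bool" where
  "lead_store F s \<longleftrightarrow> (case s of (\<sigma>, \<alpha>) \<Rightarrow>
     stored (\<alpha> 0) 0 (encode_fdfa F) \<and> \<sigma> len = length (encode_fdfa F) \<and>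
     \<sigma> num_lead = num_states (leading F) \<and>
     (\<forall>j<num_states (leading F). \<alpha> lead_arr j \<noteq> 0 \<longleftrightarrow> j \<in> reachable (leading F)) \<and> (\<forall>i. \<alpha> 1 i = 0))"

text \<open>The two halves of maximality: \<open>attained\<close> says that the current result
  belongs to some chain, \<open>covered\<close> that no state treated so far has a longer one within
  the tested range.\<close>

definition attained :: "'a fdfa \<Rightarrow> bool \<Rightarrow> nat \<Rightarrow> bool" where
  "attained F b r \<longleftrightarrow> r = 0 \<or> (\<exists>q\<in>reachable (leading F). \<exists>w. chain_word F q b w r)"

definition covered :: "'a fdfa \<Rightarrow> bool \<Rightarrow> nat \<Rightarrow> nat \<Rightarrow> bool" where
  "covered F b q r \<longleftrightarrow> (\<forall>q'<q. q' \<in> reachable (leading F) \<longrightarrow>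
     (\<forall>w k. chain_word F q' b w k \<longrightarrow> k \<le> num_states (progress F q') \<longrightarrow> k \<le> r))"

definition state_inv :: "'a::enum fdfa \<Rightarrow> bool \<Rightarrow> store \<Rightarrow> bool" where
  "state_inv F b s \<longleftrightarrow> lead_store F s \<and> fst s qvar \<le> num_states (leading F) \<and>
     fst s pos = progress_position F (fst s qvar) \<and> fst s result \<le> length (encode_fdfa F) \<and>
     attained F b (fst s result) \<and> covered F b (fst s qvar) (fst s result)"

definition length_inv :: "'a::enum fdfa \<Rightarrow> bool \<Rightarrow> nat \<Rightarrow> store \<Rightarrow> bool" where
  "length_inv F b q s \<longleftrightarrow> lead_store F s \<and> progress_store F q s \<and>
     fst s kvar \<le> fst s num_prog + 1 \<and> fst s result \<le> length (encode_fdfa F) \<and>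
     attained F b (fst s result) \<and> covered F b q (fst s result) \<and>
     (q \<in> reachable (leading F) \<longrightarrow> (\<forall>w k. chain_word F q b w k \<longrightarrow> k < fst s kvar \<longrightarrow> k \<le> fst s result))"

text \<open>\<open>L\<close> bounds the row length for inputs of length \<open>w\<close>. The
  largest counter is the index that fills all \<open>2 * L + 2\<close> rows of \<open>L\<close>
  cells; the second summand covers row numbers and levels.\<close>

definition var_bound :: "nat \<Rightarrow> nat" where
  "var_bound w = (let L = w + (w + 1) + w * w in (2 * L + 2) * L + (2 * L + 2))"

lemma wp_lengthC:
  fixes F :: "'a::enum fdfa"
  assumes F: "is_fdfa F" and inv: "length_inv F b q (\<sigma>, \<alpha>)" and k: "\<sigma> kvar \<le> \<sigma> num_prog"
    and B: "B = var_bound (length (encode_fdfa F))"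
  shows "wp B (lengthC (letters TYPE('a)) b)
    (\<lambda>s'. length_inv F b q s' \<and> fst s' num_prog = \<sigma> num_prog \<and> fst s' kvar = Suc (\<sigma> kvar)) (\<sigma>, \<alpha>)"
proof -
  let ?w = "length (encode_fdfa F)"
  define L where "L = \<sigma> row_len"
  have ps: "progress_store F q (\<sigma>, \<alpha>)" and ls: "lead_store F (\<sigma>, \<alpha>)" using inv
      by (auto simp: length_inv_def)
  have st: "stored (\<alpha> 0) 0 (encode_fdfa F)" and q: "q < num_states (leading F)"
    using ps by (simp_all add: progress_store_def)
  have le: "\<sigma> num_lead \<le> ?w" "\<sigma> num_prog \<le> ?w"
    using encode_fdfa_stored[OF st refl] q ps by (auto simp: progress_store_def)
  define M where "M = ?w + (?w + 1) + ?w * ?w"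
  have L: "L \<le> M"
    using ps le unfolding progress_store_def L_def M_def by (auto intro!: add_mono mult_mono)
  have "(2 * L + 2) * L \<le> (2 * M + 2) * M" using L by (intro mult_le_mono) auto
  then have "(2 * L + 2) * L \<le> B" "2 * L + 2 \<le> B"
    using L unfolding B var_bound_def Let_def M_def[symmetric] by linarith+
  note LB = this
  have kB: "\<sigma> kvar + 1 \<le> B"
    using k le(2) LB(2) ps unfolding progress_store_def L_def by simp
  show ?thesis
    unfolding lengthC_def
  proof (rule wp_Then, rule wp_queryC[OF F ps refl k L_def LB])
    fix \<sigma>' \<alpha>' assume same: "same_context (\<sigma>, \<alpha>) (\<sigma>', \<alpha>')"
      and res: "\<sigma>' flag \<noteq> 0 \<longleftrightarrow> (\<exists>w. chain_word F q b w (\<sigma> kvar))"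
    have eq: "\<sigma>' len = \<sigma> len" "\<sigma>' num_lead = \<sigma> num_lead" "\<sigma>' qvar = \<sigma> qvar" "\<sigma>' pos = \<sigma> pos"
      "\<sigma>' num_prog = \<sigma> num_prog" "\<sigma>' row_len = \<sigma> row_len" "\<sigma>' kvar = \<sigma> kvar" "\<sigma>' result = \<sigma> result"
      "\<alpha>' 0 = \<alpha> 0" "\<alpha>' (Suc 0) = \<alpha> (Suc 0)" "\<alpha>' lead_arr = \<alpha> lead_arr" "\<alpha>' prog_arr = \<alpha> prog_arr"
      using same by (auto simp: same_context_def)
    have qv: "\<sigma> qvar = q" using ps by (simp add: progress_store_def)
    have lead: "\<alpha> lead_arr q \<noteq> 0 \<longleftrightarrow> q \<in> reachable (leading F)" using ls q by (simp add: lead_store_def)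
    \<comment> \<open>One claim for both branches of the conditional: \<open>r\<close> is the old
      result or the length just tried.\<close>
    have new: "length_inv F b q (\<sigma>'(result := r, kvar := Suc (\<sigma> kvar)), \<alpha>')"
      if "r = \<sigma> result \<or> r = \<sigma> kvar \<and> q \<in> reachable (leading F) \<and> (\<exists>w. chain_word F q b w (\<sigma> kvar))"
        "\<sigma> result \<le> r" "q \<in> reachable (leading F) \<Longrightarrow> \<exists>w. chain_word F q b w (\<sigma> kvar) \<Longrightarrow> \<sigma> kvar \<le> r" for r
      unfolding length_inv_def
    proof (intro conjI impI allI)
      show "lead_store F (\<sigma>'(result := r, kvar := Suc (\<sigma> kvar)), \<alpha>')"
        using ls by (simp add: lead_store_def eq)
      show "progress_store F q (\<sigma>'(result := r, kvar := Suc (\<sigma> kvar)), \<alpha>')"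
        using ps by (simp add: progress_store_def eq)
      show "fst (\<sigma>'(result := r, kvar := Suc (\<sigma> kvar)), \<alpha>') result \<le> ?w"
        using that(1) inv k le by (auto simp: length_inv_def)
      show "attained F b (fst (\<sigma>'(result := r, kvar := Suc (\<sigma> kvar)), \<alpha>') result)"
        using that(1) inv by (auto simp: length_inv_def attained_def)
      show "covered F b q (fst (\<sigma>'(result := r, kvar := Suc (\<sigma> kvar)), \<alpha>') result)"
        using that(2) inv unfolding length_inv_def covered_def by (auto intro: le_trans)
    next
      fix w k' assume h: "q \<in> reachable (leading F)" "chain_word F q b w k'"
        "k' < fst (\<sigma>'(result := r, kvar := Suc (\<sigma> kvar)), \<alpha>') kvar"
      show "k' \<le> fst (\<sigma>'(result := r, kvar := Suc (\<sigma> kvar)), \<alpha>') result"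
      proof (cases "k' = \<sigma> kvar")
        case True
        then show ?thesis using that(3) h by auto
      next
        case False
        then have "k' \<le> \<sigma> result" using inv h by (auto simp: length_inv_def)
        then show ?thesis using that(2) by simp
      qed
    qed (use k eq in simp)
    show "wp B (Then (Cond (eAnd (Var flag) (eAnd (Cell lead_arr (Var qvar)) (eLess (Var result) (Var
        kvar))))
        (Assign result (Var kvar)) Nop) (Assign kvar (Plus (Var kvar) (Const 1))))
      (\<lambda>s'. length_inv F b q s' \<and> fst s' num_prog = \<sigma> num_prog \<and> fst s' kvar = Suc (\<sigma> kvar)) (\<sigma>', \<alpha>')"
    proof (intro wp_Then wp_Cond)
      assume h: "holds (eAnd (Var flag) (eAnd (Cell lead_arr (Var qvar)) (eLess (Var result) (Var
          kvar)))) \<sigma>' \<alpha>'"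
      have "length_inv F b q (\<sigma>'(result := \<sigma> kvar, kvar := Suc (\<sigma> kvar)), \<alpha>')"
        using h res lead by (intro new) (auto simp: eq qv)
      then show "wp B (Assign result (Var kvar)) (wp B (Assign kvar (Plus (Var kvar) (Const 1)))
          (\<lambda>s'. length_inv F b q s' \<and> fst s' num_prog = \<sigma> num_prog \<and> fst s' kvar = Suc (\<sigma> kvar))) (\<sigma>', \<alpha>')"
        using kB by (intro wp_Assign) (simp_all add: eq)
    next
      assume h: "\<not> holds (eAnd (Var flag) (eAnd (Cell lead_arr (Var qvar)) (eLess (Var result) (Var
          kvar)))) \<sigma>' \<alpha>'"
      have "length_inv F b q (\<sigma>'(result := \<sigma> result, kvar := Suc (\<sigma> kvar)), \<alpha>')"
        using h res lead by (intro new) (auto simp: eq qv)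
      moreover have "\<sigma>'(result := \<sigma> result) = \<sigma>'" using eq by auto
      ultimately show "wp B Nop (wp B (Assign kvar (Plus (Var kvar) (Const 1)))
          (\<lambda>s'. length_inv F b q s' \<and> fst s' num_prog = \<sigma> num_prog \<and> fst s' kvar = Suc (\<sigma> kvar))) (\<sigma>', \<alpha>')"
        using kB by (intro wp_Nop wp_Assign) (simp_all add: eq)
    qed
  qed
qed

section \<open>The main program\<close>

lemma var_bound_ge: "w + (w + 1) + w * w \<le> var_bound w" "w + 1 \<le> var_bound w"
  unfolding var_bound_def Let_def by auto

lemma wp_stateC:
  fixes F :: "'a::enum fdfa"
  assumes F: "is_fdfa F" and inv: "state_inv F b (\<sigma>, \<alpha>)" and q: "\<sigma> qvar < num_states (leading F)"
    and B: "B = var_bound (length (encode_fdfa F))"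
  shows "wp B (stateC (letters TYPE('a)) b)
    (\<lambda>s'. state_inv F b s' \<and> fst s' qvar = Suc (\<sigma> qvar)) (\<sigma>, \<alpha>)"
proof -
  let ?w = "length (encode_fdfa F)" and ?m = "letters TYPE('a)"
  define q where "q = \<sigma> qvar"
  define n where "n = num_states (progress F q)"
  define N where "N = num_states (leading F)"
  have qN: "q < N" using q by (simp add: q_def N_def)
  have ls: "lead_store F (\<sigma>, \<alpha>)" and p: "\<sigma> pos = progress_position F q"
    and res: "\<sigma> result \<le> ?w" "attained F b (\<sigma> result)" "covered F b q (\<sigma> result)"
    using inv by (simp_all add: state_inv_def q_def)
  have st: "stored (\<alpha> 0) 0 (encode_fdfa F)" and v: "\<sigma> len = ?w" "\<sigma> num_lead = N"
    using ls by (simp_all add: lead_store_def N_def)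
  note enc = encode_fdfa_stored[OF st refl]
  have P: "encodes (\<alpha> 0) ?w (progress_position F q) (progress F q)" using enc(2) qN by (simp add: N_def)
  note tP = encodes_tokens[OF P]
  have complete: "complete_automaton (progress F q)" using F qN by (simp add: is_fdfa_def N_def)
  have le: "N \<le> ?w" "n \<le> ?w" using enc(6,7) qN by (simp_all add: N_def n_def)
  have LB: "N + (n + 1) + n * n \<le> B"
  proof -
    have "N + (n + 1) + n * n \<le> ?w + (?w + 1) + ?w * ?w" using le by (intro add_mono mult_mono) auto
    then show ?thesis using var_bound_ge(1)[of ?w] unfolding B by (rule le_trans)
  qed
  have wB: "?w + 1 \<le> B" using var_bound_ge(2) B by simp
  let ?Q = "\<lambda>s'. state_inv F b s' \<and> fst s' qvar = Suc (\<sigma> qvar)"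
  let ?tail = "Then (Assign pos (Plus (table_endE ?m) (Var num_prog))) (Assign qvar (Plus (Var qvar)
      (Const 1)))"
  have loop: "wp B (Loop (eLess (Var kvar) (Plus (Var num_prog) (Const 1))) (lengthC ?m b)) (wp B ?tail
      ?Q) s"
    if "length_inv F b q s" for s
  proof (rule wp_Loop[where I = "length_inv F b q" and f = "\<lambda>s. fst s num_prog + 1 - fst s kvar", OF that])
    fix \<sigma>' \<alpha>' assume i: "length_inv F b q (\<sigma>', \<alpha>')" and h: "holds (eLess (Var kvar) (Plus (Var num_prog)
        (Const 1))) \<sigma>' \<alpha>'"
    have "\<sigma>' kvar \<le> \<sigma>' num_prog" using h by simp
    from wp_lengthC[OF F i this B]
    show "wp B (lengthC ?m b) (\<lambda>s'. length_inv F b q s' \<and> fst s' num_prog + 1 - fst s' kvar <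
        fst (\<sigma>', \<alpha>') num_prog + 1 - fst (\<sigma>', \<alpha>') kvar) (\<sigma>', \<alpha>')"
      by (rule wp_mono) (use \<open>\<sigma>' kvar \<le> \<sigma>' num_prog\<close> in auto)
  next
    fix \<sigma>' \<alpha>' assume i: "length_inv F b q (\<sigma>', \<alpha>')" and h: "\<not> holds (eLess (Var kvar) (Plus (Var
        num_prog) (Const 1))) \<sigma>' \<alpha>'"
    have ps: "progress_store F q (\<sigma>', \<alpha>')" and ls': "lead_store F (\<sigma>', \<alpha>')" using i
        by (simp_all add: length_inv_def)
    have k: "\<sigma>' kvar = \<sigma>' num_prog + 1" using h i by (simp add: length_inv_def)
    have n': "\<sigma>' num_prog = n" "\<sigma>' qvar = q" "\<sigma>' pos = progress_position F q" "\<sigma>' len = ?w"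
      using ps by (simp_all add: progress_store_def n_def)
    have st': "stored (\<alpha>' 0) 0 (encode_fdfa F)" using ps by (simp add: progress_store_def)
    note enc' = encode_fdfa_stored[OF st' refl]
    have "encodes (\<alpha>' 0) ?w (progress_position F q) (progress F q)" using enc'(2) qN by (simp add: N_def)
    note tP' = encodes_tokens(4)[OF this]
    have val: "val (Plus (table_endE ?m) (Var num_prog)) \<sigma>' \<alpha>' = progress_position F (Suc q)"
      using tP' by (simp add: table_endE_def n' n_def enc'(4))
    have pw: "progress_position F (Suc q) \<le> ?w" using enc'(5)[of "Suc q"] qN by (simp add: N_def)
    \<comment> \<open>At the exit \<open>kvar\<close> is \<open>n + 1\<close>, so all lengths up to
      \<open>n\<close> have been tried for \<open>q\<close>.\<close>
    have "covered F b (Suc q) (\<sigma>' result)"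
    proof -
      have "covered F b q (\<sigma>' result)"
        "q \<in> reachable (leading F) \<Longrightarrow> chain_word F q b w k' \<Longrightarrow> k' < n + 1 \<Longrightarrow> k' \<le> \<sigma>' result" for w k'
        using i by (simp_all add: length_inv_def k n')
      then show ?thesis unfolding covered_def n_def by (metis le_imp_less_Suc less_SucE Suc_eq_plus1)
    qed
    then have "state_inv F b (\<sigma>'(pos := progress_position F (Suc q), qvar := Suc q), \<alpha>')"
      using i ls' qN unfolding state_inv_def length_inv_def by (simp add: lead_store_def N_def)
    then show "wp B ?tail ?Q (\<sigma>', \<alpha>')"
      by (intro wp_Then wp_Assign, unfold val) (use pw wB qN le in \<open>simp_all add: n' q_def[symmetric]\<close>)
  qed
  show ?thesis
    unfolding stateC_def
  proof (rule wp_Then, rule wp_Assign)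
    have val: "val (tokenE (Var pos) (Const 0)) \<sigma> \<alpha> = n" using tP(1) by (simp add: p v n_def)
    show "val (tokenE (Var pos) (Const 0)) \<sigma> \<alpha> \<le> B" unfolding val using le wB by simp
    let ?\<sigma> = "\<sigma>(num_prog := n, row_len := N + (n + 1) + n * n, ivar := n)"
    let ?\<alpha> = "\<alpha>(prog_arr := \<lambda>p. if p < n then 0 else \<alpha> prog_arr p)"
    have closed: "wp B (closureC ?m prog_arr (Var num_prog) (Var pos)) (wp B (Then (Assign kvar (Const 1))
        (Then (Loop (eLess (Var kvar) (Plus (Var num_prog) (Const 1))) (lengthC ?m b)) ?tail)) ?Q) (?\<sigma>, ?\<alpha>)"
    proof (rule wp_closureC[OF complete])
      show "encodes (?\<alpha> 0) (?\<sigma> len) (val (Var pos) ?\<sigma> ?\<alpha>) (progress F q)" using P by (simp add: v p)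
      fix y and g :: "nat \<Rightarrow> nat" assume g: "\<And>j. j < num_states (progress F q) \<Longrightarrow> g j \<noteq> 0 \<longleftrightarrow>
          j \<in> reachable (progress F q)"
      have "length_inv F b q (?\<sigma>(yvar := y, kvar := 1), ?\<alpha>(prog_arr := g))"
        unfolding length_inv_def
        using res ls qN g p v st by (simp add: lead_store_def progress_store_def N_def n_def q_def)
      then show "wp B (Then (Assign kvar (Const 1))
        (Then (Loop (eLess (Var kvar) (Plus (Var num_prog) (Const 1))) (lengthC ?m b)) ?tail)) ?Q
        (?\<sigma>(yvar := y), ?\<alpha>(prog_arr := g))"
        using wB by (intro wp_Then[of B "Assign kvar _"] wp_Assign wp_Then[of B "Loop _ _"] loop) simp_all
    qed (use le wB n_def in auto)
    show "wp B (Then (Assign row_len (Plus (Plus (Var num_lead) (Plus (Var num_prog) (Const 1))) (Times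
        (Var num_prog) (Var num_prog))))
     (Then (Fill ivar prog_arr (Const 0) (Var num_prog) (Const 0))
     (Then (closureC ?m prog_arr (Var num_prog) (Var pos))
     (Then (Assign kvar (Const 1))
     (Then (Loop (eLess (Var kvar) (Plus (Var num_prog) (Const 1))) (lengthC ?m b)) ?tail)))))
     ?Q (\<sigma>(num_prog := val (tokenE (Var pos) (Const 0)) \<sigma> \<alpha>), \<alpha>)"
      unfolding val
      apply (rule wp_Then, rule wp_Assign)
      subgoal using LB v by simp
      apply (rule wp_Then, rule wp_Fill)
      apply simp_all
      subgoal using le wB by simp
      apply (rule wp_Then)
      using closed by (simp add: v cong: if_cong)
  qed
qed

lemma val_halfE [simp]: "val halfE \<sigma> \<alpha> = \<sigma> result div 2"
proof -
  have "val halfE \<sigma> \<alpha> = (\<Sum>x<\<sigma> result. of_bool (x < \<sigma> result div 2))"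
  proof -
    have "Suc (2 * x) < k \<longleftrightarrow> x < k div 2" for x k :: nat by presburger
    then show ?thesis unfolding halfE_def by simp
  qed
  then show ?thesis by (simp only: sum_of_bool_less div_le_dividend)
qed

lemma wp_outputC:
  assumes r: "\<sigma> result = r" "r + 1 \<le> B" and out: "\<And>i. \<alpha> 1 i = 0"
    and Q: "\<And>\<sigma>' \<alpha>'. (\<And>i. i < length (binary r) \<Longrightarrow> \<alpha>' 1 i = bit_symbol (binary r ! i)) \<Longrightarrow>
      \<alpha>' 1 (length (binary r)) = 0 \<Longrightarrow> Q (\<sigma>', \<alpha>')"
  shows "wp B outputC Q (\<sigma>, \<alpha>)"
proof -
  \<comment> \<open>\<open>ys\<close> is the part of the output already written;
    \<open>result\<close> holds the number whose binary notation is still to come. The inequality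
    keeps \<open>ivar\<close> within the bound.\<close>
  let ?I = "\<lambda>s. \<exists>ys. binary r = ys @ binary (fst s result) \<and> fst s ivar = length ys \<and>
     length ys + fst s result \<le> r \<and> (\<forall>i<length ys. snd s 1 i = bit_symbol (ys ! i)) \<and>
     (\<forall>i\<ge>length ys. snd s 1 i = 0)"
  let ?body = "Then (Write 1 (Var ivar) (Plus (Const 1) (Minus (Var result) (Times (Const 2) halfE))))
     (Then (Assign result halfE) (Assign ivar (Plus (Var ivar) (Const 1))))"
  have loop: "wp B (Loop (Var result) ?body) Q s" if "?I s" for s
  proof (rule wp_Loop[where I = ?I and f = "\<lambda>s. fst s result", OF that])
    fix \<sigma>' \<alpha>' assume "?I (\<sigma>', \<alpha>')" "holds (Var result) \<sigma>' \<alpha>'"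
    then obtain ys where ys: "binary r = ys @ binary (\<sigma>' result)" "\<sigma>' ivar = length ys"
      "length ys + \<sigma>' result \<le> r" "\<forall>i<length ys. \<alpha>' 1 i = bit_symbol (ys ! i)" "\<forall>i\<ge>length ys. \<alpha>' 1 i = 0"
      and nz: "\<sigma>' result \<noteq> 0" by auto
    define x where "x = \<sigma>' result"
    have half: "x div 2 < x" "x div 2 + 1 \<le> x" using nz by (simp_all add: x_def)
    have sym: "min (Suc (x - 2 * (x div 2))) 2 = bit_symbol (odd x)"
      by (cases "even x") (auto simp: bit_symbol_def elim!: evenE oddE)
    let ?s = "(\<sigma>'(result := x div 2, ivar := Suc (length ys)), \<alpha>'(1 := (\<alpha>' 1)(length ys := bit_symbol
        (odd x))))"
    have "?I ?s"
    proof (intro exI[of _ "ys @ [odd x]"] conjI)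
      show "binary r = (ys @ [odd x]) @ binary (fst ?s result)"
        using ys(1) binary.simps[of x] nz by (simp add: x_def)
      show "length (ys @ [odd x]) + fst ?s result \<le> r" using ys(3) half by (simp add: x_def)
    qed (use ys in \<open>auto simp: nth_append less_Suc_eq\<close>)
    then show "wp B ?body (\<lambda>s'. ?I s' \<and> fst s' result < fst (\<sigma>', \<alpha>') result) (\<sigma>', \<alpha>')"
      using half ys(2,3) r sym
      by (intro wp_Then wp_Write wp_Assign) (simp_all add: x_def[symmetric])
  next
    fix \<sigma>' \<alpha>' assume "?I (\<sigma>', \<alpha>')" "\<not> holds (Var result) \<sigma>' \<alpha>'"
    then obtain ys where ys: "binary r = ys @ binary 0"
      "\<forall>i<length ys. \<alpha>' 1 i = bit_symbol (ys ! i)" "\<forall>i\<ge>length ys. \<alpha>' 1 i = 0" by auto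
    have "binary 0 = []" by (simp add: binary.simps)
    then show "Q (\<sigma>', \<alpha>')" using ys by (intro Q) auto
  qed
  show ?thesis
    unfolding outputC_def
    by (intro wp_Then wp_Assign loop) (use r out in \<open>auto intro!: exI[of _ "[]"]\<close>)
qed

lemma wp_mainC:
  fixes F :: "'a::enum fdfa"
  assumes F: "is_fdfa F" "saturated F" and B: "B = var_bound (length (encode_fdfa F))"
  shows "wp B (mainC (letters TYPE('a)) b) (\<lambda>s. \<exists>r. signed_diameter b F = enat r \<and>
    (\<forall>i<length (binary r). snd s 1 i = bit_symbol (binary r ! i)) \<and> snd s 1 (length (binary r)) = 0)
    (input_store (encode_fdfa F))" (is "wp B _ ?Q _")
proof -
  let ?x = "encode_fdfa F" and ?m = "letters TYPE('a)"
  let ?w = "length ?x"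
  define N where "N = num_states (leading F)"
  define \<alpha> where "\<alpha> = snd (input_store ?x)"
  have \<alpha>: "\<alpha> 0 i = (if i < ?w then bit_symbol (?x ! i) else 0)" "j \<noteq> 0 \<Longrightarrow> \<alpha> j i = 0" for i j
    by (simp_all add: \<alpha>_def input_store_def)
  have st: "stored (\<alpha> 0) 0 ?x" by (simp add: stored_def \<alpha>)
  note enc = encode_fdfa_stored[OF st refl]
  note tQ = encodes_tokens[OF enc(1)]
  have complete: "complete_automaton (leading F)" using F by (simp add: is_fdfa_def)
  have le: "N \<le> ?w" using enc(6) by (simp add: N_def)
  have wB: "?w + 1 \<le> B" using var_bound_ge(2) B by simp
  have states: "wp B (Then (Loop (eLess (Var qvar) (Var num_lead)) (stateC ?m b)) outputC) ?Q s"
    if "state_inv F b s" for s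
  proof (rule wp_Then, rule wp_Loop[where I = "state_inv F b" and f = "\<lambda>s. N - fst s qvar", OF that])
    fix \<sigma> \<alpha> assume i: "state_inv F b (\<sigma>, \<alpha>)" and h: "holds (eLess (Var qvar) (Var num_lead)) \<sigma> \<alpha>"
    have q: "\<sigma> qvar < num_states (leading F)" using h i by (simp add: state_inv_def lead_store_def)
    show "wp B (stateC ?m b) (\<lambda>s'. state_inv F b s' \<and> N - fst s' qvar < N - fst (\<sigma>, \<alpha>) qvar) (\<sigma>, \<alpha>)"
      by (rule wp_mono[OF wp_stateC[OF F(1) i q B]]) (use q in \<open>auto simp: N_def\<close>)
  next
    fix \<sigma> \<alpha> assume i: "state_inv F b (\<sigma>, \<alpha>)" and h: "\<not> holds (eLess (Var qvar) (Var num_lead)) \<sigma> \<alpha>"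
    have "\<sigma> qvar = N" using h i by (simp add: state_inv_def lead_store_def N_def)
    then have "signed_diameter b F = enat (\<sigma> result)"
      using i reach_less[OF complete] unfolding state_inv_def attained_def covered_def
      by (intro signed_diameter_eqI[OF F]) (auto simp: reachable_def N_def)
    moreover have "\<sigma> result + 1 \<le> B" "\<And>i. \<alpha> 1 i = 0"
      using i wB by (auto simp: state_inv_def lead_store_def)
    ultimately show "wp B outputC ?Q (\<sigma>, \<alpha>)" by (intro wp_outputC[OF refl]) auto
  qed
  have lead: "wp B (closureC ?m lead_arr (Var num_lead) (Const 0))
      (wp B (Then (Assign pos (startE (Const 0) (Plus (Const 2) (Times (Var num_lead) (Const ?m)))))
        (Then (Loop (eLess (Var qvar) (Var num_lead)) (stateC ?m b)) outputC)) ?Q)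
      ((\<lambda>_. 0)(len := ?w, num_lead := N), \<alpha>)"
  proof (rule wp_closureC[OF complete])
    fix v and g :: "nat \<Rightarrow> nat" assume g: "\<And>j. j < num_states (leading F) \<Longrightarrow> g j \<noteq> 0 \<longleftrightarrow>
        j \<in> reachable (leading F)"
    let ?\<sigma> = "(\<lambda>_. 0)(len := ?w, num_lead := N, yvar := v)" and ?\<alpha> = "\<alpha>(lead_arr := g)"
    have val: "val (startE (Const 0) (Plus (Const 2) (Times (Var num_lead) (Const ?m)))) ?\<sigma> ?\<alpha> =
        progress_position F 0"
      using tQ(4) by (simp add: N_def progress_position_def)
    have "state_inv F b (?\<sigma>(pos := progress_position F 0), ?\<alpha>)"
      unfolding state_inv_def lead_store_def using st g \<alpha>(2)
      by (simp add: attained_def covered_def N_def)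
    then show "wp B (Then (Assign pos (startE (Const 0) (Plus (Const 2) (Times (Var num_lead) (Const ?m)))))
        (Then (Loop (eLess (Var qvar) (Var num_lead)) (stateC ?m b)) outputC)) ?Q (?\<sigma>, ?\<alpha>)"
      using enc(5)[of 0] wB by (intro wp_Then[of B "Assign _ _"] wp_Assign states, unfold val) simp_all
  qed (use enc(1) \<alpha> le wB in \<open>auto simp: N_def\<close>)
  have scan: "wp B (Loop (Cell 0 (Var len)) (Assign len (Plus (Var len) (Const 1))))
      (\<lambda>s. s = ((\<lambda>_. 0)(len := ?w), \<alpha>)) (\<lambda>_. 0, \<alpha>)"
  proof (rule wp_Loop[where I = "\<lambda>s. \<exists>i\<le>?w. s = ((\<lambda>_. 0)(len := i), \<alpha>)" and f = "\<lambda>s. ?w - fst s len"])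
    show "\<exists>i\<le>?w. (\<lambda>_. 0, \<alpha>) = ((\<lambda>_. 0)(len := i), \<alpha>)" by (intro exI[of _ 0]) auto
    fix \<sigma> \<alpha>' assume "\<exists>i\<le>?w. (\<sigma>, \<alpha>') = ((\<lambda>_. 0)(len := i), \<alpha>)"
    then obtain i where i: "i \<le> ?w" "\<sigma> = (\<lambda>_. 0)(len := i)" "\<alpha>' = \<alpha>" by auto
    { assume "holds (Cell 0 (Var len)) \<sigma> \<alpha>'"
      then have "i < ?w" using i \<alpha>(1)[of i] by (auto split: if_splits)
      then show "wp B (Assign len (Plus (Var len) (Const 1)))
          (\<lambda>s'. (\<exists>i\<le>?w. s' = ((\<lambda>_. 0)(len := i), \<alpha>)) \<and> ?w - fst s' len < ?w - fst (\<sigma>, \<alpha>') len) (\<sigma>, \<alpha>')"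
        using i wB by (intro wp_Assign) (auto intro!: exI[of _ "Suc i"]) }
    { assume "\<not> holds (Cell 0 (Var len)) \<sigma> \<alpha>'"
      then have "\<not> i < ?w" using i \<alpha>(1)[of i] by (auto simp: bit_symbol_def split: if_splits)
      then show "(\<sigma>, \<alpha>') = ((\<lambda>_. 0)(len := ?w), \<alpha>)" using i by simp }
  qed
  have input: "input_store ?x = (\<lambda>_. 0, \<alpha>)" by (simp add: \<alpha>_def input_store_def)
  have N: "val (tokenE (Const 0) (Const 0)) ((\<lambda>_. 0)(len := ?w)) \<alpha> = N"
    using tQ(1) by (simp add: N_def)
  show ?thesis
    unfolding mainC_def input
  proof (rule wp_Then, rule wp_mono[OF scan])
    fix s assume s: "s = ((\<lambda>_. 0)(len := ?w), \<alpha>)"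
    show "wp B (Then (Assign num_lead (tokenE (Const 0) (Const 0)))
     (Then (closureC ?m lead_arr (Var num_lead) (Const 0))
     (Then (Assign pos (startE (Const 0) (Plus (Const 2) (Times (Var num_lead) (Const ?m)))))
     (Then (Loop (eLess (Var qvar) (Var num_lead)) (stateC ?m b)) outputC)))) ?Q s"
      unfolding s
      by (rule wp_Then, rule wp_Assign, unfold N, use le wB in simp, rule wp_Then, rule lead)
  qed
qed

text \<open>Tapes 0 to 5 are the arrays, 6 to 33 the variables, and the scratch counters start at
  34.\<close>

lemma wf_mainC: "wf_com 6 34 (mainC m b)"
  by (simp add: mainC_def stateC_def lengthC_def outputC_def closureC_def candidateE_def queryC_def
      prepareC_def endpointsE_def savitchC_def advanceC_def leafC_def edgeE_def closesE_def Fill_def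
      halfE_def table_endE_def finalE_def leadE_def progE_def matE_def rowE_def Let_def)

section \<open>Length of the encoding and the final polynomial\<close>

lemma length_encode_automaton:
  fixes A :: "('a::enum, 'z) automaton_scheme"
  assumes A: "complete_automaton A" and c: "num_states A \<le> c"
  shows "length (encode_automaton A) \<le> 2 * (c + 1) + c * (letters TYPE('a) * (c + 1))"
proof -
  have trans: "trans A q a \<le> c" if "q < num_states A" for q a
    using A c that unfolding complete_automaton_def by (meson less_imp_le less_le_trans)
  have "length (concat (concat (map (\<lambda>q. map (\<lambda>a. encode_nat (trans A q a)) enum_class.enum) [0..<k])))
      \<le> k * (letters TYPE('a) * (c + 1))" if "k \<le> num_states A" for k
    using that
  proof (induction k)
    case (Suc k)
    have "length (encode_nat (trans A k a)) \<le> c + 1" for a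
      using trans[of k a] Suc.prems by (simp add: encode_nat_def)
    then have "length (concat (map (\<lambda>a. encode_nat (trans A k a)) as)) \<le> length as * (c + 1)" for as
    proof (induction as)
      case (Cons a as)
      show ?case using add_mono[OF Cons.prems[of a] Cons.IH[OF Cons.prems]] by simp
    qed simp
    from this[of enum_class.enum] Suc show ?case by simp
  qed simp
  from this[of "num_states A"]
  have "length (concat (concat (map (\<lambda>q. map (\<lambda>a. encode_nat (trans A q a)) enum_class.enum)
      [0..<num_states A])))
      \<le> c * (letters TYPE('a) * (c + 1))"
    using c by (meson le_trans mult_le_mono1 order_refl)
  moreover have "init_state A \<le> c" using A c by (auto simp: complete_automaton_def)
  ultimately show ?thesis using c by (simp add: encode_automaton_def encode_nat_def)
qed

text \<open>The machine measures its input by the length of a unary encoding, whereas space is to be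
  polynomial in \<open>fdfa_size\<close>. Every number in the encoding is at most \<open>c\<close>,
  and there are at most \<open>c + 1\<close> automata.\<close>

lemma length_encode_fdfa:
  fixes F :: "'a::enum fdfa"
  assumes F: "is_fdfa F" and c: "c = fdfa_size F"
  shows "length (encode_fdfa F) \<le> (c + 1) * (2 * (c + 1) + c * (letters TYPE('a) * (c + 1)) + c)"
proof -
  let ?E = "2 * (c + 1) + c * (letters TYPE('a) * (c + 1))" and ?N = "num_states (leading F)"
  have N: "?N \<le> c" by (simp add: c fdfa_size_def)
  have lead: "length (encode_automaton (leading F)) \<le> ?E"
    using F N by (intro length_encode_automaton) (simp_all add: is_fdfa_def)
  have prog: "length (encode_dfa (progress F q)) \<le> ?E + c" if "q < ?N" for q
  proof -
    have "num_states (progress F q) \<le> (\<Sum>q<?N. num_states (progress F q))"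
      using that by (intro member_le_sum) auto
    then have n: "num_states (progress F q) \<le> c" by (simp add: c fdfa_size_def)
    then have "length (encode_automaton (progress F q)) \<le> ?E"
      using F that by (intro length_encode_automaton) (simp_all add: is_fdfa_def)
    then show ?thesis using n by (simp add: encode_dfa_def)
  qed
  have "length (concat (map (\<lambda>q. encode_dfa (progress F q)) [0..<k])) \<le> k * (?E + c)" if "k \<le> ?N" for k
    using that
  proof (induction k)
    case (Suc k)
    then show ?case using prog[of k] by simp
  qed simp
  from this[of ?N] have "length (concat (map (\<lambda>q. encode_dfa (progress F q)) [0..<?N])) \<le> c * (?E + c)"
    using N by (meson le_trans mult_le_mono1 order_refl)
  then show ?thesis using lead by (simp add: encode_fdfa_def)
qed

lemma computes_in_space_mono: "computes_in_space M x y s \<Longrightarrow> s \<le> s' \<Longrightarrow> computes_in_space M x y s'"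
  unfolding computes_in_space_def by (meson le_trans)

text \<open>\<open>[:1, 2, 1:]\<close> is \<open>w + (w + 1) + w * w\<close>, the bound on the row
  length.\<close>

definition var_bound_poly :: "nat poly" where
  "var_bound_poly = (let L = [:1, 2, 1:] in ([:2:] * L + [:2:]) * L + ([:2:] * L + [:2:]))"

lemma poly_var_bound: "poly var_bound_poly w = var_bound w"
proof -
  have "poly [:1, 2, 1:] w = w + (w + 1) + w * w" by (simp add: algebra_simps)
  then show ?thesis by (simp only: var_bound_poly_def var_bound_def Let_def poly_add poly_mult) simp
qed

definition length_poly :: "nat \<Rightarrow> nat poly" where
  "length_poly m = [:1, 1:] * ([:2:] * [:1, 1:] + [:0, 1:] * ([:m:] * [:1, 1:]) + [:0, 1:])"

lemma poly_length_poly: "poly (length_poly m) c = (c + 1) * (2 * (c + 1) + c * (m * (c + 1)) + c)"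
proof -
  have "poly [:1, 1:] c = c + 1" "poly [:0, 1:] c = c" "poly [:2:] c = 2" "poly [:m:] c = m" by simp_all
  then show ?thesis by (simp only: length_poly_def poly_add poly_mult)
qed

lemma signed_diameter_computable:
  "poly_space_computable encode_fdfa fdfa_size
     {F :: 'a::enum fdfa. is_fdfa F \<and> saturated F} (signed_diameter b)"
proof -
  let ?m = "letters TYPE('a)"
  define C where "C = mainC ?m b"
  define M where "M = machine (compile 34 C)"
  define k where "k = machine_tapes (compile 34 C)"
  \<comment> \<open>The bounds compose: size of the automaton, length of the encoding, values of
    variables, values of all counters, and finally cells on \<open>k\<close> tapes.\<close>
  define p where "p = [:k:] * (pcompose (com_bound C) (pcompose var_bound_poly (length_poly ?m)) + [:2:])"
  show ?thesis
    unfolding poly_space_computable_def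
  proof (intro exI[of _ M] exI[of _ p] conjI ballI)
    show "turing_machine M" unfolding M_def by (rule turing_machine_machine)
    fix F :: "'a fdfa" assume "F \<in> {F. is_fdfa F \<and> saturated F}"
    then have F: "is_fdfa F" "saturated F" by auto
    let ?x = "encode_fdfa F"
    define B where "B = var_bound (length ?x)"
    obtain r s where r: "signed_diameter b F = enat r" and run: "big_step B C (input_store ?x) s"
      and out: "\<And>i. i < length (binary r) \<Longrightarrow> snd s 1 i = bit_symbol (binary r ! i)" "snd s 1 (length
          (binary r)) = 0"
      using wp_mainC[OF F B_def, of b] unfolding wp_def C_def by blast
    have "clean_store 6 34 B (input_store ?x)"
      by (auto simp: clean_store_def input_store_def small_cells_def bounded_vars_def scratch_clear_def
          bit_symbol_def)
    then have "exec (poly (com_bound C) B) (compile 34 C) (input_store ?x) s"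
      by (intro exec_compile[OF run, where na = 6]) (simp_all add: C_def wf_mainC)
    from exec_computes_in_space[OF this out]
    have "computes_in_space M ?x (binary r) (k * (poly (com_bound C) B + 2))"
      unfolding M_def k_def by blast
    moreover have "B \<le> poly (pcompose var_bound_poly (length_poly ?m)) (fdfa_size F)"
    proof -
      have "length ?x \<le> poly (length_poly ?m) (fdfa_size F)"
        unfolding poly_length_poly by (rule length_encode_fdfa[OF F(1) refl])
      then show ?thesis
        unfolding B_def poly_var_bound[symmetric] poly_pcompose by (rule poly_nat_mono)
    qed
    then have "k * (poly (com_bound C) B + 2) \<le> poly p (fdfa_size F)"
      by (simp add: p_def poly_pcompose[of "com_bound C"] poly_nat_mono)
    ultimately show "\<exists>k. signed_diameter b F = enat k \<and>
        computes_in_space M ?x (binary k) (poly p (fdfa_size F))"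
      using r computes_in_space_mono by blast
  qed
qed

theorem theorem17:
  shows "poly_space_computable encode_fdfa fdfa_size
           {F :: 'a::enum fdfa. is_fdfa F \<and> saturated F} positive_diameter
       \<and> poly_space_computable encode_fdfa fdfa_size
           {F :: 'a::enum fdfa. is_fdfa F \<and> saturated F} negative_diameter"
proof -
  have "signed_diameter True = positive_diameter" "signed_diameter False = negative_diameter"
    by (simp_all add: fun_eq_iff signed_diameter)
  then show ?thesis using signed_diameter_computable[where b = True] signed_diameter_computable[where b
      = False] by metis
qed

end
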